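(* For every fixed integer $(r,s)\times t$ bimatrix $A$, there is an algorithm that, given a positive integer $n$ and vectors $w,l,u\in\mathbb{Z}^{nt}$ and $b\in\mathbb{Z}^{r+ns}$ having binary encoding length $L:=\langle w,b,l,u\rangle$, solves in time $O(n^3L)$ the $n$-fold integer programming problem $$\min\left\{wx\ :\ A^{(n)}x=b,\ l\leq x\leq u,\ x\in\mathbb{Z}^{nt}\right\}.$$
   Context: An $(r,s)\times t$ bimatrix $A$ is an $(r+s)\times t$ matrix viewed as consisting of two blocks: $A_1$, its $r\times t$ submatrix of the first $r$ rows, and $A_2$, its $s\times t$ submatrix of the last $s$ rows. Its $n$-fold product is the $(r+ns)\times nt$ matrix $$A^{(n)}:=\begin{pmatrix} A_1&A_1&\cdots&A_1\\ A_2&0&\cdots&0\\ 0&A_2&\cdots&0\\ \vdots&\vdots&\ddots&\vdots\\ 0&0&\cdots&A_2\end{pmatrix}.$$ Here $wx$ denotes the inner product. The binary length $\langle z\rangle$ of an integer $z$ is the number of bits in its binary encoding; the binary length of an integer vector (or list of vectors) is the sum of the binary lengths of its entries. "Solves" means that the algorithm either finds an optimal solution or asserts that there is no feasible point. "Time" is the number of arithmetic operations (additions, multiplications, divisions, comparisons) performed, as in the real arithmetic model of computation. The constant hidden in $O(\cdot)$ depends only on the fixed bimatrix $A$. *)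

theory Defs
  imports Complex_Main "Jordan_Normal_Form.Matrix"
begin

section \<open>N-fold integer programs\<close>

text \<open>An (r,s) x t bimatrix is an (r+s) x t matrix \<open>A\<close> together with the numbers \<open>r\<close> and \<open>s\<close>.\<close>

definition upper_block :: "nat \<Rightarrow> int mat \<Rightarrow> int mat" where
  "upper_block r A = mat r (dim_col A) (\<lambda>(i, j). A $$ (i, j))"

definition lower_block :: "nat \<Rightarrow> nat \<Rightarrow> int mat \<Rightarrow> int mat" where
  "lower_block r s A = mat s (dim_col A) (\<lambda>(i, j). A $$ (r + i, j))"

text \<open>Below its first \<open>r\<close> rows the product is block diagonal: the entry at row \<open>r + i\<close> and column
  \<open>j\<close> belongs to block row \<open>i div s\<close> and block column \<open>j div t\<close>.\<close>

definition nfold_product :: "nat \<Rightarrow> nat \<Rightarrow> nat \<Rightarrow> int mat \<Rightarrow> nat \<Rightarrow> int mat" where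
  "nfold_product r s t A n = mat (r + n * s) (n * t) (\<lambda>(i, j).
     if i < r then upper_block r A $$ (i, j mod t)
     else if (i - r) div s = j div t then lower_block r s A $$ ((i - r) mod s, j mod t)
     else 0)"

definition nfold_feasible ::
  "nat \<Rightarrow> nat \<Rightarrow> nat \<Rightarrow> int mat \<Rightarrow> nat \<Rightarrow> int vec \<Rightarrow> int vec \<Rightarrow> int vec \<Rightarrow> int vec set" where
  "nfold_feasible r s t A n b l u =
     {x \<in> carrier_vec (n * t). nfold_product r s t A n *\<^sub>v x = b \<and> l \<le> x \<and> x \<le> u}"

definition nfold_optimal ::
  "nat \<Rightarrow> nat \<Rightarrow> nat \<Rightarrow> int mat \<Rightarrow> nat \<Rightarrow> int vec \<Rightarrow> int vec \<Rightarrow> int vec \<Rightarrow> int vec \<Rightarrow> int vec \<Rightarrow> bool" where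
  "nfold_optimal r s t A n w b l u x \<longleftrightarrow>
     is_arg_min (\<lambda>y. w \<bullet> y) (\<lambda>y. y \<in> nfold_feasible r s t A n b l u) x"


section \<open>Binary length\<close>

text \<open>The leading 1 is the sign bit; in particular the integer 0 has length 1.\<close>

definition binary_length :: "int \<Rightarrow> nat" where
  "binary_length z = 1 + nat \<lceil>log 2 (real_of_int (\<bar>z\<bar> + 1))\<rceil>"

definition binary_length_vec :: "int vec \<Rightarrow> nat" where
  "binary_length_vec v = (\<Sum>i<dim_vec v. binary_length (v $ i))"


section \<open>Real arithmetic model of computation\<close>

text \<open>A program is a finite piece of syntax, hence independent of the size of its input. Its memory
  is an unbounded array of real numbers. There is no rounding operation, and program constants are
  integers, so that no information can be hidden in them.\<close>

datatype expr =
    Const int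
  | Cell expr  \<comment> \<open>indirect addressing: the contents of the cell whose address is given\<close>
  | Add expr expr
  | Sub expr expr
  | Mul expr expr
  | Div expr expr

datatype program =
    Skip
  | Store expr expr  \<comment> \<open>address of the cell written to, new contents\<close>
  | Seq program program
  | If_Le expr expr program program  \<comment> \<open>tests whether the first value is at most the second\<close>
  | While_Le expr expr program

type_synonym memory = "nat \<Rightarrow> real"

definition address :: "real \<Rightarrow> nat" where
  "address v = nat \<lfloor>v\<rfloor>"

primrec val :: "expr \<Rightarrow> memory \<Rightarrow> real" where
  "val (Const k) m = of_int k"
| "val (Cell a) m = m (address (val a m))"
| "val (Add a b) m = val a m + val b m"
| "val (Sub a b) m = val a m - val b m"
| "val (Mul a b) m = val a m * val b m"
| "val (Div a b) m = val a m / val b m"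

text \<open>Evaluation gets stuck at an address that is not a natural number and on division by zero. The
  former is essential: rounding addresses (or mapping bad ones to a default cell) would let a program
  compute integer parts and parities of large numbers in constant time.\<close>

primrec well_defined :: "expr \<Rightarrow> memory \<Rightarrow> bool" where
  "well_defined (Const k) m \<longleftrightarrow> True"
| "well_defined (Cell a) m \<longleftrightarrow> well_defined a m \<and> val a m \<in> \<nat>"
| "well_defined (Add a b) m \<longleftrightarrow> well_defined a m \<and> well_defined b m"
| "well_defined (Sub a b) m \<longleftrightarrow> well_defined a m \<and> well_defined b m"
| "well_defined (Mul a b) m \<longleftrightarrow> well_defined a m \<and> well_defined b m"
| "well_defined (Div a b) m \<longleftrightarrow> well_defined a m \<and> well_defined b m \<and> val b m \<noteq> 0"

primrec arith_ops :: "expr \<Rightarrow> nat" where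
  "arith_ops (Const k) = 0"
| "arith_ops (Cell a) = arith_ops a"
| "arith_ops (Add a b) = arith_ops a + arith_ops b + 1"
| "arith_ops (Sub a b) = arith_ops a + arith_ops b + 1"
| "arith_ops (Mul a b) = arith_ops a + arith_ops b + 1"
| "arith_ops (Div a b) = arith_ops a + arith_ops b + 1"

text \<open>\<open>exec p m T m'\<close>: started in memory \<open>m\<close>, the program \<open>p\<close> terminates in memory \<open>m'\<close> after exactly
  \<open>T\<close> arithmetic operations and comparisons, those of address computations included.\<close>

inductive exec :: "program \<Rightarrow> memory \<Rightarrow> nat \<Rightarrow> memory \<Rightarrow> bool" where
  Skip: "exec Skip m 0 m"
| Store: "\<lbrakk>well_defined a m; val a m \<in> \<nat>; well_defined e m\<rbrakk> \<Longrightarrow>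
    exec (Store a e) m (arith_ops a + arith_ops e) (m(address (val a m) := val e m))"
| Seq: "\<lbrakk>exec p m T1 m1; exec q m1 T2 m2\<rbrakk> \<Longrightarrow> exec (Seq p q) m (T1 + T2) m2"
| If_True: "\<lbrakk>well_defined a m; well_defined b m; val a m \<le> val b m; exec p m T m'\<rbrakk> \<Longrightarrow>
    exec (If_Le a b p q) m (arith_ops a + arith_ops b + 1 + T) m'"
| If_False: "\<lbrakk>well_defined a m; well_defined b m; \<not> val a m \<le> val b m; exec q m T m'\<rbrakk> \<Longrightarrow>
    exec (If_Le a b p q) m (arith_ops a + arith_ops b + 1 + T) m'"
| While_False: "\<lbrakk>well_defined a m; well_defined b m; \<not> val a m \<le> val b m\<rbrakk> \<Longrightarrow>
    exec (While_Le a b p) m (arith_ops a + arith_ops b + 1) m"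
| While_True: "\<lbrakk>well_defined a m; well_defined b m; val a m \<le> val b m;
     exec p m T1 m1; exec (While_Le a b p) m1 T2 m2\<rbrakk> \<Longrightarrow>
    exec (While_Le a b p) m (arith_ops a + arith_ops b + 1 + T1 + T2) m2"

inductive_cases exec_SkipE: "exec Skip m T m'"
inductive_cases exec_StoreE: "exec (Store a e) m T m'"
inductive_cases exec_SeqE: "exec (Seq p q) m T m'"
inductive_cases exec_IfE: "exec (If_Le a b p q) m T m'"
inductive_cases exec_WhileE: "exec (While_Le a b p) m T m'"

lemma exec_deterministic:
  assumes "exec p m T m'" and "exec p m T' m''"
  shows "T' = T \<and> m'' = m'"
  using assms
proof (induction arbitrary: T' m'' rule: exec.induct)
  case Skip
  then show ?case by (auto elim: exec_SkipE)
next
  case Store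
  then show ?case by (auto elim: exec_StoreE)
next
  case (Seq p m T1 m1 q T2 m2)
  from Seq.prems obtain T1' T2' m1' where "exec p m T1' m1'" "exec q m1' T2' m''" "T' = T1' + T2'"
    by (rule exec_SeqE)
  with Seq.IH show ?case by metis
next
  case (If_True a m b p T m' q)
  from If_True.prems If_True.hyps obtain T0 where
    "exec p m T0 m''" "T' = arith_ops a + arith_ops b + 1 + T0"
    by (auto elim: exec_IfE)
  with If_True.IH show ?case by metis
next
  case (If_False a m b q T m' p)
  from If_False.prems If_False.hyps obtain T0 where
    "exec q m T0 m''" "T' = arith_ops a + arith_ops b + 1 + T0"
    by (auto elim: exec_IfE)
  with If_False.IH show ?case by metis
next
  case (While_False a m b p)
  from While_False.prems show ?case
    by (rule exec_WhileE) (simp_all add: While_False.hyps)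
next
  case (While_True a m b p T1 m1 T2 m2)
  from While_True.prems obtain T1' T2' m1' where
    "exec p m T1' m1'" "exec (While_Le a b p) m1' T2' m''"
    "T' = arith_ops a + arith_ops b + 1 + T1' + T2'"
    by (rule exec_WhileE) (use While_True.hyps(3) in simp_all)
  with While_True.IH show ?case by metis
qed


section \<open>Input and output of an n-fold integer programming algorithm\<close>

text \<open>The numbers \<open>n, w, b, l, u\<close> occupy consecutive cells starting at address 0, and all other
  cells contain 0. On termination cell 0 contains 1 if an optimal solution was found, which is then
  in the cells 1, ..., nt, and it contains 0 if the program asserts that there is no feasible point.\<close>

definition nfold_input :: "nat \<Rightarrow> int vec \<Rightarrow> int vec \<Rightarrow> int vec \<Rightarrow> int vec \<Rightarrow> memory" where
  "nfold_input n w b l u = (\<lambda>i.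
     let xs = int n # list_of_vec w @ list_of_vec b @ list_of_vec l @ list_of_vec u
     in if i < length xs then of_int (xs ! i) else 0)"

definition nfold_solved ::
  "nat \<Rightarrow> nat \<Rightarrow> nat \<Rightarrow> int mat \<Rightarrow> nat \<Rightarrow> int vec \<Rightarrow> int vec \<Rightarrow> int vec \<Rightarrow> int vec \<Rightarrow> memory \<Rightarrow> bool" where
  "nfold_solved r s t A n w b l u m \<longleftrightarrow>
     (m 0 = 1 \<and> (\<exists>x. nfold_optimal r s t A n w b l u x \<and> (\<forall>j<n * t. m (1 + j) = of_int (x $ j)))) \<or>
     (m 0 = 0 \<and> nfold_feasible r s t A n b l u = {})"

end

theory Submission
  imports Defs "HOL-Library.Countable"
begin

text \<open>Adding slack columns and a large cost on the slacks makes the program feasible from the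
  start, so it remains to minimise over the points \<open>z\<close> of a box with \<open>z - z\<^sub>0\<close> in the kernel of an
  n-fold product. Step lengths \<open>\<Delta> = 2\<^sup>K, ..., 2, 1\<close> are processed in turn, where at step length \<open>\<Delta>\<close> only
  points of \<open>z\<^sub>0 + \<Delta> ker\<close> are admitted. Every kernel element is a sign-compatible sum of
  kernel elements whose size is bounded independently of \<open>n\<close> (Dickson's lemma, applied to the bricks and
  then to the multiplicities of brick types). Two consequences drive the algorithm. First, if \<open>z\<close> is
  optimal and one bound is relaxed by at most \<open>\<Delta>\<close>, then one best step along a bounded kernel element
  restores optimality; such a step is found in time \<open>O(n)\<close> by dynamic programming over the bricks,
  because the partial sums of the top rows stay in a finite set. Second, an optimum at step length \<open>\<Delta>\<close>
  lies within \<open>O(n)\<close> steps of a given optimum at step length \<open>2 \<Delta>\<close>: otherwise some of the bounded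
  summands of the difference would add up to an even vector, which could be halved. Hence a phase shrinks the box
  to the current point and relaxes each of the \<open>O(n)\<close> bounds \<open>O(n)\<close> times, which takes time \<open>O(n\<^sup>3)\<close>, and
  there are \<open>O(L)\<close> phases.\<close>


section \<open>Conformal order and bounded generation\<close>

text \<open>Two obstacles shape the construction. One is the count of augmentations: rather than
  bounding how fast improving steps converge, optimality in the current box is kept as an invariant,
  and each relaxation of one bound is repaired by exactly one augmentation. The number of operations
  therefore depends on the widths of the bounds but not on the objective, and no step length has to
  be searched for. The other is the machine: it has no rounding, and a non-integral address is
  fatal. Hence every address is affine in \<open>n\<close> and the loop counters, the finite state
  of the dynamic program is a number inspected by comparisons, and step lengths come from doubling
  and halving only. The scheme closes at both ends for the same reason: if the step length exceeds
  the width of every bound, or if the box is a single point, then the zero direction is the only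
  feasible one and optimality is free. The \<open>O(n)\<close> distance between consecutive optima
  is explicit: at most one bounded summand per coordinate, hence \<open>n * T\<close> summands with
  entries at most \<open>C\<close>.\<close>

definition conf :: "int \<Rightarrow> int \<Rightarrow> bool" where
  "conf a b \<longleftrightarrow> 0 \<le> a \<and> a \<le> b \<or> b \<le> a \<and> a \<le> 0"

definition conformal :: "('c \<Rightarrow> int) \<Rightarrow> ('c \<Rightarrow> int) \<Rightarrow> bool" where
  "conformal x y \<longleftrightarrow> (\<forall>i. conf (x i) (y i))"

lemma conf_refl: "conf a a" and conf_trans: "conf a b \<Longrightarrow> conf b c \<Longrightarrow> conf a c"
  and conf_abs: "conf a b \<Longrightarrow> \<bar>a\<bar> \<le> \<bar>b\<bar>"
  by (auto simp: conf_def)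

lemma conf_abs_eq: "conf a b \<Longrightarrow> \<bar>a\<bar> = \<bar>b\<bar> \<Longrightarrow> a = b"
  by (auto simp: conf_def)

text \<open>Once the sequence is nonnegative it stays so, and growing means growing away from zero.
  If it is negative throughout, it is bounded above and hence eventually constant.\<close>

lemma monoseq_int_conf_tail:
  fixes b :: "nat \<Rightarrow> int"
  assumes "incseq b"
  shows "\<exists>k. \<forall>m n. k \<le> m \<longrightarrow> m \<le> n \<longrightarrow> conf (b m) (b n)"
proof (cases "\<exists>k. b k \<ge> 0")
  case True
  then obtain k where "b k \<ge> 0" by blast
  then show ?thesis
    using incseqD[OF assms] by (intro exI[of _ k]) (force simp: conf_def intro: order_trans)
next
  case False
  then have neg: "b k < 0" for k by (simp add: not_le)
  obtain k where k: "\<And>m. nat (- b k) \<le> nat (- b m)"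
    using ex_has_least_nat[of "\<lambda>_. True" 0 "\<lambda>k. nat (- b k)"] by blast
  have "b m = b k" if "m \<ge> k" for m
    using incseqD[OF assms that] k[of m] neg[of m] neg[of k] by linarith
  then show ?thesis
    by (metis conf_refl order_trans)
qed

text \<open>Pass to a monotone subsequence and drop an initial part; the decreasing case is the
  increasing one for the negated sequence.\<close>

lemma conf_subseq:
  fixes a :: "nat \<Rightarrow> int"
  shows "\<exists>\<phi> :: nat \<Rightarrow> nat. strict_mono \<phi> \<and> (\<forall>m n. m \<le> n \<longrightarrow> conf (a (\<phi> m)) (a (\<phi> n)))"
proof -
  obtain f where f: "strict_mono f" "monoseq (\<lambda>n. a (f n))"
    using seq_monosub[of a] by blast
  have "\<exists>k. \<forall>m n. k \<le> m \<longrightarrow> m \<le> n \<longrightarrow> conf (a (f m)) (a (f n))"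
  proof (cases "incseq (\<lambda>n. a (f n))")
    case True
    then show ?thesis by (rule monoseq_int_conf_tail)
  next
    case False
    then have "incseq (\<lambda>n. - a (f n))"
      using f(2) by (auto simp: monoseq_iff decseq_def incseq_def)
    from monoseq_int_conf_tail[OF this] show ?thesis by (auto simp: conf_def)
  qed
  then obtain k where k: "\<And>m n. k \<le> m \<Longrightarrow> m \<le> n \<Longrightarrow> conf (a (f m)) (a (f n))" by blast
  have "strict_mono (\<lambda>n. f (n + k))"
    using f(1) by (auto simp: strict_mono_def)
  then show ?thesis using k by (intro exI[of _ "\<lambda>n. f (n + k)"]) auto
qed

text \<open>Dickson's lemma for signed vectors: subsequences are extracted coordinate by coordinate,
  and later extractions keep what earlier ones achieved.\<close>

lemma conformal_subseq:
  fixes f :: "nat \<Rightarrow> 'c \<Rightarrow> int"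
  assumes "finite I"
  shows "\<exists>\<phi> :: nat \<Rightarrow> nat. strict_mono \<phi> \<and> (\<forall>i\<in>I. \<forall>m n. m \<le> n \<longrightarrow> conf (f (\<phi> m) i) (f (\<phi> n) i))"
  using assms
proof induction
  case empty
  show ?case by (intro exI[of _ id]) (auto simp: strict_mono_def)
next
  case (insert x I)
  from insert.IH obtain \<phi> :: "nat \<Rightarrow> nat" where \<phi>: "strict_mono \<phi>"
      "\<forall>i\<in>I. \<forall>m n. m \<le> n \<longrightarrow> conf (f (\<phi> m) i) (f (\<phi> n) i)" by (elim exE conjE)
  obtain \<psi> :: "nat \<Rightarrow> nat" where \<psi>: "strict_mono \<psi>"
      "\<forall>m n. m \<le> n \<longrightarrow> conf (f (\<phi> (\<psi> m)) x) (f (\<phi> (\<psi> n)) x)"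
    using conf_subseq[of "\<lambda>n. f (\<phi> n) x"] by (elim exE conjE)
  show ?case
  proof (intro exI conjI)
    show "strict_mono (\<phi> \<circ> \<psi>)" using \<phi>(1) \<psi>(1) by (rule strict_mono_o)
    show "\<forall>i\<in>insert x I. \<forall>m n. m \<le> n \<longrightarrow> conf (f ((\<phi> \<circ> \<psi>) m) i) (f ((\<phi> \<circ> \<psi>) n) i)"
      using \<phi>(2) \<psi> by (simp add: strict_mono_less_eq)
  qed
qed

text \<open>An injective sequence in an infinite set would have a conformal subsequence, whose first
  two members are comparable and hence equal.\<close>

lemma finite_antichain:
  assumes "finite I" and supp: "\<And>x i. x \<in> M \<Longrightarrow> i \<notin> I \<Longrightarrow> x i = 0"
    and anti: "\<And>x y. x \<in> M \<Longrightarrow> y \<in> M \<Longrightarrow> conformal x y \<Longrightarrow> x = y"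
  shows "finite M"
proof (rule ccontr)
  assume "infinite M"
  then obtain f :: "nat \<Rightarrow> _" where f: "inj f" "range f \<subseteq> M"
    by (meson infinite_countable_subset)
  obtain \<phi> :: "nat \<Rightarrow> nat" where \<phi>: "strict_mono \<phi>"
      "\<forall>i\<in>I. \<forall>m n. m \<le> n \<longrightarrow> conf (f (\<phi> m) i) (f (\<phi> n) i)"
    using conformal_subseq[OF assms(1), of f] by (elim exE conjE)
  have in_M: "f k \<in> M" for k using f(2) by auto
  have "conf (f (\<phi> 0) i) (f (\<phi> 1) i)" for i
    using \<phi>(2) supp[OF in_M] by (cases "i \<in> I") (auto simp: conf_refl)
  then have "f (\<phi> 0) = f (\<phi> 1)" by (intro anti in_M) (simp add: conformal_def)
  then have "\<phi> 0 = \<phi> 1" using f(1) by (auto dest: injD)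
  then show False using \<phi>(1) by (auto simp: strict_mono_eq)
qed

text \<open>This replaces the Graver basis. The bounded elements are, for each coordinate \<open>i\<close>, the minimal
  ones among those that do not vanish at \<open>i\<close>; they form an antichain.\<close>

lemma bounded_generation:
  fixes S :: "('c \<Rightarrow> int) set"
  assumes "finite I" and supp: "\<And>x i. x \<in> S \<Longrightarrow> i \<notin> I \<Longrightarrow> x i = 0"
  shows "\<exists>C. \<forall>h\<in>S. \<forall>i. h i \<noteq> 0 \<longrightarrow> (\<exists>g\<in>S. conformal g h \<and> g i \<noteq> 0 \<and> (\<forall>j. \<bar>g j\<bar> \<le> C))"
proof -
  define M where "M i = {g \<in> S. g i \<noteq> 0 \<and> (\<forall>g'\<in>S. g' i \<noteq> 0 \<longrightarrow> conformal g' g \<longrightarrow> g' = g)}" for i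
  have fin: "finite (M i)" for i
    by (rule finite_antichain[OF assms(1)]) (auto simp: M_def intro: supp)
  define B where "B = (\<Union>i\<in>I. \<Union>g\<in>M i. (\<lambda>j. \<bar>g j\<bar>) ` I)"
  have finB: "finite B" using fin assms(1) by (auto simp: B_def)
  \<comment> \<open>The inserted 0 covers an empty \<open>B\<close> and the coordinates outside
    \<open>I\<close>, where all elements vanish.\<close>
  define C where "C = Max (insert 0 B)"
  have "\<exists>g\<in>S. conformal g h \<and> g i \<noteq> 0 \<and> (\<forall>j. \<bar>g j\<bar> \<le> C)" if h: "h \<in> S" "h i \<noteq> 0" for h i
  proof -
    have iI: "i \<in> I" using supp h by blast
    define P where "P g \<longleftrightarrow> g \<in> S \<and> conformal g h \<and> g i \<noteq> 0" for g
    define wt where "wt g = nat (\<Sum>j\<in>I. \<bar>g j\<bar>)" for g :: "'c \<Rightarrow> int"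
    have "P h" using h by (simp add: P_def conformal_def conf_refl)
    \<comment> \<open>Least 1-norm stands in for minimality in the conformal order: anything
      conformal to \<open>g\<close> has absolute values no larger than those of \<open>g\<close>, so
      it can only have the same norm if it is equal to \<open>g\<close>.\<close>
    then obtain g where g: "P g" and least: "\<And>g'. P g' \<Longrightarrow> wt g \<le> wt g'"
      using ex_has_least_nat[of P h wt] by blast
    have "g \<in> M i" unfolding M_def
    proof (intro CollectI conjI ballI impI)
      show "g \<in> S" "g i \<noteq> 0" using g by (auto simp: P_def)
      fix g' assume g': "g' \<in> S" "g' i \<noteq> 0" "conformal g' g"
      then have "P g'" using g by (auto simp: P_def conformal_def intro: conf_trans)
      have le: "\<bar>g' j\<bar> \<le> \<bar>g j\<bar>" for j using g'(3) by (auto simp: conformal_def conf_abs)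
      have "(\<Sum>j\<in>I. \<bar>g j\<bar> - \<bar>g' j\<bar>) \<le> 0"
        using least[OF \<open>P g'\<close>] by (simp add: wt_def sum_nonneg nat_le_eq_zle sum_subtractf)
      then have "\<bar>g' j\<bar> = \<bar>g j\<bar>" if "j \<in> I" for j
        using sum_nonneg_eq_0_iff[OF assms(1), of "\<lambda>j. \<bar>g j\<bar> - \<bar>g' j\<bar>"] le that
          sum_nonneg[of I "\<lambda>j. \<bar>g j\<bar> - \<bar>g' j\<bar>"] by auto
      moreover have "conf (g' j) (g j)" for j using g'(3) by (simp add: conformal_def)
      ultimately have "g' j = g j" if "j \<in> I" for j
        using that by (blast intro: conf_abs_eq)
      moreover have "g' j = g j" if "j \<notin> I" for j
        using supp[OF g'(1) that] supp[OF \<open>g \<in> S\<close> that] by simp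
      ultimately show "g' = g" by blast
    qed
    have "\<bar>g j\<bar> \<le> C" for j
    proof (cases "j \<in> I")
      case True
      then have "\<bar>g j\<bar> \<in> B" using \<open>g \<in> M i\<close> iI by (auto simp: B_def)
      then show ?thesis using finB by (simp add: C_def)
    next
      case False
      then have "g j = 0" using supp[of g j] g by (simp add: P_def)
      then show ?thesis using finB by (simp add: C_def)
    qed
    then show ?thesis using g(1) unfolding P_def by (intro bexI[of _ g]) simp_all
  qed
  then show ?thesis by (intro exI[of _ C] ballI allI impI)
qed


section \<open>Finiteness, sign-compatible subsums and parity\<close>

lemma finite_bounded_funs:
  assumes "finite I"
  shows "finite {v :: 'c \<Rightarrow> int. (\<forall>j. \<bar>v j\<bar> \<le> C) \<and> (\<forall>j. j \<notin> I \<longrightarrow> v j = 0)}"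
proof (rule finite_subset)
  show "finite {v :: 'c \<Rightarrow> int. \<forall>j. (j \<in> I \<longrightarrow> v j \<in> {-C..C}) \<and> (j \<notin> I \<longrightarrow> v j = 0)}"
    using assms by (rule finite_set_of_finite_funs) simp
qed (auto simp: abs_le_iff minus_le_iff)

text \<open>All summands have the sign of \<open>b\<close>, so nothing cancels in a partial sum. The
  second claim is what keeps a chosen coordinate nonzero when only part of a decomposition is
  taken.\<close>

lemma conf_sum_subset:
  assumes "finite K" "J \<subseteq> K" "\<And>k. k \<in> K \<Longrightarrow> conf (a k) b" "b = (\<Sum>k\<in>K. a k)"
  shows "conf (\<Sum>k\<in>J. a k) b" and "k \<in> J \<Longrightarrow> a k \<noteq> 0 \<Longrightarrow> (\<Sum>k\<in>J. a k) \<noteq> 0"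
proof -
  have fin: "finite J" using assms(1,2) by (rule finite_subset[rotated])
  have "(conf (\<Sum>k\<in>J. a k) b) \<and> (k \<in> J \<longrightarrow> a k \<noteq> 0 \<longrightarrow> (\<Sum>k\<in>J. a k) \<noteq> 0)"
  proof (cases "b \<ge> 0")
    case True
    then have pos: "0 \<le> a k" if "k \<in> K" for k using assms(3)[OF that] by (auto simp: conf_def)
    have "(\<Sum>k\<in>J. a k) \<le> b" unfolding assms(4)
      by (rule sum_mono2) (use assms pos in auto)
    moreover have "0 \<le> (\<Sum>k\<in>J. a k)" by (rule sum_nonneg) (use pos assms(2) in auto)
    moreover have "a k \<le> (\<Sum>k\<in>J. a k)" "0 \<le> a k" if "k \<in> J"
      using member_le_sum[of k J a] that fin pos assms(2) by auto
    ultimately show ?thesis by (auto simp: conf_def)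
  next
    case False
    then have neg: "a k \<le> 0" if "k \<in> K" for k using assms(3)[OF that] by (auto simp: conf_def)
    have "(\<Sum>k\<in>J. - a k) \<le> (\<Sum>k\<in>K. - a k)"
      by (rule sum_mono2) (use assms neg in auto)
    moreover have "0 \<le> (\<Sum>k\<in>J. - a k)" by (rule sum_nonneg) (use neg assms(2) in auto)
    moreover have "- a k \<le> (\<Sum>k\<in>J. - a k)" "a k \<le> 0" if "k \<in> J"
      using member_le_sum[of k J "\<lambda>k. - a k"] that fin neg assms(2) by auto
    ultimately show ?thesis using assms(4) by (auto simp: conf_def sum_negf)
  qed
  then show "conf (\<Sum>k\<in>J. a k) b" and "k \<in> J \<Longrightarrow> a k \<noteq> 0 \<Longrightarrow> (\<Sum>k\<in>J. a k) \<noteq> 0" by blast+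
qed

text \<open>More subsets than parity patterns: two of them have the same parities, and their symmetric
  difference has even sum.\<close>

lemma even_subsum:
  fixes g :: "nat \<Rightarrow> 'c \<Rightarrow> int"
  assumes "finite I" "card I < m"
  shows "\<exists>J\<subseteq>{..<m}. J \<noteq> {} \<and> (\<forall>i\<in>I. even (\<Sum>k\<in>J. g k i))"
proof -
  define F where "F J = {i \<in> I. odd (\<Sum>k\<in>J. g k i)}" for J
  have "F ` Pow {..<m} \<subseteq> Pow I" by (auto simp: F_def)
  then have "card (F ` Pow {..<m}) \<le> card (Pow I)" using assms(1) by (simp add: card_mono)
  also have "\<dots> < card (Pow {..<m})" using assms by (simp add: card_Pow)
  finally have "\<not> inj_on F (Pow {..<m})" by (rule pigeonhole)
  then obtain J1 J2 where J: "J1 \<subseteq> {..<m}" "J2 \<subseteq> {..<m}" "J1 \<noteq> J2" "F J1 = F J2"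
    by (auto simp: inj_on_def)
  have fin: "finite J1" "finite J2" using J finite_subset by blast+
  have "even (\<Sum>k\<in>(J1 - J2) \<union> (J2 - J1). g k i)" if "i \<in> I" for i
  proof -
    have "(\<Sum>k\<in>(J1 - J2) \<union> (J2 - J1). g k i) = (\<Sum>k\<in>J1 - J2. g k i) + (\<Sum>k\<in>J2 - J1. g k i)"
      using fin by (intro sum.union_disjoint) auto
    moreover have "(\<Sum>k\<in>J1. g k i) = (\<Sum>k\<in>J1 \<inter> J2. g k i) + (\<Sum>k\<in>J1 - J2. g k i)"
      using fin(1) by (rule sum.Int_Diff)
    moreover have "(\<Sum>k\<in>J2. g k i) = (\<Sum>k\<in>J1 \<inter> J2. g k i) + (\<Sum>k\<in>J2 - J1. g k i)"
      using sum.Int_Diff[OF fin(2), of _ J1] by (simp add: Int_commute)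
    moreover have "even (\<Sum>k\<in>J1. g k i) \<longleftrightarrow> even (\<Sum>k\<in>J2. g k i)"
      using J(4) that by (auto simp: F_def set_eq_iff)
    ultimately show ?thesis by (metis even_add)
  qed
  then show ?thesis using J by (intro exI[of _ "(J1 - J2) \<union> (J2 - J1)"]) auto
qed


text \<open>An integer lattice of finitely supported functions with a distinguished set of elements
  from which every member can be built conformally. It is used at two levels: for the kernel of one
  brick, with a finite \<open>D\<close>, and for the kernel of the whole product, with the elements
  of bounded 1-norm as \<open>D\<close>.\<close>

locale generated =
  fixes I :: "'c set" and S D :: "('c \<Rightarrow> int) set"
  assumes finI: "finite I"
    and supp: "x \<in> S \<Longrightarrow> i \<notin> I \<Longrightarrow> x i = 0"
    and zero: "(\<lambda>_. 0) \<in> S"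
    and diff: "x \<in> S \<Longrightarrow> y \<in> S \<Longrightarrow> (\<lambda>i. x i - y i) \<in> S"
    and D_subset: "D \<subseteq> S"
    and generation: "h \<in> S \<Longrightarrow> h i \<noteq> 0 \<Longrightarrow> \<exists>g\<in>D. conformal g h \<and> g i \<noteq> 0"
begin

lemma add: "x \<in> S \<Longrightarrow> y \<in> S \<Longrightarrow> (\<lambda>i. x i + y i) \<in> S"
  using diff[of x "\<lambda>i. 0 - y i"] diff[OF zero, of y] by simp

lemma sum_closed: "finite J \<Longrightarrow> (\<And>k. k \<in> J \<Longrightarrow> g k \<in> S) \<Longrightarrow> (\<lambda>i. \<Sum>k\<in>J. g k i) \<in> S"
  by (induction J rule: finite_induct) (auto intro: zero add)

text \<open>Splitting off a generator conformal to \<open>h\<close> leaves a remainder that is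
  conformal to \<open>h\<close> and strictly shorter in the 1-norm. Generators found later are
  conformal to the remainder, hence to \<open>h\<close>.\<close>

lemma decomposition:
  assumes "h \<in> S"
  shows "\<exists>m (g :: nat \<Rightarrow> 'c \<Rightarrow> int). (\<forall>k<m. g k \<in> D \<and> conformal (g k) h \<and> (\<exists>i. g k i \<noteq> 0)) \<and>
           (\<forall>i. h i = (\<Sum>k<m. g k i))"
  using assms
proof (induction "nat (\<Sum>i\<in>I. \<bar>h i\<bar>)" arbitrary: h rule: less_induct)
  case less
  show ?case
  proof (cases "\<exists>i. h i \<noteq> 0")
    case False
    then show ?thesis by (intro exI[of _ 0]) simp
  next
    case True
    then obtain i where i: "h i \<noteq> 0" by blast
    then obtain g0 where g0: "g0 \<in> D" "conformal g0 h" "g0 i \<noteq> 0"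
      using generation[OF less.prems i] by blast
    define h' where "h' = (\<lambda>i. h i - g0 i)"
    have h'S: "h' \<in> S" using diff less.prems g0(1) D_subset by (auto simp: h'_def)
    have h'h: "conformal h' h" using g0(2) by (auto simp: conformal_def conf_def h'_def)
    have "i \<in> I" using supp less.prems i by blast
    have "(\<Sum>i\<in>I. \<bar>h' i\<bar>) < (\<Sum>i\<in>I. \<bar>h i\<bar>)"
    proof (rule sum_strict_mono_ex1[OF finI])
      show "\<forall>i\<in>I. \<bar>h' i\<bar> \<le> \<bar>h i\<bar>" using h'h by (simp add: conformal_def conf_abs)
      have "conf (g0 i) (h i)" using g0(2) by (simp add: conformal_def)
      then have "\<bar>h' i\<bar> < \<bar>h i\<bar>" using g0(3) by (auto simp: h'_def conf_def)
      then show "\<exists>i\<in>I. \<bar>h' i\<bar> < \<bar>h i\<bar>" using \<open>i \<in> I\<close> by blast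
    qed
    then have "nat (\<Sum>i\<in>I. \<bar>h' i\<bar>) < nat (\<Sum>i\<in>I. \<bar>h i\<bar>)"
      by (metis nat_less_eq_zless sum_abs_ge_zero)
    from less.hyps[OF this h'S] obtain m and g :: "nat \<Rightarrow> 'c \<Rightarrow> int"
      where g: "\<forall>k<m. g k \<in> D \<and> conformal (g k) h' \<and> (\<exists>i. g k i \<noteq> 0)"
        and h': "\<forall>i. h' i = (\<Sum>k<m. g k i)" by (elim exE conjE)
    show ?thesis
    proof (intro exI[of _ "Suc m"] exI[of _ "g(m := g0)"] conjI allI impI)
      fix k assume "k < Suc m"
      then consider "k < m" | "k = m" by linarith
      note cs = this
      show "(g(m := g0)) k \<in> D" using cs g g0(1) by cases auto
      have "conformal (g k) h" if "k < m"
        using that g h'h by (auto simp: conformal_def intro: conf_trans)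
      then show "conformal ((g(m := g0)) k) h" using cs g0(2) by cases auto
      show "\<exists>i. (g(m := g0)) k i \<noteq> 0" using cs g g0(3) by cases auto
    next
      fix j
      have "h j = h' j + g0 j" by (simp add: h'_def)
      also have "h' j = (\<Sum>k<m. g k j)" using h' by blast
      also have "\<dots> = (\<Sum>k<m. (g(m := g0)) k j)" by (rule sum.cong) auto
      finally show "h j = (\<Sum>k<Suc m. (g(m := g0)) k j)" by simp
    qed
  qed
qed

end


section \<open>The kernel of an n-fold product\<close>

definition brick_kernel :: "nat \<Rightarrow> nat \<Rightarrow> (nat \<Rightarrow> nat \<Rightarrow> int) \<Rightarrow> (nat \<Rightarrow> int) set" where
  "brick_kernel T s a2 = {v. (\<forall>j. j \<notin> {..<T} \<longrightarrow> v j = 0) \<and> (\<forall>k<s. (\<Sum>j<T. a2 k j * v j) = 0)}"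

text \<open>Indices are pairs of brick and column, and functions vanish outside the grid, so that
  the lattice is closed under pointwise operations and equality of vectors is equality of
  functions.\<close>

definition nfold_kernel ::
  "nat \<Rightarrow> nat \<Rightarrow> nat \<Rightarrow> (nat \<Rightarrow> nat \<Rightarrow> int) \<Rightarrow> (nat \<Rightarrow> nat \<Rightarrow> int) \<Rightarrow> nat \<Rightarrow> (nat \<times> nat \<Rightarrow> int) set" where
  "nfold_kernel T r s a1 a2 n =
     {h. (\<forall>p. p \<notin> {..<n} \<times> {..<T} \<longrightarrow> h p = 0) \<and>
         (\<forall>i<n. \<forall>k<s. (\<Sum>j<T. a2 k j * h (i, j)) = 0) \<and>
         (\<forall>k<r. (\<Sum>i<n. \<Sum>j<T. a1 k j * h (i, j)) = 0)}"

lemma subset_card_containing: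
  assumes "finite X" "x \<in> X" "1 \<le> c" "c \<le> card X"
  shows "\<exists>Y\<subseteq>X. card Y = c \<and> x \<in> Y"
proof -
  have "c - 1 \<le> card (X - {x})" using assms by simp
  then obtain Z where Z: "Z \<subseteq> X - {x}" "card Z = c - 1" "finite Z"
    by (rule obtain_subset_with_card_n)
  then show ?thesis using assms by (intro exI[of _ "insert x Z"]) (auto simp: card_insert_if)
qed

text \<open>Bricks decompose into finitely many types of bounded kernel elements. The type multiplicities
  of an element of the n-fold kernel lie in a lattice that does not depend on n, and a bounded
  multiplicity vector below them selects a bounded part of the decomposition.\<close>

lemma nfold_bounded_generation:
  "\<exists>C\<ge>0. \<forall>n. \<forall>h\<in>nfold_kernel T r s a1 a2 n. \<forall>p. h p \<noteq> 0 \<longrightarrow>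
     (\<exists>g\<in>nfold_kernel T r s a1 a2 n. conformal g h \<and> g p \<noteq> 0 \<and>
        (\<Sum>q\<in>{..<n} \<times> {..<T}. \<bar>g q\<bar>) \<le> C)"
proof -
  let ?B = "brick_kernel T s a2"
  obtain C1 where C1: "\<forall>h\<in>?B. \<forall>i. h i \<noteq> 0 \<longrightarrow>
      (\<exists>g\<in>?B. conformal g h \<and> g i \<noteq> 0 \<and> (\<forall>j. \<bar>g j\<bar> \<le> C1))"
    using bounded_generation[of "{..<T}" ?B] by (auto simp: brick_kernel_def)
  define H where "H = {v \<in> ?B. \<forall>j. \<bar>v j\<bar> \<le> C1}"
  have finH: "finite H"
    by (rule finite_subset[OF _ finite_bounded_funs[of "{..<T}" C1]]) (auto simp: H_def brick_kernel_def)
  interpret b: generated "{..<T}" ?B H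
  proof
    show "\<exists>g\<in>H. conformal g h \<and> g i \<noteq> 0" if hi: "h \<in> ?B" "h i \<noteq> 0" for h i
    proof -
      obtain g where "g \<in> ?B" "conformal g h" "g i \<noteq> 0" "\<forall>j. \<bar>g j\<bar> \<le> C1"
        using bspec[OF C1 hi(1)] hi(2) by metis
      then show ?thesis by (intro bexI[of _ g]) (simp_all add: H_def)
    qed
  qed (auto simp: brick_kernel_def H_def right_diff_distrib sum_subtractf)
  define rw where "rw v k = (\<Sum>j<T. a1 k j * v j)" for v k
  define M where "M = {\<mu> :: (nat \<Rightarrow> int) \<Rightarrow> int. (\<forall>\<eta>. \<eta> \<notin> H \<longrightarrow> \<mu> \<eta> = 0) \<and>
      (\<forall>k<r. (\<Sum>\<eta>\<in>H. \<mu> \<eta> * rw \<eta> k) = 0)}"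
  obtain C2 where C2: "\<forall>h\<in>M. \<forall>i. h i \<noteq> 0 \<longrightarrow>
      (\<exists>g\<in>M. conformal g h \<and> g i \<noteq> 0 \<and> (\<forall>j. \<bar>g j\<bar> \<le> C2))"
    using bounded_generation[of H M] finH by (auto simp: M_def)
  \<comment> \<open>At most \<open>card H\<close> types, each used at most \<open>C2\<close> times,
    each use contributing at most \<open>T\<close> entries of size \<open>C1\<close>. The 1-norm is
    bounded, not only the largest entry.\<close>
  define C where "C = int (card H) * \<bar>C2\<bar> * (int T * \<bar>C1\<bar>)"
  have "\<exists>g\<in>nfold_kernel T r s a1 a2 n. conformal g h \<and> g p0 \<noteq> 0 \<and>
        (\<Sum>q\<in>{..<n} \<times> {..<T}. \<bar>g q\<bar>) \<le> C"
    if h: "h \<in> nfold_kernel T r s a1 a2 n" and p0: "h p0 \<noteq> 0" for n h p0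
  proof -
    obtain i0 j0 where ij: "p0 = (i0, j0)" by fastforce
    have i0: "i0 < n" "j0 < T" using h p0 ij by (auto simp: nfold_kernel_def)
    have "\<exists>mg :: nat \<times> (nat \<Rightarrow> nat \<Rightarrow> int). (\<forall>k<fst mg. snd mg k \<in> H \<and> conformal (snd mg k) (\<lambda>j. h (i, j))) \<and>
           (\<forall>j. h (i, j) = (\<Sum>k<fst mg. snd mg k j))" if "i < n" for i
    proof -
      have "(\<lambda>j. h (i, j)) \<in> ?B" using h that by (auto simp: nfold_kernel_def brick_kernel_def)
      from b.decomposition[OF this] obtain m and g :: "nat \<Rightarrow> nat \<Rightarrow> int"
        where "(\<forall>k<m. g k \<in> H \<and> conformal (g k) (\<lambda>j. h (i, j)) \<and> (\<exists>l. g k l \<noteq> 0)) \<and>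
          (\<forall>j. h (i, j) = (\<Sum>k<m. g k j))" by (elim exE)
      then show ?thesis by (intro exI[of _ "(m, g)"], unfold fst_conv snd_conv) blast
    qed
    then obtain mg :: "nat \<Rightarrow> nat \<times> (nat \<Rightarrow> nat \<Rightarrow> int)" where mg: "\<And>i. i < n \<Longrightarrow> (\<forall>k<fst (mg i). snd (mg i) k \<in> H \<and>
          conformal (snd (mg i) k) (\<lambda>j. h (i, j))) \<and> (\<forall>j. h (i, j) = (\<Sum>k<fst (mg i). snd (mg i) k j))"
      by metis
    define m where "m i = fst (mg i)" for i
    define g where "g i = snd (mg i)" for i
    have gH: "g i k \<in> H" and gh: "\<And>j. conf (g i k j) (h (i, j))" if "i < n" "k < m i" for i k
      using mg[OF that(1)] that(2) by (auto simp: m_def g_def conformal_def)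
    have hsum: "h (i, j) = (\<Sum>k<m i. g i k j)" if "i < n" for i j
      using mg[OF that] by (simp add: m_def g_def)
    \<comment> \<open>The pool of all brick summands of \<open>h\<close>, labelled by brick and
      position in that brick's decomposition; \<open>G\<close> forgets the label and keeps the type,
      and \<open>lam\<close> counts the labels of each type.\<close>
    define P where "P = Sigma {..<n} (\<lambda>i. {..<m i})"
    have finP: "finite P" by (simp add: P_def)
    define G where "G p = g (fst p) (snd p)" for p
    have GH: "G ` P \<subseteq> H" using gH by (auto simp: P_def G_def)
    define lam where "lam \<eta> = int (card {p \<in> P. G p = \<eta>})" for \<eta>
    have fiber: "(\<Sum>\<eta>\<in>H. int (card {p \<in> Q. G p = \<eta>}) * rw \<eta> k) = (\<Sum>p\<in>Q. rw (G p) k)"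
      if "Q \<subseteq> P" for Q k
    proof -
      have finQ: "finite Q" using that finP by (rule finite_subset)
      have "(\<Sum>p\<in>Q. rw (G p) k) = (\<Sum>\<eta>\<in>H. \<Sum>p\<in>{p \<in> Q. G p = \<eta>}. rw (G p) k)"
        by (rule sum.group[OF finQ finH, symmetric]) (use GH that in blast)
      also have "\<dots> = (\<Sum>\<eta>\<in>H. int (card {p \<in> Q. G p = \<eta>}) * rw \<eta> k)"
        by (intro sum.cong refl) simp
      finally show ?thesis by simp
    qed
    have rw_sum: "rw (\<lambda>j. \<Sum>k\<in>K. f k j) l = (\<Sum>k\<in>K. rw (f k) l)" for f :: "nat \<Rightarrow> nat \<Rightarrow> int" and K l
      unfolding rw_def by (simp add: sum_distrib_left sum.swap[of _ K])
    have "lam \<in> M" unfolding M_def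
    proof (intro CollectI conjI allI impI)
      fix \<eta> assume "\<eta> \<notin> H"
      then have "{p \<in> P. G p = \<eta>} = {}" using GH by auto
      then show "lam \<eta> = 0" by (simp only: lam_def card.empty of_nat_0)
    next
      fix k assume "k < r"
      have "(\<Sum>\<eta>\<in>H. lam \<eta> * rw \<eta> k) = (\<Sum>p\<in>P. rw (G p) k)"
        using fiber[of P k] by (simp add: lam_def)
      also have "\<dots> = (\<Sum>i<n. \<Sum>l<m i. rw (g i l) k)"
        unfolding P_def G_def by (subst sum.Sigma) (auto simp: case_prod_unfold)
      also have "\<dots> = (\<Sum>i<n. rw (\<lambda>j. h (i, j)) k)"
        by (intro sum.cong refl) (simp add: rw_sum[symmetric] hsum)
      also have "\<dots> = 0" using h \<open>k < r\<close> by (simp add: nfold_kernel_def rw_def)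
      finally show "(\<Sum>\<eta>\<in>H. lam \<eta> * rw \<eta> k) = 0" .
    qed
    have "(\<Sum>k<m i0. g i0 k j0) \<noteq> 0" using hsum[OF i0(1)] p0 ij by simp
    then obtain k0 where k0: "k0 < m i0" "g i0 k0 j0 \<noteq> 0"
      by (metis (no_types, lifting) lessThan_iff sum.neutral)
    define \<eta>0 where "\<eta>0 = g i0 k0"
    have p0P: "(i0, k0) \<in> {p \<in> P. G p = \<eta>0}" using k0 i0 by (simp add: P_def G_def \<eta>0_def)
    then have "lam \<eta>0 \<noteq> 0" using finP by (auto simp: lam_def card_eq_0_iff)
    then obtain \<mu> where \<mu>: "\<mu> \<in> M" "conformal \<mu> lam" "\<mu> \<eta>0 \<noteq> 0" "\<forall>\<eta>. \<bar>\<mu> \<eta>\<bar> \<le> C2"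
      using bspec[OF C2 \<open>lam \<in> M\<close>] by metis
    have \<mu>_le: "0 \<le> \<mu> \<eta>" "\<mu> \<eta> \<le> lam \<eta>" for \<eta>
    proof -
      have "conf (\<mu> \<eta>) (lam \<eta>)" "0 \<le> lam \<eta>" using \<mu>(2) by (auto simp: conformal_def lam_def)
      then show "0 \<le> \<mu> \<eta>" "\<mu> \<eta> \<le> lam \<eta>" by (auto simp: conf_def)
    qed
    \<comment> \<open>Of the \<open>lam \<eta>\<close> summands of type \<open>\<eta>\<close>, any
      \<open>\<mu> \<eta>\<close> may be selected, since the top rows only see types. Type
      \<open>\<eta>0\<close> is selected at least once, and the selection is made to include
      \<open>(i0, k0)\<close>, the summand that does not vanish at \<open>p0\<close>.\<close>
    have "\<exists>Y\<subseteq>{p \<in> P. G p = \<eta>}. card Y = nat (\<mu> \<eta>) \<and> (\<eta> = \<eta>0 \<longrightarrow> (i0, k0) \<in> Y)" for \<eta>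
    proof -
      have le: "nat (\<mu> \<eta>) \<le> card {p \<in> P. G p = \<eta>}" using \<mu>_le[of \<eta>] by (simp add: lam_def)
      show ?thesis
      proof (cases "\<eta> = \<eta>0")
        case True
        then have "1 \<le> nat (\<mu> \<eta>)" using \<mu>(3) \<mu>_le[of \<eta>] by simp
        then show ?thesis using subset_card_containing[of "{p \<in> P. G p = \<eta>}" "(i0, k0)"] True le p0P finP
          by auto
      next
        case False
        obtain Y where "Y \<subseteq> {p \<in> P. G p = \<eta>}" "card Y = nat (\<mu> \<eta>)"
          using obtain_subset_with_card_n[OF le] by blast
        then show ?thesis using False by blast
      qed
    qed
    then obtain Y where Y: "\<And>\<eta>. Y \<eta> \<subseteq> {p \<in> P. G p = \<eta>}" "\<And>\<eta>. card (Y \<eta>) = nat (\<mu> \<eta>)"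
        "(i0, k0) \<in> Y \<eta>0" by metis
    define P' where "P' = (\<Union>\<eta>\<in>H. Y \<eta>)"
    have P'P: "P' \<subseteq> P" using Y(1) by (auto simp: P'_def)
    have fib: "{p \<in> P'. G p = \<eta>} = Y \<eta>" if "\<eta> \<in> H" for \<eta>
      using Y(1) that by (auto simp: P'_def)
    define K where "K i = {k. (i, k) \<in> P'}" for i
    have K: "K i \<subseteq> {..<m i}" for i using P'P by (auto simp: K_def P_def)
    have K0: "K i = {}" if "\<not> i < n" for i using P'P that by (auto simp: K_def P_def)
    have P'_Sigma: "P' = Sigma {..<n} K" using P'P by (auto simp: K_def P_def)
    have finK: "finite (K i)" for i using K finite_subset by blast
    \<comment> \<open>A subsum of the brick decompositions of \<open>h\<close>: this makes it
      conformal to \<open>h\<close> and puts each brick in the brick kernel, while membership of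
      \<open>\<mu>\<close> in \<open>M\<close> makes the top rows vanish.\<close>
    define f where "f p = (\<Sum>k\<in>K (fst p). g (fst p) k (snd p))" for p
    have f: "f (i, j) = (\<Sum>k\<in>K i. g i k j)" for i j by (simp add: f_def)
    have fB: "(\<lambda>j. f (i, j)) \<in> ?B" if "i < n" for i
      unfolding f by (rule b.sum_closed[OF finK]) (use gH[OF that] K H_def in blast)
    have f_out: "f p = 0" if "p \<notin> {..<n} \<times> {..<T}" for p
    proof (cases "fst p < n")
      case True
      then have "\<not> snd p < T" using that by (auto simp: mem_Times_iff)
      then show ?thesis using fB[OF True] by (auto simp: brick_kernel_def)
    next
      case False
      then show ?thesis using K0 by (simp add: f_def)
    qed
    have "f \<in> nfold_kernel T r s a1 a2 n" unfolding nfold_kernel_def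
    proof (intro CollectI conjI allI impI)
      fix i k assume "i < n" "k < s"
      then show "(\<Sum>j<T. a2 k j * f (i, j)) = 0" using fB by (auto simp: brick_kernel_def)
    next
      fix k assume "k < r"
      have "(\<Sum>i<n. \<Sum>j<T. a1 k j * f (i, j)) = (\<Sum>i<n. rw (\<lambda>j. \<Sum>l\<in>K i. g i l j) k)"
        by (simp add: rw_def f)
      also have "\<dots> = (\<Sum>p\<in>P'. rw (G p) k)"
        unfolding P'_Sigma G_def rw_sum by (subst sum.Sigma) (auto simp: case_prod_unfold finK)
      also have "\<dots> = (\<Sum>\<eta>\<in>H. \<mu> \<eta> * rw \<eta> k)"
        unfolding fiber[OF P'P, symmetric] using fib Y(2) \<mu>_le by (intro sum.cong refl) simp
      also have "\<dots> = 0" using \<mu>(1) \<open>k < r\<close> by (simp add: M_def)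
      finally show "(\<Sum>i<n. \<Sum>j<T. a1 k j * f (i, j)) = 0" .
    qed (use f_out in auto)
    moreover have "conformal f h" unfolding conformal_def
    proof
      fix p show "conf (f p) (h p)"
      proof (cases "fst p < n")
        case True
        show ?thesis unfolding f_def
        proof (rule conf_sum_subset(1)[OF finite_lessThan K])
          show "conf (g (fst p) k (snd p)) (h p)" if "k \<in> {..<m (fst p)}" for k
            using gh[OF True, of k "snd p"] that by simp
          show "h p = (\<Sum>k<m (fst p). g (fst p) k (snd p))" using hsum[OF True, of "snd p"] by simp
        qed
      next
        case False
        then have "h p = 0" using h by (cases p) (auto simp: nfold_kernel_def)
        then show ?thesis using False K0 by (simp add: f_def conf_def)
      qed
    qed
    moreover have "f p0 \<noteq> 0"
    proof -
      have "k0 \<in> K i0" using Y(3) gH[OF i0(1) k0(1)] by (auto simp: K_def P'_def \<eta>0_def)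
      then show ?thesis unfolding ij f
      proof (rule conf_sum_subset(2)[OF finite_lessThan K, rotated 2])
        show "conf (g i0 k j0) (h (i0, j0))" if "k \<in> {..<m i0}" for k
          using gh[OF i0(1), of k j0] that by simp
      qed (use hsum[OF i0(1)] k0(2) in blast)+
    qed
    moreover have "(\<Sum>q\<in>{..<n} \<times> {..<T}. \<bar>f q\<bar>) \<le> C"
    proof -
      have "(\<Sum>q\<in>{..<n} \<times> {..<T}. \<bar>f q\<bar>) = (\<Sum>i<n. \<Sum>j<T. \<bar>f (i, j)\<bar>)"
        by (simp add: sum.cartesian_product)
      also have "\<dots> \<le> (\<Sum>i<n. \<Sum>j<T. \<Sum>k\<in>K i. \<bar>C1\<bar>)"
      proof (intro sum_mono)
        fix i j assume "i \<in> {..<n}"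
        have "\<bar>g i k j\<bar> \<le> \<bar>C1\<bar>" if "k \<in> K i" for k
        proof -
          have "g i k \<in> H" using gH[of i k] K[of i] that \<open>i \<in> {..<n}\<close> by auto
          then have "\<bar>g i k j\<bar> \<le> C1" by (simp add: H_def)
          then show ?thesis by linarith
        qed
        then show "\<bar>f (i, j)\<bar> \<le> (\<Sum>k\<in>K i. \<bar>C1\<bar>)"
          unfolding f by (intro order_trans[OF sum_abs] sum_mono) blast
      qed
      also have "\<dots> = int (\<Sum>i<n. card (K i)) * (int T * \<bar>C1\<bar>)"
        by (simp add: sum_distrib_right sum_distrib_left mult_ac)
      also have "(\<Sum>i<n. card (K i)) = card P'"
        unfolding P'_Sigma using finK by (simp add: card_SigmaI)
      also have "int (card P') * (int T * \<bar>C1\<bar>) \<le> C"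
      proof -
        have "card P' \<le> (\<Sum>\<eta>\<in>H. card (Y \<eta>))"
          unfolding P'_def by (rule card_UN_le[OF finH])
        also have "\<dots> \<le> (\<Sum>\<eta>\<in>H. nat \<bar>C2\<bar>)"
        proof (rule sum_mono)
          fix \<eta> show "card (Y \<eta>) \<le> nat \<bar>C2\<bar>" using Y(2)[of \<eta>] spec[OF \<mu>(4), of \<eta>] by linarith
        qed
        finally have "int (card P') \<le> int (card H * nat \<bar>C2\<bar>)"
          by (simp only: of_nat_le_iff sum_constant of_nat_id)
        also have "\<dots> = int (card H) * \<bar>C2\<bar>" by simp
        finally show ?thesis unfolding C_def by (rule mult_right_mono) simp
      qed
      finally show ?thesis .
    qed
    ultimately show ?thesis by blast
  qed
  moreover have "0 \<le> C" by (simp add: C_def)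
  ultimately show ?thesis by (intro exI[of _ C]) simp
qed


section \<open>Augmentation and proximity\<close>

primrec sg :: "bool \<Rightarrow> int" where
  "sg True = 1"
| "sg False = -1"

text \<open>Lower bounds are upper bounds on the negated coordinate: \<open>U True\<close> bounds \<open>z\<close> and
  \<open>U False\<close> bounds \<open>- z\<close>.\<close>

definition in_box :: "'c set \<Rightarrow> (bool \<Rightarrow> 'c \<Rightarrow> int) \<Rightarrow> ('c \<Rightarrow> int) \<Rightarrow> bool" where
  "in_box I U z \<longleftrightarrow> (\<forall>p\<in>I. \<forall>\<sigma>. sg \<sigma> * z p \<le> U \<sigma> p)"

definition cost :: "'c set \<Rightarrow> ('c \<Rightarrow> int) \<Rightarrow> ('c \<Rightarrow> int) \<Rightarrow> int" where
  "cost I c h = (\<Sum>p\<in>I. c p * h p)"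

abbreviation shift :: "('c \<Rightarrow> int) \<Rightarrow> int \<Rightarrow> ('c \<Rightarrow> int) \<Rightarrow> 'c \<Rightarrow> int" where
  "shift z \<Delta> h \<equiv> \<lambda>p. z p + \<Delta> * h p"

lemma cost_add: "cost I c (\<lambda>p. x p + y p) = cost I c x + cost I c y"
  and cost_diff: "cost I c (\<lambda>p. x p - y p) = cost I c x - cost I c y"
  and cost_scale: "cost I c (\<lambda>p. k * x p) = k * cost I c x"
  by (simp_all add: cost_def distrib_left right_diff_distrib sum.distrib sum_subtractf
      sum_distrib_left mult.left_commute)

text \<open>The middle point lies on the segment between \<open>z\<close> and
  \<open>z + \<Delta> * b\<close>. This is how feasibility of a direction passes to its conformal
  summands.\<close>

lemma sg_between:
  assumes "conf a b" "0 \<le> \<Delta>" "sg \<sigma> * z \<le> u" "sg \<sigma> * (z + \<Delta> * b) \<le> u"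
  shows "sg \<sigma> * (z + \<Delta> * a) \<le> u"
proof -
  have "0 \<le> \<Delta> * a \<and> \<Delta> * a \<le> \<Delta> * b \<or> \<Delta> * b \<le> \<Delta> * a \<and> \<Delta> * a \<le> 0"
    using assms(1,2) by (auto simp: conf_def mult_left_mono mult_nonneg_nonpos)
  then show ?thesis using assms(3,4) by (cases \<sigma>) (auto simp: distrib_left)
qed

lemma in_box_conformal:
  assumes "conformal g h" "0 \<le> \<Delta>" "in_box I U z" "in_box I U (shift z \<Delta> h)"
  shows "in_box I U (shift z \<Delta> g)"
  using assms sg_between unfolding in_box_def conformal_def by blast

lemma conformal_diff: "conformal g h \<Longrightarrow> conformal (\<lambda>p. h p - g p) h"
  by (auto simp: conformal_def conf_def)


context generated
begin

text \<open>Optimality among the points of the box that differ from \<open>z\<close> by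
  \<open>\<Delta>\<close> times a lattice element, expressed through the direction so that costs at
  different step lengths are directly comparable.\<close>

definition scale_opt :: "(bool \<Rightarrow> 'c \<Rightarrow> int) \<Rightarrow> ('c \<Rightarrow> int) \<Rightarrow> int \<Rightarrow> ('c \<Rightarrow> int) \<Rightarrow> bool" where
  "scale_opt U c \<Delta> z \<longleftrightarrow> in_box I U z \<and> (\<forall>h\<in>S. in_box I U (shift z \<Delta> h) \<longrightarrow> 0 \<le> cost I c h)"

text \<open>If a bound is relaxed by at most one step length, an improving direction that was not
  available before contains a generator using the relaxed bound, and the rest was available
  before; so a single best generator step restores optimality.\<close>

lemma augment_after_relaxation:
  assumes opt: "scale_opt U c \<Delta> z" and \<Delta>: "0 < \<Delta>"
    and b: "U \<sigma>0 p0 \<le> b" "b \<le> U \<sigma>0 p0 + \<Delta>"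
    and U': "U' = U(\<sigma>0 := (U \<sigma>0)(p0 := b))"
    and g: "g \<in> S" "in_box I U' (shift z \<Delta> g)" "cost I c g \<le> 0"
    and best: "\<And>d. d \<in> D \<Longrightarrow> in_box I U' (shift z \<Delta> d) \<Longrightarrow> cost I c g \<le> cost I c d"
  shows "scale_opt U' c \<Delta> (shift z \<Delta> g)"
  unfolding scale_opt_def
proof (intro conjI ballI impI)
  show "in_box I U' (shift z \<Delta> g)" by (rule g(2))
  fix h assume h: "h \<in> S" "in_box I U' (shift (shift z \<Delta> g) \<Delta> h)"
  have UU': "U \<sigma> p \<le> U' \<sigma> p" for \<sigma> p using U' b by (auto simp: fun_upd_def)
  have box: "in_box I U z" using opt by (simp add: scale_opt_def)
  then have box': "in_box I U' z" using UU' order_trans unfolding in_box_def by blast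
  \<comment> \<open>The combined move away from \<open>z\<close>. It suffices that \<open>g\<close>
    costs no more than \<open>e\<close>, because the difference of their costs is the cost of
    \<open>h\<close>.\<close>
  define e where "e = (\<lambda>p. g p + h p)"
  have e: "e \<in> S" using g(1) h(1) add by (simp add: e_def)
  have e_box: "in_box I U' (shift z \<Delta> e)"
    using h(2) by (simp add: e_def distrib_left add.assoc)
  have "cost I c g \<le> cost I c e"
  proof (cases "in_box I U (shift z \<Delta> e)")
    case True
    then have "0 \<le> cost I c e" using opt e by (simp add: scale_opt_def)
    then show ?thesis using g(3) by simp
  next
    case False
    then obtain p \<sigma> where p: "p \<in> I" "\<not> sg \<sigma> * (z p + \<Delta> * e p) \<le> U \<sigma> p"
      by (auto simp: in_box_def)
    have "\<sigma> = \<sigma>0 \<and> p = p0"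
    proof (rule ccontr)
      assume "\<not> (\<sigma> = \<sigma>0 \<and> p = p0)"
      then have "U' \<sigma> p = U \<sigma> p" using U' by (auto simp: fun_upd_def)
      then show False using p e_box unfolding in_box_def by metis
    qed
    then have p0: "p0 \<in> I" "U \<sigma>0 p0 < sg \<sigma>0 * (z p0 + \<Delta> * e p0)" using p by auto
    have "sg \<sigma>0 * z p0 \<le> U \<sigma>0 p0" using box p0(1) by (simp add: in_box_def)
    then have pos: "0 < \<Delta> * (sg \<sigma>0 * e p0)" using p0(2) by (simp add: algebra_simps)
    then have "e p0 \<noteq> 0" by auto
    then obtain d where d: "d \<in> D" "conformal d e" "d p0 \<noteq> 0" using generation[OF e] by blast
    have dS: "d \<in> S" using d(1) D_subset by blast
    have "0 < sg \<sigma>0 * e p0" using pos \<Delta> by (simp add: zero_less_mult_iff)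
    moreover have "conf (d p0) (e p0)" using d(2) by (simp add: conformal_def)
    ultimately have "1 \<le> sg \<sigma>0 * d p0" using d(3) by (cases \<sigma>0) (auto simp: conf_def)
    \<comment> \<open>Integrality: a generator that moves in the direction of the relaxed bound
      moves by at least one full step, which is as much as the bound was relaxed. Without it, the
      remainder \<open>f\<close> respects the old bound.\<close>
    then have step: "\<Delta> \<le> \<Delta> * (sg \<sigma>0 * d p0)" using \<Delta> by simp
    define f where "f = (\<lambda>p. e p - d p)"
    have f: "f \<in> S" using diff e dS by (simp add: f_def)
    have fe: "conformal f e" unfolding f_def using d(2) by (rule conformal_diff)
    have "in_box I U (shift z \<Delta> f)" unfolding in_box_def
    proof (intro ballI allI)
      fix q \<tau> assume q: "q \<in> I"
      show "sg \<tau> * (z q + \<Delta> * f q) \<le> U \<tau> q"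
      proof (cases "\<tau> = \<sigma>0 \<and> q = p0")
        case True
        have "sg \<sigma>0 * (z p0 + \<Delta> * e p0) \<le> U' \<sigma>0 p0" using e_box p0(1) by (simp add: in_box_def)
        also have "U' \<sigma>0 p0 \<le> U \<sigma>0 p0 + \<Delta>" using b(2) U' by simp
        finally have "sg \<sigma>0 * (z p0 + \<Delta> * e p0) - \<Delta> * (sg \<sigma>0 * d p0) \<le> U \<sigma>0 p0"
          using step by linarith
        then show ?thesis using True by (simp add: f_def algebra_simps)
      next
        case False
        then have "U' \<tau> q = U \<tau> q" using U' by (auto simp: fun_upd_def)
        then have "sg \<tau> * (z q + \<Delta> * e q) \<le> U \<tau> q" using e_box q unfolding in_box_def by metis
        moreover have "sg \<tau> * z q \<le> U \<tau> q" using box q by (simp add: in_box_def)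
        moreover have "conf (f q) (e q)" using fe by (simp add: conformal_def)
        ultimately show ?thesis using \<Delta> by (intro sg_between[of "f q" "e q"]) auto
      qed
    qed
    then have "0 \<le> cost I c f" using opt f by (simp add: scale_opt_def)
    moreover have "cost I c f = cost I c e - cost I c d" unfolding f_def by (rule cost_diff)
    moreover have "in_box I U' (shift z \<Delta> d)"
      using in_box_conformal[OF d(2) _ box' e_box] \<Delta> by simp
    then have "cost I c g \<le> cost I c d" by (rule best[OF d(1)])
    ultimately show ?thesis by linarith
  qed
  moreover have "cost I c e = cost I c g + cost I c h" unfolding e_def by (rule cost_add)
  ultimately show "0 \<le> cost I c h" by linarith
qed

text \<open>Among the directions that are no worse than \<open>h\<close> the shortest one has at most \<open>card I\<close> parts:
  otherwise some parts add up to \<open>2 k\<close>, and \<open>k\<close> is a direction at step length \<open>2 \<Delta>\<close>.\<close>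

lemma proximity:
  assumes halve: "\<forall>x. (\<lambda>i. 2 * x i) \<in> S \<longrightarrow> x \<in> S"
    and opt: "scale_opt U c (2 * \<Delta>) z" and \<Delta>: "0 < \<Delta>"
    and C: "0 \<le> C" "\<forall>g\<in>D. \<forall>p. \<bar>g p\<bar> \<le> C"
    and h: "h \<in> S" "in_box I U (shift z \<Delta> h)"
  shows "\<exists>h'\<in>S. in_box I U (shift z \<Delta> h') \<and> cost I c h' \<le> cost I c h \<and>
           (\<forall>p. \<bar>h' p\<bar> \<le> int (card I) * C)"
proof -
  define Q where "Q x \<longleftrightarrow> x \<in> S \<and> in_box I U (shift z \<Delta> x) \<and> cost I c x \<le> cost I c h" for x
  define wt where "wt g = nat (\<Sum>j\<in>I. \<bar>g j\<bar>)" for g :: "'c \<Rightarrow> int"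
  have "Q h" using h by (simp add: Q_def)
  then obtain x where x: "Q x" and least: "\<And>y. Q y \<Longrightarrow> wt x \<le> wt y"
    using ex_has_least_nat[of Q h wt] by blast
  have xS: "x \<in> S" and x_box: "in_box I U (shift z \<Delta> x)" and x_cost: "cost I c x \<le> cost I c h"
    using x by (auto simp: Q_def)
  obtain m and g :: "nat \<Rightarrow> 'c \<Rightarrow> int"
    where g: "\<forall>k<m. g k \<in> D \<and> conformal (g k) x \<and> (\<exists>i. g k i \<noteq> 0)"
      and xsum: "\<forall>i. x i = (\<Sum>k<m. g k i)"
    using decomposition[OF xS] by (elim exE conjE)
  have box: "in_box I U z" using opt by (simp add: scale_opt_def)
  have "m \<le> card I"
  proof (rule ccontr)
    assume "\<not> m \<le> card I"
    then obtain J where J: "J \<subseteq> {..<m}" "J \<noteq> {}" "\<forall>i\<in>I. even (\<Sum>k\<in>J. g k i)"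
      using even_subsum[OF finI, of m g] by auto
    have finJ: "finite J" using J(1) finite_subset by blast
    have gk: "conf (g k i) (x i)" if "k \<in> {..<m}" for k i using g that by (auto simp: conformal_def)
    define y where "y = (\<lambda>i. \<Sum>k\<in>J. g k i)"
    \<comment> \<open>\<open>y\<close> is even on \<open>I\<close> and zero elsewhere, so the
      division is exact; by \<open>halve\<close> the half lies in the lattice, and a step
      \<open>2 * \<Delta>\<close> along it is a step \<open>\<Delta>\<close> along
      \<open>y\<close>.\<close>
    define k where "k = (\<lambda>i. y i div 2)"
    have gS: "g l \<in> S" if "l \<in> J" for l using g J(1) that D_subset by blast
    have yS: "y \<in> S" unfolding y_def using finJ gS by (rule sum_closed)
    have yx: "conformal y x" unfolding conformal_def y_def
    proof
      fix i show "conf (\<Sum>k\<in>J. g k i) (x i)"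
        by (rule conf_sum_subset(1)[OF finite_lessThan J(1) gk]) (use xsum in blast)+
    qed
    have yk: "y = (\<lambda>i. 2 * k i)"
    proof
      fix i show "y i = 2 * k i"
        using J(3) supp[OF yS, of i] by (cases "i \<in> I") (auto simp: k_def y_def)
    qed
    have kS: "k \<in> S" using halve yS unfolding yk by blast
    obtain l i where l: "l \<in> J" "g l i \<noteq> 0" using J(1,2) g by blast
    have yi: "y i \<noteq> 0" unfolding y_def
      by (rule conf_sum_subset(2)[OF finite_lessThan J(1) gk]) (use xsum l in blast)+
    have "in_box I U (shift z (2 * \<Delta>) k)"
    proof -
      have "in_box I U (shift z \<Delta> y)"
        using in_box_conformal[OF yx _ box x_box] \<Delta> by simp
      moreover have "shift z (2 * \<Delta>) k = shift z \<Delta> y" by (simp add: yk algebra_simps)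
      ultimately show ?thesis by simp
    qed
    then have "0 \<le> cost I c k" using opt kS by (simp add: scale_opt_def)
    then have "0 \<le> cost I c y" by (simp add: yk cost_scale)
    \<comment> \<open>Since \<open>y\<close> has nonnegative cost, dropping it from \<open>x\<close>
      does not increase the cost, but it shortens \<open>x\<close> strictly, against the choice of
      \<open>x\<close>.\<close>
    define x' where "x' = (\<lambda>i. x i - y i)"
    have x'x: "conformal x' x" unfolding x'_def using yx by (rule conformal_diff)
    have "Q x'" unfolding Q_def
    proof (intro conjI)
      show "x' \<in> S" using diff xS yS by (simp add: x'_def)
      show "in_box I U (shift z \<Delta> x')" using in_box_conformal[OF x'x _ box x_box] \<Delta> by simp
      show "cost I c x' \<le> cost I c h"
        using x_cost \<open>0 \<le> cost I c y\<close> by (simp add: x'_def cost_diff)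
    qed
    then have "wt x \<le> wt x'" by (rule least)
    moreover have "(\<Sum>j\<in>I. \<bar>x' j\<bar>) < (\<Sum>j\<in>I. \<bar>x j\<bar>)"
    proof (rule sum_strict_mono_ex1[OF finI])
      show "\<forall>j\<in>I. \<bar>x' j\<bar> \<le> \<bar>x j\<bar>" using x'x by (simp add: conformal_def conf_abs)
      have "conf (y i) (x i)" using yx by (simp add: conformal_def)
      then have "\<bar>x' i\<bar> < \<bar>x i\<bar>" using yi by (auto simp: x'_def conf_def)
      moreover have "i \<in> I" using supp[OF yS, of i] yi by blast
      ultimately show "\<exists>j\<in>I. \<bar>x' j\<bar> < \<bar>x j\<bar>" by blast
    qed
    then have "wt x' < wt x" unfolding wt_def by (metis nat_less_eq_zless sum_abs_ge_zero)
    ultimately show False by simp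
  qed
  have "\<bar>x p\<bar> \<le> int (card I) * C" for p
  proof -
    have "\<bar>x p\<bar> \<le> (\<Sum>k<m. \<bar>g k p\<bar>)" using xsum by (metis sum_abs)
    also have "\<dots> \<le> (\<Sum>k<m. C)" by (rule sum_mono) (use g C(2) in auto)
    also have "\<dots> \<le> int (card I) * C" using \<open>m \<le> card I\<close> C(1) by (simp add: mult_right_mono)
    finally show ?thesis .
  qed
  then show ?thesis using xS x_box x_cost by blast
qed

text \<open>By proximity, any competitor in the full box can be exchanged for one within
  \<open>card I * C\<close> steps of \<open>z\<close> that costs no more, and that one survives in
  the box cut down to \<open>\<rho>\<close> steps around \<open>z\<close>. For \<open>\<rho>\<close>
  only a lower bound is asked, so the program may relax a bound more often than this.\<close>

lemma scale_opt_from_box: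
  assumes halve: "\<forall>x. (\<lambda>i. 2 * x i) \<in> S \<longrightarrow> x \<in> S"
    and opt: "scale_opt U c (2 * \<Delta>) z" and \<Delta>: "0 < \<Delta>"
    and C: "0 \<le> C" "\<forall>g\<in>D. \<forall>p. \<bar>g p\<bar> \<le> C" "\<And>\<sigma> p. p \<in> I \<Longrightarrow> int (card I) * C \<le> \<rho> \<sigma> p"
    and U': "\<And>\<sigma> p. p \<in> I \<Longrightarrow> U' \<sigma> p = min (U \<sigma> p) (sg \<sigma> * z p + \<rho> \<sigma> p * \<Delta>)"
    and y: "y \<in> S" and opt': "scale_opt U' c \<Delta> (shift z \<Delta> y)"
  shows "scale_opt U c \<Delta> (shift z \<Delta> y)"
  unfolding scale_opt_def
proof (intro conjI ballI impI)
  have "in_box I U' (shift z \<Delta> y)" using opt' by (simp add: scale_opt_def)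
  then show "in_box I U (shift z \<Delta> y)" unfolding in_box_def using U' by force
  fix h assume h: "h \<in> S" "in_box I U (shift (shift z \<Delta> y) \<Delta> h)"
  define e where "e = (\<lambda>p. y p + h p)"
  have e: "e \<in> S" "in_box I U (shift z \<Delta> e)"
    using y h add by (simp_all add: e_def distrib_left add.assoc)
  obtain x where x: "x \<in> S" "in_box I U (shift z \<Delta> x)" "cost I c x \<le> cost I c e"
      "\<And>p. \<bar>x p\<bar> \<le> int (card I) * C"
    using proximity[OF halve opt \<Delta> C(1,2) e] by blast
  define f where "f = (\<lambda>p. x p - y p)"
  have "in_box I U' (shift (shift z \<Delta> y) \<Delta> f)" unfolding in_box_def
  proof (intro ballI allI)
    fix p \<sigma> assume p: "p \<in> I"
    have "sg \<sigma> * x p \<le> \<rho> \<sigma> p" using x(4)[of p] C(3)[OF p, of \<sigma>] by (cases \<sigma>) auto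
    then have "\<Delta> * (sg \<sigma> * x p) \<le> \<Delta> * \<rho> \<sigma> p" using \<Delta> by (intro mult_left_mono) auto
    then have "sg \<sigma> * (z p + \<Delta> * x p) \<le> sg \<sigma> * z p + \<rho> \<sigma> p * \<Delta>" by (simp add: algebra_simps)
    moreover have "sg \<sigma> * (z p + \<Delta> * x p) \<le> U \<sigma> p" using x(2) p by (simp add: in_box_def)
    ultimately have "sg \<sigma> * (z p + \<Delta> * x p) \<le> U' \<sigma> p" using U'[OF p] by simp
    moreover have "z p + \<Delta> * y p + \<Delta> * f p = z p + \<Delta> * x p" by (simp add: f_def algebra_simps)
    ultimately show "sg \<sigma> * (z p + \<Delta> * y p + \<Delta> * f p) \<le> U' \<sigma> p" by (simp only:)
  qed
  moreover have "f \<in> S" using diff x(1) y by (simp add: f_def)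
  ultimately have "0 \<le> cost I c f" using opt' by (simp add: scale_opt_def)
  moreover have "cost I c f = cost I c x - cost I c y" unfolding f_def by (rule cost_diff)
  moreover have "cost I c e = cost I c y + cost I c h" unfolding e_def by (rule cost_add)
  ultimately show "0 \<le> cost I c h" using x(3) by linarith
qed

end


section \<open>A language of loops over bricks\<close>

text \<open>\<open>Pos\<close> is the current point, \<open>Bnd\<close> its bounds, \<open>Box\<close> the tighter bounds of the current phase;
  \<open>Val k\<close> and \<open>Choice k\<close> are the optimal cost of completing a step from state \<open>k\<close> of the dynamic
  program on and the edge attaining it. \<open>Weight\<close> is the cost of a unit of slack, and \<open>Penalty\<close> the terminal
  cost that makes ending in a nonzero state worse than not moving.\<close>

datatype field = Pos nat | Bnd bool nat | Box bool nat | Cost nat | Val nat | Choice nat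
  | Scale | Range | Weight | Penalty | State | Flag

instance field :: countable
  by countable_datatype

datatype loc = Low nat | Glob field | Brick nat field

text \<open>\<open>Aff c0 c1 c2 d\<close> stands for \<open>c0 + c1 n + c2 i\<close>, where \<open>n\<close> is the number of bricks and \<open>i\<close> the
  counter of the loop at nesting depth \<open>d\<close>.\<close>

datatype affine = Aff nat nat nat nat

datatype hloc = HLow affine | HGlob field | HBrick affine field

text \<open>The only division is by the constant 2, so evaluation can get stuck only at addresses,
  and these are controlled by the shape of \<open>affine\<close>.\<close>

datatype hexp = HConst int | HRead hloc | HAdd hexp hexp | HSub hexp hexp | HMul hexp hexp | HHalf hexp

text \<open>Every loop runs over the bricks, exactly \<open>n\<close> times, so the running time can
  be read off the syntax. Loops of any other length are added outside this language.\<close>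

datatype hprog = HSkip | HSet hloc hexp | HSeq hprog hprog | HIf hexp hexp hprog hprog
  | HUp nat hprog | HDown nat hprog

type_synonym env = "nat \<Rightarrow> nat"
type_synonym store = "loc \<Rightarrow> real"

primrec affval :: "nat \<Rightarrow> env \<Rightarrow> affine \<Rightarrow> nat" where
  "affval n \<iota> (Aff c0 c1 c2 d) = c0 + c1 * n + c2 * \<iota> d"

primrec lval :: "nat \<Rightarrow> env \<Rightarrow> hloc \<Rightarrow> loc" where
  "lval n \<iota> (HLow a) = Low (affval n \<iota> a)"
| "lval n \<iota> (HGlob f) = Glob f"
| "lval n \<iota> (HBrick a f) = Brick (affval n \<iota> a) f"

primrec hval :: "nat \<Rightarrow> env \<Rightarrow> store \<Rightarrow> hexp \<Rightarrow> real" where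
  "hval n \<iota> m (HConst k) = of_int k"
| "hval n \<iota> m (HRead a) = m (lval n \<iota> a)"
| "hval n \<iota> m (HAdd a b) = hval n \<iota> m a + hval n \<iota> m b"
| "hval n \<iota> m (HSub a b) = hval n \<iota> m a - hval n \<iota> m b"
| "hval n \<iota> m (HMul a b) = hval n \<iota> m a * hval n \<iota> m b"
| "hval n \<iota> m (HHalf a) = hval n \<iota> m a / 2"

primrec run :: "nat \<Rightarrow> hprog \<Rightarrow> env \<Rightarrow> store \<Rightarrow> store" where
  "run n HSkip \<iota> m = m"
| "run n (HSet a e) \<iota> m = m(lval n \<iota> a := hval n \<iota> m e)"
| "run n (HSeq p q) \<iota> m = run n q \<iota> (run n p \<iota> m)"
| "run n (HIf a b p q) \<iota> m = (if hval n \<iota> m a \<le> hval n \<iota> m b then run n p \<iota> m else run n q \<iota> m)"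
| "run n (HUp d p) \<iota> m = fold (\<lambda>i. run n p (\<iota>(d := i))) [0..<n] m"
| "run n (HDown d p) \<iota> m = fold (\<lambda>i. run n p (\<iota>(d := i))) (rev [0..<n]) m"


text \<open>Memory layout: cell 0 holds \<open>n\<close>, the cells below \<open>Q n\<close> the input and the output, the next
  \<open>Q\<close> cells the loop counters, the next \<open>Q\<close> cells the globals, and then follow the bricks.\<close>

abbreviation size_cell :: expr where
  "size_cell \<equiv> Cell (Const 0)"

definition counter_addr :: "nat \<Rightarrow> nat \<Rightarrow> expr" where
  "counter_addr Q d = Add (Mul (Const (int Q)) size_cell) (Const (int d))"

primrec comp_aff :: "nat \<Rightarrow> affine \<Rightarrow> expr" where
  "comp_aff Q (Aff c0 c1 c2 d) = Add (Add (Const (int c0)) (Mul (Const (int c1)) size_cell))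
     (Mul (Const (int c2)) (Cell (counter_addr Q d)))"

primrec comp_loc :: "nat \<Rightarrow> hloc \<Rightarrow> expr" where
  "comp_loc Q (HLow a) = comp_aff Q a"
| "comp_loc Q (HGlob f) =
     Add (Mul (Const (int Q)) (Add size_cell (Const 1))) (Const (int (to_nat f)))"
| "comp_loc Q (HBrick a f) =
     Add (Mul (Const (int Q)) (Add (Add size_cell (Const 2)) (comp_aff Q a))) (Const (int (to_nat f)))"

primrec comp_exp :: "nat \<Rightarrow> hexp \<Rightarrow> expr" where
  "comp_exp Q (HConst k) = Const k"
| "comp_exp Q (HRead a) = Cell (comp_loc Q a)"
| "comp_exp Q (HAdd a b) = Add (comp_exp Q a) (comp_exp Q b)"
| "comp_exp Q (HSub a b) = Sub (comp_exp Q a) (comp_exp Q b)"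
| "comp_exp Q (HMul a b) = Mul (comp_exp Q a) (comp_exp Q b)"
| "comp_exp Q (HHalf a) = Div (comp_exp Q a) (Const 2)"

primrec compile :: "nat \<Rightarrow> hprog \<Rightarrow> program" where
  "compile Q HSkip = Skip"
| "compile Q (HSet a e) = Store (comp_loc Q a) (comp_exp Q e)"
| "compile Q (HSeq p q) = Seq (compile Q p) (compile Q q)"
| "compile Q (HIf a b p q) = If_Le (comp_exp Q a) (comp_exp Q b) (compile Q p) (compile Q q)"
| "compile Q (HUp d p) = Seq (Store (counter_addr Q d) (Const 0))
     (While_Le (Add (Cell (counter_addr Q d)) (Const 1)) size_cell
       (Seq (compile Q p)
         (Store (counter_addr Q d) (Add (Cell (counter_addr Q d)) (Const 1)))))"
| "compile Q (HDown d p) = Seq (Store (counter_addr Q d) size_cell)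
     (While_Le (Const 1) (Cell (counter_addr Q d))
       (Seq (Store (counter_addr Q d) (Sub (Cell (counter_addr Q d)) (Const 1)))
         (compile Q p)))"

primrec addr :: "nat \<Rightarrow> nat \<Rightarrow> loc \<Rightarrow> nat" where
  "addr Q n (Low a) = a"
| "addr Q n (Glob f) = Q * (n + 1) + to_nat f"
| "addr Q n (Brick i f) = Q * (n + 2 + i) + to_nat f"

text \<open>Cell 0 is excluded because compiled code keeps reading \<open>n\<close> from it; the
  upper bound on a low address keeps it below the loop counters, and a field code must fit into a
  record of \<open>Q\<close> cells.\<close>

primrec valid :: "nat \<Rightarrow> nat \<Rightarrow> loc \<Rightarrow> bool" where
  "valid Q n (Low a) \<longleftrightarrow> 1 \<le> a \<and> a < Q * n"
| "valid Q n (Glob f) \<longleftrightarrow> to_nat f < Q"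
| "valid Q n (Brick i f) \<longleftrightarrow> to_nat f < Q"

text \<open>Only the counters of the \<open>D\<close> enclosing loops are tracked; deeper ones may
  hold anything, since a loop initialises its own. The value \<open>n\<close> itself is allowed
  because a counter has it before a downward loop and after an upward one.\<close>

definition coupled :: "nat \<Rightarrow> nat \<Rightarrow> nat \<Rightarrow> env \<Rightarrow> store \<Rightarrow> memory \<Rightarrow> bool" where
  "coupled Q n D \<iota> m M \<longleftrightarrow> M 0 = real n \<and> (\<forall>l. valid Q n l \<longrightarrow> M (addr Q n l) = m l) \<and>
     (\<forall>d<D. M (Q * n + d) = real (\<iota> d) \<and> \<iota> d \<le> n)"

primrec scoped_aff :: "nat \<Rightarrow> affine \<Rightarrow> bool" where
  "scoped_aff D (Aff c0 c1 c2 d) \<longleftrightarrow> c2 = 0 \<or> d < D"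

primrec positive_aff :: "affine \<Rightarrow> bool" where
  "positive_aff (Aff c0 c1 c2 d) \<longleftrightarrow> 1 \<le> c0"

primrec scoped_loc :: "nat \<Rightarrow> hloc \<Rightarrow> bool" where
  "scoped_loc D (HLow a) \<longleftrightarrow> scoped_aff D a \<and> positive_aff a"
| "scoped_loc D (HGlob f) \<longleftrightarrow> True"
| "scoped_loc D (HBrick a f) \<longleftrightarrow> scoped_aff D a"

primrec scoped_exp :: "nat \<Rightarrow> hexp \<Rightarrow> bool" where
  "scoped_exp D (HConst k) \<longleftrightarrow> True"
| "scoped_exp D (HRead a) \<longleftrightarrow> scoped_loc D a"
| "scoped_exp D (HAdd a b) \<longleftrightarrow> scoped_exp D a \<and> scoped_exp D b"
| "scoped_exp D (HSub a b) \<longleftrightarrow> scoped_exp D a \<and> scoped_exp D b"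
| "scoped_exp D (HMul a b) \<longleftrightarrow> scoped_exp D a \<and> scoped_exp D b"
| "scoped_exp D (HHalf a) \<longleftrightarrow> scoped_exp D a"

primrec scoped :: "nat \<Rightarrow> hprog \<Rightarrow> bool" where
  "scoped D HSkip \<longleftrightarrow> True"
| "scoped D (HSet a e) \<longleftrightarrow> scoped_loc D a \<and> scoped_exp D e"
| "scoped D (HSeq p q) \<longleftrightarrow> scoped D p \<and> scoped D q"
| "scoped D (HIf a b p q) \<longleftrightarrow> scoped_exp D a \<and> scoped_exp D b \<and> scoped D p \<and> scoped D q"
| "scoped D (HUp d p) \<longleftrightarrow> d = D \<and> scoped (Suc D) p"
| "scoped D (HDown d p) \<longleftrightarrow> d = D \<and> scoped (Suc D) p"

text \<open>For \<open>n \<ge> 1\<close> and a counter at most \<open>n\<close>, the value is at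
  most \<open>(c0 + c1 + c2) * n\<close>; the extra 1 makes this strictly less than
  \<open>Q * n\<close>. A brick address has no such requirement, because the bricks lie above
  everything else.\<close>

primrec width_aff :: "affine \<Rightarrow> nat" where
  "width_aff (Aff c0 c1 c2 d) = c0 + c1 + c2 + 1"

primrec width_loc :: "hloc \<Rightarrow> nat" where
  "width_loc (HLow a) = width_aff a"
| "width_loc (HGlob f) = to_nat f + 1"
| "width_loc (HBrick a f) = to_nat f + 1"

primrec width_exp :: "hexp \<Rightarrow> nat" where
  "width_exp (HConst k) = 0"
| "width_exp (HRead a) = width_loc a"
| "width_exp (HAdd a b) = max (width_exp a) (width_exp b)"
| "width_exp (HSub a b) = max (width_exp a) (width_exp b)"
| "width_exp (HMul a b) = max (width_exp a) (width_exp b)"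
| "width_exp (HHalf a) = width_exp a"

primrec width :: "hprog \<Rightarrow> nat" where
  "width HSkip = 0"
| "width (HSet a e) = max (width_loc a) (width_exp e)"
| "width (HSeq p q) = max (width p) (width q)"
| "width (HIf a b p q) = max (max (width_exp a) (width_exp b)) (max (width p) (width q))"
| "width (HUp d p) = max (d + 1) (width p)"
| "width (HDown d p) = max (d + 1) (width p)"

text \<open>An upper bound, which charges both branches of a conditional. The 9 is the test and the
  increment of an upward loop (4 + 5), the 6 its initialisation and its final failing test (2 + 4);
  a downward loop needs no more.\<close>

primrec steps :: "nat \<Rightarrow> nat \<Rightarrow> hprog \<Rightarrow> nat" where
  "steps Q n HSkip = 0"
| "steps Q n (HSet a e) = arith_ops (comp_loc Q a) + arith_ops (comp_exp Q e)"
| "steps Q n (HSeq p q) = steps Q n p + steps Q n q"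
| "steps Q n (HIf a b p q) =
     arith_ops (comp_exp Q a) + arith_ops (comp_exp Q b) + 1 + (steps Q n p + steps Q n q)"
| "steps Q n (HUp d p) = n * (steps Q n p + 9) + 6"
| "steps Q n (HDown d p) = n * (steps Q n p + 9) + 6"

primrec degree :: "hprog \<Rightarrow> nat" where
  "degree HSkip = 0"
| "degree (HSet a e) = 0"
| "degree (HSeq p q) = max (degree p) (degree q)"
| "degree (HIf a b p q) = max (degree p) (degree q)"
| "degree (HUp d p) = Suc (degree p)"
| "degree (HDown d p) = Suc (degree p)"

text \<open>Each nesting level multiplies by \<open>n\<close>, and since \<open>n \<ge> 1\<close>
  all lower-order terms are absorbed into the leading one. The constant depends on \<open>Q\<close>
  and the program only.\<close>

lemma steps_poly: "\<exists>K. \<forall>n\<ge>1. steps Q n p \<le> K * n ^ degree p"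
proof -
  have seq: "\<exists>K. \<forall>n\<ge>1. c + (f n + g n) \<le> K * n ^ max a b"
    if bounds: "\<exists>K. \<forall>n\<ge>1. f n \<le> K * n ^ a" "\<exists>K. \<forall>n\<ge>1. g n \<le> K * n ^ b"
    for f g :: "nat \<Rightarrow> nat" and a b c :: nat
  proof -
    from bounds obtain K1 K2 where "\<forall>n\<ge>1. f n \<le> K1 * n ^ a" "\<forall>n\<ge>1. g n \<le> K2 * n ^ b"
      by (elim exE)
    then have K: "f n \<le> K1 * n ^ a" "g n \<le> K2 * n ^ b" if "n \<ge> 1" for n using that by simp_all
    have "c + (f n + g n) \<le> (c + (K1 + K2)) * n ^ max a b" if n: "n \<ge> 1" for n
    proof -
      have "K1 * n ^ a \<le> K1 * n ^ max a b" "K2 * n ^ b \<le> K2 * n ^ max a b"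
        using n by (auto intro!: mult_left_mono power_increasing)
      moreover have "c \<le> c * n ^ max a b" using n by simp
      ultimately show ?thesis using K[OF n] unfolding distrib_right by linarith
    qed
    then show ?thesis by blast
  qed
  have loop: "\<exists>K. \<forall>n\<ge>1. n * (f n + 9) + 6 \<le> K * n ^ Suc a"
    if bound: "\<exists>K. \<forall>n\<ge>1. f n \<le> K * n ^ a" for f :: "nat \<Rightarrow> nat" and a :: nat
  proof -
    from bound obtain K where "\<forall>n\<ge>1. f n \<le> K * n ^ a" by (elim exE)
    then have K: "f n \<le> K * n ^ a" if "n \<ge> 1" for n using that by simp
    have "n * (f n + 9) + 6 \<le> (K + 15) * n ^ Suc a" if n: "n \<ge> 1" for n
    proof -
      have "n * f n \<le> n * (K * n ^ a)" using K[OF n] by (rule mult_le_mono2)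
      then have "n * f n \<le> K * (n * n ^ a)" by (simp only: mult.left_commute)
      moreover have "n * 1 \<le> n * n ^ a" using n by (intro mult_left_mono) auto
      ultimately show ?thesis using n unfolding power_Suc distrib_left distrib_right by linarith
    qed
    then show ?thesis by blast
  qed
  show ?thesis
  proof (induction p)
    case (HSeq p q)
    then show ?case using seq[of "\<lambda>n. steps Q n p" "degree p" "\<lambda>n. steps Q n q" "degree q" 0] by simp
  next
    case (HIf a b p q)
    then show ?case
      using seq[OF HIf.IH, of "arith_ops (comp_exp Q a) + arith_ops (comp_exp Q b) + 1"]
      by (simp only: steps.simps degree.simps)
  next
    case (HUp d p)
    then show ?case using loop[of "\<lambda>n. steps Q n p" "degree p"] by simp
  next
    case (HDown d p)
    then show ?case using loop[of "\<lambda>n. steps Q n p" "degree p"] by simp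
  qed auto
qed

section \<open>Correctness of the compiler\<close>

lemma address_of_nat: "address (real k) = k"
  by (simp add: address_def)

lemma arith_ops_counter [simp]: "arith_ops (counter_addr Q d) = 2"
  by (simp add: counter_addr_def)

text \<open>Writing to a location must not disturb the counter block, which occupies
  \<open>Q\<close> cells from \<open>Q * n\<close> on, nor the cell that holds
  \<open>n\<close>.\<close>

lemma addr_ge:
  assumes "valid Q n l" "1 \<le> n"
  shows "addr Q n l < Q * n \<or> Q * n + Q \<le> addr Q n l" and "addr Q n l \<noteq> 0"
proof -
  show "addr Q n l < Q * n \<or> Q * n + Q \<le> addr Q n l" using assms
    by (cases l) (auto simp: algebra_simps)
  show "addr Q n l \<noteq> 0" using assms by (cases l) auto
qed

lemma record_eq:
  fixes a b x y Q :: nat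
  assumes "Q * a + x = Q * b + y" "x < Q" "y < Q"
  shows "a = b \<and> x = y"
proof -
  have "(Q * a + x) div Q = a" "(Q * b + y) div Q = b" using assms(2,3) by auto
  then show ?thesis using assms(1) by auto
qed

lemma addr_inj:
  assumes "valid Q n l" "valid Q n l'" "addr Q n l = addr Q n l'"
  shows "l = l'"
proof -
  have low: False if "a < Q * n" "a = Q * (n + k) + x" for a k x
  proof -
    have "Q * (n + k) = Q * n + Q * k" by (rule distrib_left)
    then show False using that by linarith
  qed
  show ?thesis
  proof (cases l)
    case l: (Low a)
    show ?thesis
    proof (cases l')
      case (Low b)
      then show ?thesis using assms l by simp
    next
      case (Glob g)
      then have "a < Q * n" "a = Q * (n + 1) + to_nat g" using assms l by (simp_all only: addr.simps valid.simps)
      from low[OF this] show ?thesis ..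
    next
      case (Brick i g)
      then have "a < Q * n" "a = Q * (n + (2 + i)) + to_nat g"
        using assms l by (simp_all only: addr.simps valid.simps add.assoc)
      from low[OF this] show ?thesis ..
    qed
  next
    case l: (Glob f)
    show ?thesis
    proof (cases l')
      case (Low b)
      then have "b < Q * n" "b = Q * (n + 1) + to_nat f" using assms l by (simp_all only: addr.simps valid.simps)
      from low[OF this] show ?thesis ..
    next
      case (Glob g)
      then show ?thesis using assms l by simp
    next
      case (Brick i g)
      then have "Q * (n + 1) + to_nat f = Q * (n + 2 + i) + to_nat g" "to_nat f < Q" "to_nat g < Q"
        using assms l by (simp_all only: addr.simps valid.simps)
      from record_eq[OF this] show ?thesis by simp
    qed
  next
    case l: (Brick i f)
    show ?thesis
    proof (cases l')
      case (Low b)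
      then have "b < Q * n" "b = Q * (n + (2 + i)) + to_nat f"
        using assms l by (simp_all only: addr.simps valid.simps add.assoc)
      from low[OF this] show ?thesis ..
    next
      case (Glob g)
      then have "Q * (n + 2 + i) + to_nat f = Q * (n + 1) + to_nat g" "to_nat f < Q" "to_nat g < Q"
        using assms l by (simp_all only: addr.simps valid.simps)
      from record_eq[OF this] show ?thesis by simp
    next
      case (Brick i' g)
      then have "Q * (n + 2 + i) + to_nat f = Q * (n + 2 + i') + to_nat g" "to_nat f < Q" "to_nat g < Q"
        using assms l by (simp_all only: addr.simps valid.simps)
      from record_eq[OF this] show ?thesis using l Brick by simp
    qed
  qed
qed

context
  fixes Q n :: nat
  assumes n: "1 \<le> n"
begin

lemma coupled_size: "coupled Q n D \<iota> m M \<Longrightarrow> M (address 0) = real n"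
  using address_of_nat[of 0] by (simp add: coupled_def)

lemma counter_val:
  assumes "coupled Q n D \<iota> m M"
  shows "val (counter_addr Q d) M = real (Q * n + d)" and "well_defined (counter_addr Q d) M"
  using coupled_size[OF assms] Nats_0 by (simp_all add: counter_addr_def)

lemma aff_val:
  assumes "coupled Q n D \<iota> m M" "scoped_aff D a"
  shows "val (comp_aff Q a) M = real (affval n \<iota> a) \<and> well_defined (comp_aff Q a) M"
proof (cases a)
  case (Aff c0 c1 c2 d)
  \<comment> \<open>With \<open>c2 = 0\<close> the counter cell may be outside the tracked ones and
    hold any number; it is still read, but multiplied by zero.\<close>
  have "real c2 * M (address (val (counter_addr Q d) M)) = real (c2 * \<iota> d)"
  proof (cases "c2 = 0")
    case False
    then have "d < D" using assms(2) Aff by simp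
    then show ?thesis using assms(1) by (simp add: counter_val[OF assms(1)] address_of_nat coupled_def
        del: of_nat_add of_nat_mult) simp
  qed simp
  then show ?thesis using coupled_size[OF assms(1)] Nats_0 counter_val[OF assms(1), of d]
    by (simp add: Aff)
qed

lemma aff_range:
  assumes "positive_aff a" "width_aff a \<le> Q" "scoped_aff D a" "\<And>d. d < D \<Longrightarrow> \<iota> d \<le> n"
  shows "1 \<le> affval n \<iota> a \<and> affval n \<iota> a < Q * n"
proof (cases a)
  case (Aff c0 c1 c2 d)
  have "c0 + c1 * n + c2 * \<iota> d \<le> c0 * n + c1 * n + c2 * n"
    using assms(3,4) n Aff by (intro add_mono) auto
  also have "\<dots> = (c0 + c1 + c2) * n" by (simp add: distrib_right)
  also have "\<dots> < Q * n" using assms(2) n Aff by simp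
  finally show ?thesis using assms(1) Aff by simp
qed

lemma loc_val:
  assumes c: "coupled Q n D \<iota> m M" and "scoped_loc D a" "width_loc a \<le> Q"
  shows "val (comp_loc Q a) M = real (addr Q n (lval n \<iota> a)) \<and> well_defined (comp_loc Q a) M \<and>
    valid Q n (lval n \<iota> a)"
proof (cases a)
  case (HLow b)
  then show ?thesis using assms aff_val[OF c, of b] aff_range[of b D \<iota>] by (auto simp: coupled_def)
next
  case (HGlob f)
  then show ?thesis using assms coupled_size[OF c] Nats_0 by (auto simp: algebra_simps)
next
  case (HBrick b f)
  then show ?thesis using assms coupled_size[OF c] Nats_0 aff_val[OF c, of b]
    by (auto simp: algebra_simps)
qed

lemma exp_val:
  assumes c: "coupled Q n D \<iota> m M" and "scoped_exp D e" "width_exp e \<le> Q"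
  shows "val (comp_exp Q e) M = hval n \<iota> m e \<and> well_defined (comp_exp Q e) M"
  using assms(2,3)
proof (induction e)
  case (HRead a)
  then have "val (comp_loc Q a) M = real (addr Q n (lval n \<iota> a))" "well_defined (comp_loc Q a) M"
      "valid Q n (lval n \<iota> a)" using loc_val[OF c, of a] by auto
  then show ?case using c by (simp add: address_of_nat coupled_def)
qed auto

lemma coupled_update:
  assumes "coupled Q n D \<iota> m M" "valid Q n l" "D \<le> Q"
  shows "coupled Q n D \<iota> (m(l := x)) (M(addr Q n l := x))"
  using assms addr_ge[OF assms(2) n] addr_inj[OF assms(2)] unfolding coupled_def by fastforce

lemma coupled_counter:
  assumes "coupled Q n D \<iota> m M" "k \<le> n" "D < Q"
  shows "coupled Q n (Suc D) (\<iota>(D := k)) m (M(Q * n + D := real k))"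
  unfolding coupled_def
proof (intro conjI allI impI)
  have ne: "0 \<noteq> Q * n + D" using assms(3) n by simp
  show "(M(Q * n + D := real k)) 0 = real n"
    unfolding fun_upd_other[OF ne] using assms(1) by (simp add: coupled_def)
  fix l assume l: "valid Q n l"
  have "addr Q n l \<noteq> Q * n + D" using addr_ge(1)[OF l n] assms(3) by linarith
  then show "(M(Q * n + D := real k)) (addr Q n l) = m l" using assms(1) l by (simp add: coupled_def)
next
  fix d assume "d < Suc D"
  then show "(M(Q * n + D := real k)) (Q * n + d) = real ((\<iota>(D := k)) d)" "(\<iota>(D := k)) d \<le> n"
    using assms by (auto simp: coupled_def less_Suc_eq)
qed

lemma coupled_pop:
  assumes "coupled Q n (Suc D) (\<iota>(D := k)) m M"
  shows "coupled Q n D \<iota> m M"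
proof -
  have "M (Q * n + d) = real (\<iota> d) \<and> \<iota> d \<le> n" if "d < D" for d
  proof -
    have "M (Q * n + d) = real ((\<iota>(D := k)) d) \<and> (\<iota>(D := k)) d \<le> n"
      using assms less_SucI[OF that] unfolding coupled_def by blast
    moreover have "(\<iota>(D := k)) d = \<iota> d" using that by simp
    ultimately show ?thesis by (simp only:)
  qed
  then show ?thesis using assms unfolding coupled_def by blast
qed

lemma exec_counter:
  assumes "coupled Q n D' \<iota>' m M" "val e M = real k" "well_defined e M" "k \<le> n" "D < Q"
    and "coupled Q n D \<iota> m M"
  shows "\<exists>M'. exec (Store (counter_addr Q D) e) M (2 + arith_ops e) M' \<and>
    coupled Q n (Suc D) (\<iota>(D := k)) m M'"
proof -
  have "exec (Store (counter_addr Q D) e) M (arith_ops (counter_addr Q D) + arith_ops e)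
      (M(address (val (counter_addr Q D) M) := val e M))"
    using counter_val[OF assms(1)] assms(3) by (intro exec.Store) (auto simp del: of_nat_add of_nat_mult)
  then show ?thesis using coupled_counter[OF assms(6,4,5)] assms(2)
    by (simp add: counter_val[OF assms(1)] address_of_nat del: of_nat_add of_nat_mult) blast
qed

lemma coupled_pop_counter:
  "coupled Q n (Suc D) (\<iota>(D := k)) m M \<Longrightarrow> M (Q * n + D) = real k \<and> k \<le> n"
  by (auto simp: coupled_def)

lemma counter_read:
  assumes "coupled Q n (Suc D) (\<iota>(D := k)) m M"
  shows "val (Cell (counter_addr Q D)) M = real k" and "well_defined (Cell (counter_addr Q D)) M"
  using coupled_pop_counter[OF assms]
  by (simp_all add: counter_val[OF assms] address_of_nat del: of_nat_add of_nat_mult)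

lemma exec_up:
  assumes body: "\<And>k m M. coupled Q n (Suc D) (\<iota>(D := k)) m M \<Longrightarrow>
      \<exists>T M'. exec (compile Q p) M T M' \<and> T \<le> S \<and> coupled Q n (Suc D) (\<iota>(D := k)) (f k m) M'"
    and "D < Q" "coupled Q n (Suc D) (\<iota>(D := k)) m M"
  shows "\<exists>T M'. exec (While_Le (Add (Cell (counter_addr Q D)) (Const 1)) size_cell
       (Seq (compile Q p) (Store (counter_addr Q D) (Add (Cell (counter_addr Q D)) (Const 1))))) M T M' \<and>
     T \<le> (n - k) * (S + 9) + 4 \<and> coupled Q n D \<iota> (fold f [k..<n] m) M'"
  using assms(3)
proof (induction "n - k" arbitrary: k m M)
  case 0
  then have k: "k = n" using coupled_pop_counter by fastforce
  have "exec (While_Le (Add (Cell (counter_addr Q D)) (Const 1)) size_cell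
       (Seq (compile Q p) (Store (counter_addr Q D) (Add (Cell (counter_addr Q D)) (Const 1))))) M
       (arith_ops (Add (Cell (counter_addr Q D)) (Const 1)) + arith_ops size_cell + 1) M"
    by (rule exec.While_False)
      (use counter_read[OF 0(2)] coupled_size[OF 0(2)] Nats_0 k in auto)
  moreover have "coupled Q n D \<iota> (fold f [k..<n] m) M" using coupled_pop[OF 0(2)] k by simp
  ultimately show ?case by (intro exI conjI) (assumption | simp)+
next
  case (Suc x)
  then have k: "k < n" "x = n - Suc k" by linarith+
  note rd = counter_read[OF Suc.prems]
  obtain T1 M1 where M1: "exec (compile Q p) M T1 M1" "T1 \<le> S" "coupled Q n (Suc D) (\<iota>(D := k)) (f k m) M1"
    using body[OF Suc.prems] by blast
  obtain M2 where M2: "exec (Store (counter_addr Q D) (Add (Cell (counter_addr Q D)) (Const 1))) M1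
      (2 + arith_ops (Add (Cell (counter_addr Q D)) (Const 1))) M2"
      "coupled Q n (Suc D) (\<iota>(D := Suc k)) (f k m) M2"
    using exec_counter[OF M1(3), of "Add (Cell (counter_addr Q D)) (Const 1)" "Suc k" D \<iota>]
      counter_read[OF M1(3)] k assms(2) coupled_pop[OF M1(3)] by auto
  obtain T3 M3 where M3: "exec (While_Le (Add (Cell (counter_addr Q D)) (Const 1)) size_cell
       (Seq (compile Q p) (Store (counter_addr Q D) (Add (Cell (counter_addr Q D)) (Const 1))))) M2 T3 M3"
      "T3 \<le> (n - Suc k) * (S + 9) + 4" "coupled Q n D \<iota> (fold f [Suc k..<n] (f k m)) M3"
    using Suc.hyps(1)[OF k(2) M2(2)] by blast
  have wd: "well_defined (Add (Cell (counter_addr Q D)) (Const 1)) M" "well_defined size_cell M"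
    using rd Nats_0 by auto
  have le: "val (Add (Cell (counter_addr Q D)) (Const 1)) M \<le> val size_cell M"
    using rd coupled_size[OF Suc.prems] k by simp
  let ?T = "arith_ops (Add (Cell (counter_addr Q D)) (Const 1)) + arith_ops size_cell + 1 +
      (T1 + (2 + arith_ops (Add (Cell (counter_addr Q D)) (Const 1)))) + T3"
  have "(n - k) * (S + 9) = (S + 9) + (n - Suc k) * (S + 9)"
    using k(1) by (metis Suc_diff_Suc mult_Suc)
  moreover have "?T = T1 + T3 + 9" by simp
  ultimately have T: "?T \<le> (n - k) * (S + 9) + 4" using M1(2) M3(2) by linarith
  have fold: "coupled Q n D \<iota> (fold f [k..<n] m) M3"
    using M3(3) k(1) by (simp only: upt_conv_Cons fold_simps)
  show ?case
    by (rule exI[of _ ?T], rule exI[of _ M3])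
      (intro conjI exec.While_True[OF wd le exec.Seq[OF M1(1) M2(1)] M3(1)] T fold)
qed

lemma exec_down:
  assumes body: "\<And>k m M. coupled Q n (Suc D) (\<iota>(D := k)) m M \<Longrightarrow>
      \<exists>T M'. exec (compile Q p) M T M' \<and> T \<le> S \<and> coupled Q n (Suc D) (\<iota>(D := k)) (f k m) M'"
    and "D < Q" "coupled Q n (Suc D) (\<iota>(D := k)) m M"
  shows "\<exists>T M'. exec (While_Le (Const 1) (Cell (counter_addr Q D))
       (Seq (Store (counter_addr Q D) (Sub (Cell (counter_addr Q D)) (Const 1))) (compile Q p))) M T M' \<and>
     T \<le> k * (S + 9) + 4 \<and> coupled Q n D \<iota> (fold f (rev [0..<k]) m) M'"
  using assms(3)
proof (induction k arbitrary: m M)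
  case 0
  have "exec (While_Le (Const 1) (Cell (counter_addr Q D))
       (Seq (Store (counter_addr Q D) (Sub (Cell (counter_addr Q D)) (Const 1))) (compile Q p))) M
       (arith_ops (Const 1) + arith_ops (Cell (counter_addr Q D)) + 1) M"
    by (rule exec.While_False) (use counter_read[OF 0] in auto)
  moreover have "coupled Q n D \<iota> (fold f (rev [0..<0]) m) M" using coupled_pop[OF 0] by simp
  ultimately show ?case by (intro exI conjI) (assumption | simp)+
next
  case (Suc k)
  note rd = counter_read[OF Suc.prems]
  obtain M1 where M1: "exec (Store (counter_addr Q D) (Sub (Cell (counter_addr Q D)) (Const 1))) M
      (2 + arith_ops (Sub (Cell (counter_addr Q D)) (Const 1))) M1"
      "coupled Q n (Suc D) (\<iota>(D := k)) m M1"
    using exec_counter[OF Suc.prems, of "Sub (Cell (counter_addr Q D)) (Const 1)" k D \<iota>]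
      rd assms(2) coupled_pop[OF Suc.prems] coupled_pop_counter[OF Suc.prems] by auto
  obtain T2 M2 where M2: "exec (compile Q p) M1 T2 M2" "T2 \<le> S" "coupled Q n (Suc D) (\<iota>(D := k)) (f k m) M2"
    using body[OF M1(2)] by blast
  obtain T3 M3 where M3: "exec (While_Le (Const 1) (Cell (counter_addr Q D))
       (Seq (Store (counter_addr Q D) (Sub (Cell (counter_addr Q D)) (Const 1))) (compile Q p))) M2 T3 M3"
      "T3 \<le> k * (S + 9) + 4" "coupled Q n D \<iota> (fold f (rev [0..<k]) (f k m)) M3"
    using Suc.IH[OF M2(3)] by blast
  have wd: "well_defined (Const 1) M" "well_defined (Cell (counter_addr Q D)) M" using rd by auto
  have le: "val (Const 1) M \<le> val (Cell (counter_addr Q D)) M" using rd by simp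
  let ?T = "arith_ops (Const 1) + arith_ops (Cell (counter_addr Q D)) + 1 +
      ((2 + arith_ops (Sub (Cell (counter_addr Q D)) (Const 1))) + T2) + T3"
  have "Suc k * (S + 9) = (S + 9) + k * (S + 9)" by simp
  moreover have "?T = T2 + T3 + 8" by simp
  ultimately have T: "?T \<le> Suc k * (S + 9) + 4" using M2(2) M3(2) by linarith
  have fold: "coupled Q n D \<iota> (fold f (rev [0..<Suc k]) m) M3" using M3(3) by simp
  show ?case
    by (rule exI[of _ ?T], rule exI[of _ M3])
      (intro conjI exec.While_True[OF wd le exec.Seq[OF M1(1) M2(1)] M3(1)] T fold)
qed

text \<open>The induction is over all depths \<open>D\<close> at once: the body of a loop is
  simulated with one more tracked counter, so its induction hypothesis already says that the body
  leaves the counter of the loop unchanged.\<close>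

theorem exec_compile:
  assumes "coupled Q n D \<iota> m M" "scoped D p" "width p \<le> Q" "D \<le> Q"
  shows "\<exists>T M'. exec (compile Q p) M T M' \<and> T \<le> steps Q n p \<and> coupled Q n D \<iota> (run n p \<iota> m) M'"
  using assms
proof (induction p arbitrary: D \<iota> m M)
  case HSkip
  then show ?case by (auto intro: exec.Skip)
next
  case (HSet a e)
  have a: "val (comp_loc Q a) M = real (addr Q n (lval n \<iota> a))" "well_defined (comp_loc Q a) M"
      "valid Q n (lval n \<iota> a)"
    using loc_val[OF HSet(1), of a] HSet(2,3) by auto
  have e: "val (comp_exp Q e) M = hval n \<iota> m e" "well_defined (comp_exp Q e) M"
    using exp_val[OF HSet(1), of e] HSet(2,3) by auto
  have "exec (compile Q (HSet a e)) M (steps Q n (HSet a e))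
      (M(address (val (comp_loc Q a) M) := val (comp_exp Q e) M))"
    using a e exec.Store[of "comp_loc Q a" M "comp_exp Q e"] by simp
  moreover have "coupled Q n D \<iota> (run n (HSet a e) \<iota> m)
      (M(address (val (comp_loc Q a) M) := val (comp_exp Q e) M))"
    using coupled_update[OF HSet(1) a(3) HSet(4), of "hval n \<iota> m e"]
    unfolding a(1) e(1) address_of_nat run.simps .
  ultimately show ?case by (intro exI conjI) (assumption | rule order_refl)+
next
  case (HSeq p q)
  obtain T1 M1 where M1: "exec (compile Q p) M T1 M1" "T1 \<le> steps Q n p" "coupled Q n D \<iota> (run n p \<iota> m) M1"
    using HSeq.IH(1)[OF HSeq.prems(1)] HSeq.prems by auto
  obtain T2 M2 where M2: "exec (compile Q q) M1 T2 M2" "T2 \<le> steps Q n q"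
      "coupled Q n D \<iota> (run n q \<iota> (run n p \<iota> m)) M2"
    using HSeq.IH(2)[OF M1(3)] HSeq.prems by auto
  show ?case using exec.Seq[OF M1(1) M2(1)] M1(2) M2(2,3) by (intro exI conjI) (assumption | simp)+
next
  case (HIf a b p q)
  have e: "val (comp_exp Q a) M = hval n \<iota> m a" "well_defined (comp_exp Q a) M"
      "val (comp_exp Q b) M = hval n \<iota> m b" "well_defined (comp_exp Q b) M"
    using exp_val[OF HIf.prems(1), of a] exp_val[OF HIf.prems(1), of b] HIf.prems(2,3) by auto
  show ?case
  proof (cases "hval n \<iota> m a \<le> hval n \<iota> m b")
    case True
    obtain T1 M1 where M1: "exec (compile Q p) M T1 M1" "T1 \<le> steps Q n p" "coupled Q n D \<iota> (run n p \<iota> m) M1"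
      using HIf.IH(1)[OF HIf.prems(1)] HIf.prems by auto
    have "exec (compile Q (HIf a b p q)) M (arith_ops (comp_exp Q a) + arith_ops (comp_exp Q b) + 1 + T1) M1"
      unfolding compile.simps by (rule exec.If_True) (use e True M1(1) in simp_all)
    then show ?thesis using M1(2,3) True by (intro exI conjI) (assumption | simp)+
  next
    case False
    obtain T1 M1 where M1: "exec (compile Q q) M T1 M1" "T1 \<le> steps Q n q" "coupled Q n D \<iota> (run n q \<iota> m) M1"
      using HIf.IH(2)[OF HIf.prems(1)] HIf.prems by auto
    have "exec (compile Q (HIf a b p q)) M (arith_ops (comp_exp Q a) + arith_ops (comp_exp Q b) + 1 + T1) M1"
      unfolding compile.simps by (rule exec.If_False) (use e False M1(1) in simp_all)
    then show ?thesis using M1(2,3) False by (intro exI conjI) (assumption | simp)+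
  qed
next
  case (HUp d p)
  have d: "d = D" "D < Q" using HUp.prems by auto
  obtain M1 where M1: "exec (Store (counter_addr Q D) (Const 0)) M (2 + arith_ops (Const 0)) M1"
      "coupled Q n (Suc D) (\<iota>(D := 0)) m M1"
    using exec_counter[OF HUp.prems(1), of "Const 0" 0 D \<iota>] HUp.prems(1) d by auto
  have "\<exists>T M'. exec (compile Q p) M T M' \<and> T \<le> steps Q n p \<and>
      coupled Q n (Suc D) (\<iota>(D := k)) (run n p (\<iota>(D := k)) m) M'"
    if "coupled Q n (Suc D) (\<iota>(D := k)) m M" for k m M
    by (rule HUp.IH[OF that]) (use HUp.prems d in auto)
  from exec_up[of D \<iota> p "steps Q n p" "\<lambda>k. run n p (\<iota>(D := k))", OF this d(2) M1(2)]
  obtain T2 M2 where M2: "exec (While_Le (Add (Cell (counter_addr Q D)) (Const 1)) size_cell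
       (Seq (compile Q p) (Store (counter_addr Q D) (Add (Cell (counter_addr Q D)) (Const 1))))) M1 T2 M2"
      "T2 \<le> (n - 0) * (steps Q n p + 9) + 4"
      "coupled Q n D \<iota> (fold (\<lambda>k. run n p (\<iota>(D := k))) [0..<n] m) M2" by blast
  show ?case using exec.Seq[OF M1(1) M2(1)] M2(2,3) d(1) by (intro exI conjI) (assumption | simp)+
next
  case (HDown d p)
  have d: "d = D" "D < Q" using HDown.prems by auto
  obtain M1 where M1: "exec (Store (counter_addr Q D) size_cell) M (2 + arith_ops size_cell) M1"
      "coupled Q n (Suc D) (\<iota>(D := n)) m M1"
    using exec_counter[OF HDown.prems(1), of size_cell n D \<iota>] coupled_size[OF HDown.prems(1)]
      HDown.prems(1) d Nats_0 by auto
  have "\<exists>T M'. exec (compile Q p) M T M' \<and> T \<le> steps Q n p \<and>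
      coupled Q n (Suc D) (\<iota>(D := k)) (run n p (\<iota>(D := k)) m) M'"
    if "coupled Q n (Suc D) (\<iota>(D := k)) m M" for k m M
    by (rule HDown.IH[OF that]) (use HDown.prems d in auto)
  from exec_down[of D \<iota> p "steps Q n p" "\<lambda>k. run n p (\<iota>(D := k))", OF this d(2) M1(2)]
  obtain T2 M2 where M2: "exec (While_Le (Const 1) (Cell (counter_addr Q D))
       (Seq (Store (counter_addr Q D) (Sub (Cell (counter_addr Q D)) (Const 1))) (compile Q p))) M1 T2 M2"
      "T2 \<le> n * (steps Q n p + 9) + 4"
      "coupled Q n D \<iota> (fold (\<lambda>k. run n p (\<iota>(D := k))) (rev [0..<n]) m) M2" by blast
  show ?case using exec.Seq[OF M1(1) M2(1)] M2(2,3) d(1) by (intro exI conjI) (assumption | simp)+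
qed

text \<open>For the two loops whose length depends on the numbers in the input; the number
  \<open>K\<close> of iterations is supplied by the caller through the values of the test along the
  iteration. The additional 1 in \<open>K + 1\<close> pays for the last, failing test.\<close>

lemma exec_while:
  assumes "coupled Q n D \<iota> m M" "scoped D p" "width p \<le> Q" "D \<le> Q"
    and e: "scoped_exp D a" "scoped_exp D b" "width_exp a \<le> Q" "width_exp b \<le> Q"
    and "\<And>k. k < K \<Longrightarrow> hval n \<iota> ((run n p \<iota> ^^ k) m) a \<le> hval n \<iota> ((run n p \<iota> ^^ k) m) b"
    and "\<not> hval n \<iota> ((run n p \<iota> ^^ K) m) a \<le> hval n \<iota> ((run n p \<iota> ^^ K) m) b"
  shows "\<exists>T M'. exec (While_Le (comp_exp Q a) (comp_exp Q b) (compile Q p)) M T M' \<and>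
    T \<le> (K + 1) * (steps Q n p + (arith_ops (comp_exp Q a) + arith_ops (comp_exp Q b) + 1)) \<and>
    coupled Q n D \<iota> ((run n p \<iota> ^^ K) m) M'"
  using assms(1,9,10)
proof (induction K arbitrary: m M)
  case 0
  have "exec (While_Le (comp_exp Q a) (comp_exp Q b) (compile Q p)) M
      (arith_ops (comp_exp Q a) + arith_ops (comp_exp Q b) + 1) M"
    by (rule exec.While_False) (use exp_val[OF 0(1) e(1,3)] exp_val[OF 0(1) e(2,4)] 0(3) in simp_all)
  then show ?case using 0(1) by (intro exI conjI) (assumption | simp)+
next
  case (Suc K)
  have le: "hval n \<iota> m a \<le> hval n \<iota> m b" using Suc.prems(2)[of 0] by simp
  obtain T1 M1 where M1: "exec (compile Q p) M T1 M1" "T1 \<le> steps Q n p" "coupled Q n D \<iota> (run n p \<iota> m) M1"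
    using exec_compile[OF Suc.prems(1) assms(2-4)] by blast
  have eq: "(run n p \<iota> ^^ k) (run n p \<iota> m) = (run n p \<iota> ^^ Suc k) m" for k
    by (simp add: funpow_swap1)
  have "\<exists>T M'. exec (While_Le (comp_exp Q a) (comp_exp Q b) (compile Q p)) M1 T M' \<and>
    T \<le> (K + 1) * (steps Q n p + (arith_ops (comp_exp Q a) + arith_ops (comp_exp Q b) + 1)) \<and>
    coupled Q n D \<iota> ((run n p \<iota> ^^ Suc K) m) M'"
    unfolding eq[symmetric]
  proof (rule Suc.IH[OF M1(3)])
    show "hval n \<iota> ((run n p \<iota> ^^ k) (run n p \<iota> m)) a \<le> hval n \<iota> ((run n p \<iota> ^^ k) (run n p \<iota> m)) b"
      if "k < K" for k
      unfolding eq using that by (intro Suc.prems(2)) simp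
    show "\<not> hval n \<iota> ((run n p \<iota> ^^ K) (run n p \<iota> m)) a \<le> hval n \<iota> ((run n p \<iota> ^^ K) (run n p \<iota> m)) b"
      unfolding eq by (rule Suc.prems(3))
  qed
  then obtain T2 M2 where M2: "exec (While_Le (comp_exp Q a) (comp_exp Q b) (compile Q p)) M1 T2 M2"
    "T2 \<le> (K + 1) * (steps Q n p + (arith_ops (comp_exp Q a) + arith_ops (comp_exp Q b) + 1))"
    "coupled Q n D \<iota> ((run n p \<iota> ^^ Suc K) m) M2" by blast
  have "exec (While_Le (comp_exp Q a) (comp_exp Q b) (compile Q p)) M
     (arith_ops (comp_exp Q a) + arith_ops (comp_exp Q b) + 1 + T1 + T2) M2"
    by (rule exec.While_True[OF _ _ _ M1(1) M2(1)])
      (use exp_val[OF Suc.prems(1) e(1,3)] exp_val[OF Suc.prems(1) e(2,4)] le in simp_all)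
  moreover have "arith_ops (comp_exp Q a) + arith_ops (comp_exp Q b) + 1 + T1 + T2 \<le>
     (Suc K + 1) * (steps Q n p + (arith_ops (comp_exp Q a) + arith_ops (comp_exp Q b) + 1))"
    using M1(2) M2(2) by simp
  ultimately show ?case using M2(3) by blast
qed

end


section \<open>Derived constructs, unfolded into program text of a length independent of
  \<open>n\<close>\<close>

definition seqs :: "hprog list \<Rightarrow> hprog" where
  "seqs ps = foldr HSeq ps HSkip"

definition hsum :: "hexp list \<Rightarrow> hexp" where
  "hsum es = foldr HAdd es (HConst 0)"

definition guards :: "(hexp \<times> hexp) list \<Rightarrow> hprog \<Rightarrow> hprog" where
  "guards bs p = foldr (\<lambda>(a, b) q. HIf a b q HSkip) bs p"

text \<open>A case distinction on a number held in memory. It replaces table lookup: a field is part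
  of the program text and cannot be computed at run time.\<close>

definition switch :: "hexp \<Rightarrow> nat \<Rightarrow> (nat \<Rightarrow> hprog) \<Rightarrow> hprog" where
  "switch e N P = foldr (\<lambda>k q. HIf e (HConst (int k)) (P k) q) [0..<N] HSkip"

lemma run_seqs: "run n (seqs ps) \<iota> m = fold (\<lambda>p. run n p \<iota>) ps m"
  by (induction ps arbitrary: m) (simp_all add: seqs_def)

lemma run_seqs_map: "run n (seqs (map f xs)) \<iota> m = fold (\<lambda>x. run n (f x) \<iota>) xs m"
  by (simp add: run_seqs fold_map comp_def)

lemma hval_hsum: "hval n \<iota> m (hsum (map f [0..<N])) = (\<Sum>j<N. hval n \<iota> m (f j))"
proof -
  have "hval n \<iota> m (hsum es) = sum_list (map (hval n \<iota> m) es)" for es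
    by (induction es) (simp_all add: hsum_def)
  then show ?thesis by (simp add: comp_def interv_sum_list_conv_sum_set_nat atLeast0LessThan)
qed

lemma run_guards:
  "run n (guards bs p) \<iota> m =
     (if \<forall>(a, b)\<in>set bs. hval n \<iota> m a \<le> hval n \<iota> m b then run n p \<iota> m else m)"
  by (induction bs) (auto simp: guards_def)

text \<open>The tests compare \<open>e\<close> with 0, 1, 2 and so on by \<open>\<le>\<close>; for a
  natural number the test that succeeds first is the one at its own value.\<close>

lemma run_switch:
  assumes "hval n \<iota> m e = real k" "k < N"
  shows "run n (switch e N P) \<iota> m = run n (P k) \<iota> m"
proof -
  have "run n (foldr (\<lambda>k q. HIf e (HConst (int k)) (P k) q) [a..<N] HSkip) \<iota> m = run n (P k) \<iota> m"
    if "a \<le> k" for a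
    using that
  proof (induction "k - a" arbitrary: a)
    case 0
    then show ?case using assms by (simp add: upt_conv_Cons)
  next
    case (Suc x)
    then have "x = k - Suc a" "Suc a \<le> k" by linarith+
    then show ?case using Suc(1)[of "Suc a"] assms by (simp add: upt_conv_Cons)
  qed
  then show ?thesis unfolding switch_def by simp
qed

lemma fold_upt:
  assumes "P 0 m" "\<And>k m. k < N \<Longrightarrow> P k m \<Longrightarrow> P (Suc k) (f k m)"
  shows "P N (fold f [0..<N] m)"
  using assms(2)
proof (induction N)
  case 0
  then show ?case using assms(1) by simp
next
  case (Suc N)
  have "P N (fold f [0..<N] m)" by (rule Suc.IH) (simp add: Suc.prems)
  then show ?case using Suc.prems[of N] by simp
qed

lemma fold_rev_upt:
  assumes "P N m" "\<And>k m. k < N \<Longrightarrow> P (Suc k) m \<Longrightarrow> P k (f k m)"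
  shows "P 0 (fold f (rev [0..<N]) m)"
  using assms
proof (induction N arbitrary: m)
  case (Suc N)
  then show ?case using Suc.IH[of "f N m"] by simp
qed simp

text \<open>A syntactic superset of the fields that are written. It serves to see without any
  calculation that the phases leave \<open>Flag\<close> alone.\<close>

primrec wfields :: "hprog \<Rightarrow> field set" where
  "wfields HSkip = {}"
| "wfields (HSet a e) = (case a of HLow _ \<Rightarrow> {} | HGlob f \<Rightarrow> {f} | HBrick _ f \<Rightarrow> {f})"
| "wfields (HSeq p q) = wfields p \<union> wfields q"
| "wfields (HIf a b p q) = wfields p \<union> wfields q"
| "wfields (HUp d p) = wfields p"
| "wfields (HDown d p) = wfields p"

lemma run_frame:
  assumes "f \<notin> wfields p"
  shows "run n p \<iota> m (Glob f) = m (Glob f)" and "run n p \<iota> m (Brick i f) = m (Brick i f)"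
proof -
  have "run n p \<iota> m (Glob f) = m (Glob f) \<and> run n p \<iota> m (Brick i f) = m (Brick i f)" using assms
  proof (induction p arbitrary: \<iota> m)
    case (HSet a e)
    then show ?case by (cases a) auto
  next
    case (HUp d p)
    have "fold (\<lambda>i. run n p (\<iota>(d := i))) xs m (Glob f) = m (Glob f) \<and>
        fold (\<lambda>i. run n p (\<iota>(d := i))) xs m (Brick i f) = m (Brick i f)" for xs
      using HUp by (induction xs arbitrary: m) simp_all
    then show ?case by simp
  next
    case (HDown d p)
    have "fold (\<lambda>i. run n p (\<iota>(d := i))) xs m (Glob f) = m (Glob f) \<and>
        fold (\<lambda>i. run n p (\<iota>(d := i))) xs m (Brick i f) = m (Brick i f)" for xs
      using HDown by (induction xs arbitrary: m) simp_all
    then show ?case by simp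
  qed auto
  then show "run n p \<iota> m (Glob f) = m (Glob f)" and "run n p \<iota> m (Brick i f) = m (Brick i f)" by auto
qed

lemma seqs_simps [simp]:
  "wfields (seqs ps) = (\<Union>p\<in>set ps. wfields p)"
  "scoped D (seqs ps) \<longleftrightarrow> (\<forall>p\<in>set ps. scoped D p)"
  by (induction ps) (auto simp: seqs_def)

lemma guards_simps [simp]:
  "wfields (guards bs p) = wfields p"
  "scoped D (guards bs p) \<longleftrightarrow> (\<forall>(a, b)\<in>set bs. scoped_exp D a \<and> scoped_exp D b) \<and> scoped D p"
  "degree (guards bs p) = degree p"
proof -
  have guards_Cons: "guards ((a, b) # bs) p = HIf a b (guards bs p) HSkip" for a b bs by (simp add: guards_def)
  have Nil: "guards [] p = p" by (simp add: guards_def)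
  have "wfields (guards bs p) = wfields p \<and>
    (scoped D (guards bs p) \<longleftrightarrow> (\<forall>ab\<in>set bs. scoped_exp D (fst ab) \<and> scoped_exp D (snd ab)) \<and> scoped D p) \<and>
    degree (guards bs p) = degree p"
  proof (induction bs)
    case (Cons ab bs)
    then show ?case by (cases ab) (simp add: guards_Cons)
  qed (simp add: Nil)
  then show "wfields (guards bs p) = wfields p"
    "scoped D (guards bs p) \<longleftrightarrow> (\<forall>(a, b)\<in>set bs. scoped_exp D a \<and> scoped_exp D b) \<and> scoped D p"
    "degree (guards bs p) = degree p"
    by (auto simp: case_prod_unfold)
qed

lemma switch_simps:
  "wfields (switch e N P) = (\<Union>k<N. wfields (P k))"
  "scoped_exp D e \<Longrightarrow> scoped D (switch e N P) \<longleftrightarrow> (\<forall>k<N. scoped D (P k))"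
proof -
  have "wfields (foldr (\<lambda>k q. HIf e (HConst (int k)) (P k) q) xs HSkip) = (\<Union>k\<in>set xs. wfields (P k))" for xs
    by (induction xs) auto
  then show "wfields (switch e N P) = (\<Union>k<N. wfields (P k))" by (auto simp: switch_def)
  have "scoped_exp D e \<Longrightarrow>
      scoped D (foldr (\<lambda>k q. HIf e (HConst (int k)) (P k) q) xs HSkip) \<longleftrightarrow> (\<forall>k\<in>set xs. scoped D (P k))" for xs
    by (induction xs) auto
  then show "scoped_exp D e \<Longrightarrow> scoped D (switch e N P) \<longleftrightarrow> (\<forall>k<N. scoped D (P k))"
    by (auto simp: switch_def)
qed

lemma degree_seqs_le: "(\<And>p. p \<in> set ps \<Longrightarrow> degree p \<le> N) \<Longrightarrow> degree (seqs ps) \<le> N"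
  by (induction ps) (auto simp: seqs_def)

lemma degree_seqs_0 [simp]: "degree (seqs ps) = 0 \<longleftrightarrow> (\<forall>p\<in>set ps. degree p = 0)"
  by (induction ps) (auto simp: seqs_def)

lemma degree_switch_0 [simp]: "degree (switch e N P) = 0 \<longleftrightarrow> (\<forall>k<N. degree (P k) = 0)"
proof -
  have "degree (foldr (\<lambda>k q. HIf e (HConst (int k)) (P k) q) xs HSkip) = 0 \<longleftrightarrow>
      (\<forall>k\<in>set xs. degree (P k) = 0)" for xs
    by (induction xs) auto
  then show ?thesis by (auto simp: switch_def)
qed

lemma scoped_hsum [simp]: "scoped_exp D (hsum es) \<longleftrightarrow> (\<forall>e\<in>set es. scoped_exp D e)"
  by (induction es) (auto simp: hsum_def)


section \<open>The best augmentation step\<close>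

abbreviation here :: "nat \<Rightarrow> nat \<Rightarrow> field \<Rightarrow> hloc" where
  "here d k f \<equiv> HBrick (Aff k 0 1 d) f"

text \<open>An edge \<open>(v, k')\<close> of state \<open>k\<close> means that after using brick \<open>v\<close> in state \<open>k\<close> the partial sum
  is in state \<open>k'\<close>.\<close>

locale transitions =
  fixes T :: nat and E :: "nat \<Rightarrow> ((nat \<Rightarrow> int) \<times> nat) list" and S :: nat and C :: int
  assumes S_pos: "0 < S"
    and E_ne: "k < S \<Longrightarrow> E k \<noteq> []"
    and E_zero: "k < S \<Longrightarrow> E k ! 0 = (\<lambda>_. 0, k)"
    and E_target: "k < S \<Longrightarrow> (v, k') \<in> set (E k) \<Longrightarrow> k' < S"
    and E_bound: "k < S \<Longrightarrow> (v, k') \<in> set (E k) \<Longrightarrow> \<bar>v j\<bar> \<le> C"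
begin

definition brick_cost :: "nat \<Rightarrow> (nat \<Rightarrow> int) \<Rightarrow> hexp" where
  "brick_cost d v = hsum (map (\<lambda>j. HMul (HConst (v j)) (HRead (here d 0 (Cost j)))) [0..<T])"

text \<open>The offset 1 addresses the next brick. At the last brick this is the record with index
  \<open>n\<close>, which belongs to no brick of the program and holds the terminal costs.\<close>

definition cand :: "nat \<Rightarrow> (nat \<Rightarrow> int) \<times> nat \<Rightarrow> hexp" where
  "cand d e = HAdd (brick_cost d (fst e)) (HRead (here d 1 (Val (snd e))))"

definition sides :: "(bool \<times> nat) list" where
  "sides = List.product [True, False] [0..<T]"

lemma set_sides: "set sides = UNIV \<times> {..<T}"
  by (auto simp: sides_def)

definition brick_guards :: "nat \<Rightarrow> (nat \<Rightarrow> int) \<Rightarrow> (hexp \<times> hexp) list" where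
  "brick_guards d v = map (\<lambda>(\<sigma>, j). (HMul (HConst (sg \<sigma>))
       (HAdd (HRead (here d 0 (Pos j))) (HMul (HRead (HGlob Scale)) (HConst (v j)))),
     HRead (here d 0 (Box \<sigma> j)))) sides"

definition try_edge :: "nat \<Rightarrow> nat \<Rightarrow> nat \<Rightarrow> hprog" where
  "try_edge d k q = guards (brick_guards d (fst (E k ! q)))
     (HIf (cand d (E k ! q)) (HRead (here d 0 (Val k)))
       (HSeq (HSet (here d 0 (Val k)) (cand d (E k ! q)))
             (HSet (here d 0 (Choice k)) (HConst (int q)))) HSkip)"

text \<open>Edge 0 is the zero brick, which fits whenever the current point lies in the box.
  Starting from it provides a finite first value, so no representation of infinity is
  needed.\<close>

definition dp_state :: "nat \<Rightarrow> nat \<Rightarrow> hprog" where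
  "dp_state d k = HSeq (HSeq (HSet (here d 0 (Val k)) (cand d (E k ! 0)))
       (HSet (here d 0 (Choice k)) (HConst 0)))
     (seqs (map (try_edge d k) [0..<length (E k)]))"

definition dp :: "nat \<Rightarrow> hprog" where
  "dp d = HDown d (seqs (map (dp_state d) [0..<S]))"

definition take_edge :: "nat \<Rightarrow> nat \<Rightarrow> nat \<Rightarrow> hprog" where
  "take_edge d k q = HSeq (seqs (map (\<lambda>j. HSet (here d 0 (Pos j))
       (HAdd (HRead (here d 0 (Pos j))) (HMul (HRead (HGlob Scale)) (HConst (fst (E k ! q) j))))) [0..<T]))
     (HSet (HGlob State) (HConst (int (snd (E k ! q)))))"

text \<open>Both the state and the stored choice are numbers in memory that select a piece of
  program text, hence the two nested switches.\<close>

definition forward :: "nat \<Rightarrow> hprog" where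
  "forward d = HSeq (HSet (HGlob State) (HConst 0))
     (HUp d (switch (HRead (HGlob State)) S (\<lambda>k.
        switch (HRead (here d 0 (Choice k))) (length (E k)) (take_edge d k))))"

definition augment :: "nat \<Rightarrow> hprog" where
  "augment d = HSeq (dp d) (forward d)"

definition fits :: "store \<Rightarrow> nat \<Rightarrow> (nat \<Rightarrow> int) \<Rightarrow> bool" where
  "fits m i v \<longleftrightarrow> (\<forall>\<sigma>. \<forall>j<T. of_int (sg \<sigma>) * (m (Brick i (Pos j)) + m (Glob Scale) * of_int (v j))
     \<le> m (Brick i (Box \<sigma> j)))"

definition bcost :: "store \<Rightarrow> nat \<Rightarrow> (nat \<Rightarrow> int) \<Rightarrow> real" where
  "bcost m i v = (\<Sum>j<T. of_int (v j) * m (Brick i (Cost j)))"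

definition edge_val :: "store \<Rightarrow> nat \<Rightarrow> (nat \<Rightarrow> int) \<times> nat \<Rightarrow> real" where
  "edge_val m i e = bcost m i (fst e) + m (Brick (Suc i) (Val (snd e)))"

text \<open>The optimality equation in two halves: the stored choice fits and attains the stored
  value, and no fitting edge has a smaller one.\<close>

definition bellman :: "store \<Rightarrow> nat \<Rightarrow> nat \<Rightarrow> bool" where
  "bellman m i k \<longleftrightarrow> (\<exists>q<length (E k). m (Brick i (Choice k)) = real q \<and> fits m i (fst (E k ! q)) \<and>
       m (Brick i (Val k)) = edge_val m i (E k ! q)) \<and>
     (\<forall>q<length (E k). fits m i (fst (E k ! q)) \<longrightarrow> m (Brick i (Val k)) \<le> edge_val m i (E k ! q))"

lemma hval_cand: "hval n \<iota> m (cand d e) = edge_val m (\<iota> d) e"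
  by (simp add: cand_def brick_cost_def hval_hsum edge_val_def bcost_def)

lemma guards_fits:
  "(\<forall>(a, b)\<in>set (brick_guards d v). hval n \<iota> m a \<le> hval n \<iota> m b) \<longleftrightarrow> fits m (\<iota> d) v"
  by (simp add: brick_guards_def fits_def set_sides) (simp add: Ball_def)

lemma run_try_edge:
  "run n (try_edge d k q) \<iota> m =
    (if fits m (\<iota> d) (fst (E k ! q)) \<and> edge_val m (\<iota> d) (E k ! q) \<le> m (Brick (\<iota> d) (Val k))
     then m(Brick (\<iota> d) (Val k) := edge_val m (\<iota> d) (E k ! q), Brick (\<iota> d) (Choice k) := real q) else m)"
  by (simp add: try_edge_def run_guards guards_fits hval_cand)

lemma depends_cong:
  assumes "\<And>j. m' (Brick i (Pos j)) = m (Brick i (Pos j))" "\<And>\<sigma> j. m' (Brick i (Box \<sigma> j)) = m (Brick i (Box \<sigma> j))"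
    "\<And>j. m' (Brick i (Cost j)) = m (Brick i (Cost j))" "m' (Glob Scale) = m (Glob Scale)"
    "\<And>k. m' (Brick (Suc i) (Val k)) = m (Brick (Suc i) (Val k))"
  shows "fits m' i v = fits m i v" and "edge_val m' i e = edge_val m i e"
  using assms by (simp_all add: fits_def edge_val_def bcost_def)

text \<open>\<open>X\<close> marks the pairs of brick and state whose table entries may have
  changed. Filling the table of one brick reads only the table of the next brick, so earlier results
  remain correct.\<close>

definition dp_frame :: "(nat \<Rightarrow> nat \<Rightarrow> bool) \<Rightarrow> store \<Rightarrow> store \<Rightarrow> bool" where
  "dp_frame X m m' \<longleftrightarrow> (\<forall>l. (\<forall>i k. X i k \<longrightarrow> l \<noteq> Brick i (Val k) \<and> l \<noteq> Brick i (Choice k)) \<longrightarrow> m' l = m l)"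

lemma dp_frameD:
  assumes "dp_frame X m m'"
  shows "m' (Glob f) = m (Glob f)" "m' (Brick i (Pos j)) = m (Brick i (Pos j))"
    "m' (Brick i (Box \<sigma> j)) = m (Brick i (Box \<sigma> j))" "m' (Brick i (Cost j)) = m (Brick i (Cost j))"
    "m' (Brick i (Bnd \<sigma> j)) = m (Brick i (Bnd \<sigma> j))"
    "\<not> X i k \<Longrightarrow> m' (Brick i (Val k)) = m (Brick i (Val k))"
    "\<not> X i k \<Longrightarrow> m' (Brick i (Choice k)) = m (Brick i (Choice k))"
proof -
  note * = assms[unfolded dp_frame_def, rule_format]
  show "m' (Glob f) = m (Glob f)" "m' (Brick i (Pos j)) = m (Brick i (Pos j))"
    "m' (Brick i (Box \<sigma> j)) = m (Brick i (Box \<sigma> j))" "m' (Brick i (Cost j)) = m (Brick i (Cost j))"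
    "m' (Brick i (Bnd \<sigma> j)) = m (Brick i (Bnd \<sigma> j))"
    by (rule *; simp)+
  show "m' (Brick i (Val k)) = m (Brick i (Val k))" "m' (Brick i (Choice k)) = m (Brick i (Choice k))"
    if "\<not> X i k" by (rule *; use that in auto)+
qed

lemma dp_state_spec:
  assumes k: "k < S"
    and zero_fits: "fits m (\<iota> d) (\<lambda>_. 0)"
  shows "dp_frame (\<lambda>i k'. i = \<iota> d \<and> k' = k) m (run n (dp_state d k) \<iota> m)"
    and "bellman (run n (dp_state d k) \<iota> m) (\<iota> d) k"
proof -
  let ?i = "\<iota> d"
  let ?X = "\<lambda>i k'. i = \<iota> d \<and> k' = k"
  \<comment> \<open>Fitting and edge values are evaluated in the initial store \<open>m\<close>; by
    the frame condition they are the same in the current one.\<close>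
  define P where "P N m' \<longleftrightarrow> dp_frame ?X m m' \<and>
     (\<exists>q<length (E k). m' (Brick ?i (Choice k)) = real q \<and> fits m ?i (fst (E k ! q)) \<and>
       m' (Brick ?i (Val k)) = edge_val m ?i (E k ! q)) \<and>
     (\<forall>q<N. fits m ?i (fst (E k ! q)) \<longrightarrow> m' (Brick ?i (Val k)) \<le> edge_val m ?i (E k ! q))" for N m'
  define m0 where "m0 = m(Brick ?i (Val k) := edge_val m ?i (E k ! 0), Brick ?i (Choice k) := 0)"
  have cong: "fits m' ?i v = fits m ?i v" "edge_val m' ?i e = edge_val m ?i e"
    if "dp_frame ?X m m'" for m' v e
    using depends_cong[of m' ?i m] dp_frameD[OF that] by auto
  have "P 0 m0" unfolding P_def
  proof (intro conjI)
    show "dp_frame ?X m m0" by (auto simp: dp_frame_def m0_def)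
    show "\<exists>q<length (E k). m0 (Brick ?i (Choice k)) = real q \<and> fits m ?i (fst (E k ! q)) \<and>
       m0 (Brick ?i (Val k)) = edge_val m ?i (E k ! q)"
      using E_ne[OF k] E_zero[OF k] zero_fits by (intro exI[of _ 0]) (simp add: m0_def)
  qed simp
  have "P (length (E k)) (fold (\<lambda>q. run n (try_edge d k q) \<iota>) [0..<length (E k)] m0)"
  proof (rule fold_upt[where P = P])
    fix q m' assume q: "q < length (E k)" and m': "P q m'"
    have fr: "dp_frame ?X m m'" using m' by (simp add: P_def)
    show "P (Suc q) (run n (try_edge d k q) \<iota> m')"
    proof (cases "fits m ?i (fst (E k ! q)) \<and> edge_val m ?i (E k ! q) \<le> m' (Brick ?i (Val k))")
      case True
      have fr': "dp_frame ?X m (run n (try_edge d k q) \<iota> m')"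
        using fr by (auto simp: dp_frame_def run_try_edge)
      show ?thesis unfolding P_def
      proof (intro conjI fr' allI impI)
        show "\<exists>q'<length (E k). run n (try_edge d k q) \<iota> m' (Brick ?i (Choice k)) = real q' \<and>
            fits m ?i (fst (E k ! q')) \<and>
            run n (try_edge d k q) \<iota> m' (Brick ?i (Val k)) = edge_val m ?i (E k ! q')"
          using True q by (intro exI[of _ q]) (simp add: run_try_edge cong[OF fr])
        fix q' assume "q' < Suc q" "fits m ?i (fst (E k ! q'))"
        then show "run n (try_edge d k q) \<iota> m' (Brick ?i (Val k)) \<le> edge_val m ?i (E k ! q')"
          using True m' by (auto simp: run_try_edge cong[OF fr] P_def less_Suc_eq intro: order_trans)
      qed
    next
      case False
      then have "run n (try_edge d k q) \<iota> m' = m'" by (auto simp: run_try_edge cong[OF fr])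
      then show ?thesis using m' False by (auto simp: P_def less_Suc_eq)
    qed
  qed (rule \<open>P 0 m0\<close>)
  moreover have "run n (dp_state d k) \<iota> m =
      fold (\<lambda>q. run n (try_edge d k q) \<iota>) [0..<length (E k)] m0"
    by (simp add: dp_state_def run_seqs_map hval_cand m0_def)
  ultimately have P: "P (length (E k)) (run n (dp_state d k) \<iota> m)" by simp
  then show fr: "dp_frame ?X m (run n (dp_state d k) \<iota> m)" by (simp add: P_def)
  show "bellman (run n (dp_state d k) \<iota> m) ?i k"
    using P unfolding bellman_def P_def cong[OF fr] by blast
qed

lemma bellman_cong:
  assumes "dp_frame X m m'" "\<And>k'. \<not> X (Suc i) k'" "\<not> X i k"
  shows "bellman m' i k = bellman m i k"
  using depends_cong[of m' i m] dp_frameD[OF assms(1)] assms(2,3) by (simp add: bellman_def)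

lemma dp_frame_trans:
  assumes "dp_frame X m m'" "dp_frame Y m' m''" "\<And>i k. X i k \<or> Y i k \<Longrightarrow> Z i k"
  shows "dp_frame Z m m''"
  using assms unfolding dp_frame_def by metis

lemma dp_row_spec:
  assumes "fits m (\<iota> d) (\<lambda>_. 0)"
  shows "dp_frame (\<lambda>i k'. i = \<iota> d \<and> k' < S) m (run n (seqs (map (dp_state d) [0..<S])) \<iota> m) \<and>
    (\<forall>k<S. bellman (run n (seqs (map (dp_state d) [0..<S])) \<iota> m) (\<iota> d) k)"
proof -
  define P where "P N m' \<longleftrightarrow> dp_frame (\<lambda>i k'. i = \<iota> d \<and> k' < N) m m' \<and> (\<forall>k<N. bellman m' (\<iota> d) k)" for N m'
  have "P S (fold (\<lambda>k. run n (dp_state d k) \<iota>) [0..<S] m)"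
  proof (rule fold_upt[where P = P])
    show "P 0 m" by (simp add: P_def dp_frame_def)
    fix k m' assume k: "k < S" and m': "P k m'"
    have fr: "dp_frame (\<lambda>i k'. i = \<iota> d \<and> k' < k) m m'" using m' by (simp add: P_def)
    have zf: "fits m' (\<iota> d) (\<lambda>_. 0)" using assms dp_frameD[OF fr] by (simp add: fits_def)
    note sp = dp_state_spec[where \<iota> = \<iota> and d = d and m = m', OF k zf, of n]
    show "P (Suc k) (run n (dp_state d k) \<iota> m')" unfolding P_def
    proof (intro conjI allI impI)
      show "dp_frame (\<lambda>i k'. i = \<iota> d \<and> k' < Suc k) m (run n (dp_state d k) \<iota> m')"
        by (rule dp_frame_trans[OF fr sp(1)]) auto
      fix k' assume "k' < Suc k"
      then show "bellman (run n (dp_state d k) \<iota> m') (\<iota> d) k'"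
        using sp(2) bellman_cong[OF sp(1), of "\<iota> d" k'] m' by (cases "k' = k") (auto simp: P_def)
    qed
  qed
  then show ?thesis by (simp add: P_def run_seqs_map)
qed

lemma dp_spec:
  assumes "\<And>i. i < n \<Longrightarrow> fits m i (\<lambda>_. 0)"
  shows "dp_frame (\<lambda>i k'. i < n \<and> k' < S) m (run n (dp d) \<iota> m)"
    and "i < n \<Longrightarrow> k < S \<Longrightarrow> bellman (run n (dp d) \<iota> m) i k"
proof -
  define P where "P N m' \<longleftrightarrow> dp_frame (\<lambda>i k'. N \<le> i \<and> i < n \<and> k' < S) m m' \<and>
     (\<forall>i k. N \<le> i \<longrightarrow> i < n \<longrightarrow> k < S \<longrightarrow> bellman m' i k)" for N m'
  have "P 0 (fold (\<lambda>i. run n (seqs (map (dp_state d) [0..<S])) (\<iota>(d := i))) (rev [0..<n]) m)"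
  proof (rule fold_rev_upt[where P = P])
    show "P n m" by (simp add: P_def dp_frame_def)
    fix N m' assume N: "N < n" and m': "P (Suc N) m'"
    let ?m = "run n (seqs (map (dp_state d) [0..<S])) (\<iota>(d := N)) m'"
    have fr: "dp_frame (\<lambda>i k'. Suc N \<le> i \<and> i < n \<and> k' < S) m m'" using m' by (simp add: P_def)
    have zf: "fits m' ((\<iota>(d := N)) d) (\<lambda>_. 0)" using assms[OF N] dp_frameD[OF fr] by (simp add: fits_def)
    have sp: "dp_frame (\<lambda>i k'. i = N \<and> k' < S) m' ?m" "\<And>k. k < S \<Longrightarrow> bellman ?m N k"
      using dp_row_spec[where \<iota> = "\<iota>(d := N)" and d = d and m = m', OF zf, of n] by auto
    show "P N ?m" unfolding P_def
    proof (intro conjI allI impI)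
      show "dp_frame (\<lambda>i k'. N \<le> i \<and> i < n \<and> k' < S) m ?m"
        by (rule dp_frame_trans[OF fr sp(1)]) (use N in auto)
      fix i k assume "N \<le> i" "i < n" "k < S"
      then show "bellman ?m i k"
        using sp(2)[of k] bellman_cong[OF sp(1), of i k] m' by (cases "i = N") (auto simp: P_def)
    qed
  qed
  then have P: "P 0 (run n (dp d) \<iota> m)" by (simp add: dp_def)
  then show "dp_frame (\<lambda>i k'. i < n \<and> k' < S) m (run n (dp d) \<iota> m)" by (simp add: P_def)
  show "i < n \<Longrightarrow> k < S \<Longrightarrow> bellman (run n (dp d) \<iota> m) i k" using P by (simp add: P_def)
qed

lemma run_take_edge:
  "run n (take_edge d k q) \<iota> m = (\<lambda>l. case l of Glob State \<Rightarrow> real (snd (E k ! q))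
     | Brick i (Pos j) \<Rightarrow> m l + (if i = \<iota> d \<and> j < T then m (Glob Scale) * of_int (fst (E k ! q) j) else 0)
     | _ \<Rightarrow> m l)"
proof -
  let ?v = "fst (E k ! q)"
  define P where "P N m' \<longleftrightarrow> m' = (\<lambda>l. case l of Brick i (Pos j) \<Rightarrow>
      m l + (if i = \<iota> d \<and> j < N then m (Glob Scale) * of_int (?v j) else 0) | _ \<Rightarrow> m l)" for N and m' :: store
  have "P T (fold (\<lambda>j. run n (HSet (here d 0 (Pos j))
       (HAdd (HRead (here d 0 (Pos j))) (HMul (HRead (HGlob Scale)) (HConst (?v j))))) \<iota>) [0..<T] m)"
  proof (rule fold_upt[where P = P])
    show "P 0 m" by (auto simp: P_def fun_eq_iff split: loc.split field.split)
    fix j m' assume "P j m'"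
    then show "P (Suc j) (run n (HSet (here d 0 (Pos j))
       (HAdd (HRead (here d 0 (Pos j))) (HMul (HRead (HGlob Scale)) (HConst (?v j))))) \<iota> m')"
      by (auto simp: P_def fun_eq_iff less_Suc_eq split: loc.split field.split)
  qed
  then show ?thesis
    by (auto simp: take_edge_def run_seqs_map P_def fun_eq_iff split: loc.split field.split)
qed

text \<open>The start is the state of the zero partial sum. The end is left free here; returning to
  state 0 is a separate requirement, enforced in the program by the terminal costs.\<close>

definition path :: "nat \<Rightarrow> (nat \<Rightarrow> nat) \<Rightarrow> (nat \<Rightarrow> nat \<Rightarrow> int) \<Rightarrow> bool" where
  "path n st g \<longleftrightarrow> st 0 = 0 \<and> (\<forall>i<n. (g i, st (Suc i)) \<in> set (E (st i)))"

lemma path_states: "path n st g \<Longrightarrow> i \<le> n \<Longrightarrow> st i < S"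
proof (induction i)
  case 0
  then show ?case using S_pos by (simp add: path_def)
next
  case (Suc i)
  then show ?case using E_target[of "st i" "g i" "st (Suc i)"] by (simp add: path_def)
qed

text \<open>The walk changes only positions and the current state, never the table, so the whole
  path can be defined from the choices in the initial store.\<close>

lemma forward_spec:
  assumes bell: "\<And>i k. i < n \<Longrightarrow> k < S \<Longrightarrow> bellman m i k"
  shows "\<exists>st g. path n st g \<and> (\<forall>i<n. fits m i (g i)) \<and>
    (\<forall>i<n. m (Brick i (Val (st i))) = bcost m i (g i) + m (Brick (Suc i) (Val (st (Suc i))))) \<and>
    run n (forward d) \<iota> m = (\<lambda>l. case l of Glob State \<Rightarrow> real (st n)
     | Brick i (Pos j) \<Rightarrow> m l + (if i < n \<and> j < T then m (Glob Scale) * of_int (g i j) else 0)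
     | _ \<Rightarrow> m l)"
proof -
  have "\<exists>q. i < n \<longrightarrow> k < S \<longrightarrow> q < length (E k) \<and> m (Brick i (Choice k)) = real q \<and>
      fits m i (fst (E k ! q)) \<and> m (Brick i (Val k)) = edge_val m i (E k ! q)" for i k
    using bell unfolding bellman_def by blast
  then obtain ch where ch: "\<And>i k. i < n \<Longrightarrow> k < S \<Longrightarrow> ch i k < length (E k) \<and>
      m (Brick i (Choice k)) = real (ch i k) \<and>
      fits m i (fst (E k ! ch i k)) \<and> m (Brick i (Val k)) = edge_val m i (E k ! ch i k)" by metis
  define st where "st = rec_nat (0 :: nat) (\<lambda>i k. snd (E k ! ch i k))"
  define g where "g i = fst (E (st i) ! ch i (st i))" for i
  have st: "st 0 = 0" "\<And>i. st (Suc i) = snd (E (st i) ! ch i (st i))" by (simp_all add: st_def)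
  have stS: "st i < S" if "i \<le> n" for i
    using that
  proof (induction i)
    case 0
    then show ?case using S_pos by (simp add: st)
  next
    case (Suc i)
    then have "E (st i) ! ch i (st i) \<in> set (E (st i))" using ch[of i "st i"] by (intro nth_mem) simp
    then show ?case using E_target[of "st i" "g i" "st (Suc i)"] Suc by (simp add: st(2) g_def)
  qed
  have path: "path n st g" unfolding path_def
  proof (intro conjI allI impI)
    show "st 0 = 0" by (rule st)
    fix i assume i: "i < n"
    have "E (st i) ! ch i (st i) \<in> set (E (st i))" using ch[OF i stS[of i]] i by simp
    then show "(g i, st (Suc i)) \<in> set (E (st i))" by (simp add: st(2) g_def)
  qed
  define P where "P N m' \<longleftrightarrow> m' = (\<lambda>l. case l of Glob State \<Rightarrow> real (st N)
     | Brick i (Pos j) \<Rightarrow> m l + (if i < N \<and> j < T then m (Glob Scale) * of_int (g i j) else 0)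
     | _ \<Rightarrow> m l)" for N and m' :: store
  let ?body = "switch (HRead (HGlob State)) S (\<lambda>k.
        switch (HRead (here d 0 (Choice k))) (length (E k)) (take_edge d k))"
  have "P n (fold (\<lambda>i. run n ?body (\<iota>(d := i))) [0..<n] (m(Glob State := 0)))"
  proof (rule fold_upt[where P = P])
    show "P 0 (m(Glob State := 0))" by (auto simp: P_def st fun_eq_iff split: loc.split field.split)
    fix i m' assume i: "i < n" and m': "P i m'"
    have S: "st i < S" using stS i by simp
    have "hval n (\<iota>(d := i)) m' (HRead (HGlob State)) = real (st i)" using m' by (simp add: P_def)
    note 1 = run_switch[OF this S]
    have "hval n (\<iota>(d := i)) m' (HRead (here d 0 (Choice (st i)))) = real (ch i (st i))"
      using m' ch[OF i S] by (simp add: P_def)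
    note 2 = run_switch[OF this]
    have eq: "run n ?body (\<iota>(d := i)) m' = run n (take_edge d (st i) (ch i (st i))) (\<iota>(d := i)) m'"
      unfolding 1 using ch[OF i S] by (subst 2) auto
    show "P (Suc i) (run n ?body (\<iota>(d := i)) m')" unfolding eq
      using m' unfolding run_take_edge P_def
      by (auto simp: fun_eq_iff st(2) g_def less_Suc_eq split: loc.split field.split)
  qed
  then have run: "run n (forward d) \<iota> m = (\<lambda>l. case l of Glob State \<Rightarrow> real (st n)
     | Brick i (Pos j) \<Rightarrow> m l + (if i < n \<and> j < T then m (Glob Scale) * of_int (g i j) else 0)
     | _ \<Rightarrow> m l)" by (simp add: forward_def P_def)
  have "fits m i (g i) \<and> m (Brick i (Val (st i))) = bcost m i (g i) + m (Brick (Suc i) (Val (st (Suc i))))"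
    if "i < n" for i
    using ch[OF that stS[of i]] that by (simp add: g_def st(2) edge_val_def)
  then show ?thesis using path run by blast
qed

text \<open>The inequalities for the single edges telescope along the path. It is proved for initial
  segments so that the induction can run.\<close>

lemma bellman_lower:
  assumes bell: "\<And>i k. i < n \<Longrightarrow> k < S \<Longrightarrow> bellman m i k"
    and path: "path n st g" and fit: "\<And>i. i < n \<Longrightarrow> fits m i (g i)" and "i \<le> n"
  shows "m (Brick 0 (Val 0)) \<le> (\<Sum>i'<i. bcost m i' (g i')) + m (Brick i (Val (st i)))"
  using assms(4)
proof (induction i)
  case 0
  then show ?case using path by (simp add: path_def)
next
  case (Suc i)
  have S: "st i < S" using path_states[OF path] Suc by simp
  have "(g i, st (Suc i)) \<in> set (E (st i))" using path Suc by (simp add: path_def)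
  then obtain q where q: "q < length (E (st i))" "E (st i) ! q = (g i, st (Suc i))" by (auto simp: in_set_conv_nth)
  have "fits m i (fst (E (st i) ! q))" using fit[of i] Suc.prems q(2) by simp
  then have "m (Brick i (Val (st i))) \<le> edge_val m i (E (st i) ! q)"
    using bell[of i "st i"] S q(1) Suc.prems unfolding bellman_def by (metis Suc_le_lessD)
  then show ?case using Suc q(2) by (simp add: edge_val_def)
qed

end


section \<open>One scaling phase\<close>

text \<open>A simultaneous assignment: the right-hand sides do not read the cells that are written,
  so all of them may be evaluated in the initial store, whatever the order.\<close>

lemma run_assigns:
  assumes step: "\<forall>x m. x \<in> set xs \<longrightarrow> run n (p x) \<iota> m = m(Brick i (f x) := v x m)"
    and indep: "\<forall>x m m'. x \<in> set xs \<longrightarrow> (\<forall>l. (\<forall>y\<in>set xs. l \<noteq> Brick i (f y)) \<longrightarrow> m' l = m l) \<longrightarrow>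
      v x m' = v x m"
    and inj: "inj_on f (set xs)"
  shows "x \<in> set xs \<Longrightarrow> run n (seqs (map p xs)) \<iota> m (Brick i (f x)) = v x m"
    and "(\<And>y. y \<in> set xs \<Longrightarrow> l \<noteq> Brick i (f y)) \<Longrightarrow> run n (seqs (map p xs)) \<iota> m l = m l"
proof -
  have "(\<forall>x\<in>set ys. fold (\<lambda>x. run n (p x) \<iota>) ys m (Brick i (f x)) = v x m) \<and>
      (\<forall>l. (\<forall>y\<in>set ys. l \<noteq> Brick i (f y)) \<longrightarrow> fold (\<lambda>x. run n (p x) \<iota>) ys m l = m l)"
    if "set ys \<subseteq> set xs" for ys
    using that
  proof (induction ys rule: rev_induct)
    case (snoc y ys)
    let ?r = "fold (\<lambda>x. run n (p x) \<iota>) ys m"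
    have y: "y \<in> set xs" and ys: "set ys \<subseteq> set xs" using snoc.prems by auto
    have IH: "\<forall>x\<in>set ys. ?r (Brick i (f x)) = v x m"
      "\<forall>l. (\<forall>y\<in>set ys. l \<noteq> Brick i (f y)) \<longrightarrow> ?r l = m l" using snoc.IH[OF ys] by auto
    have "v y ?r = v y m" by (rule indep[rule_format, OF y]) (use IH(2) ys in blast)
    then have r: "fold (\<lambda>x. run n (p x) \<iota>) (ys @ [y]) m = ?r(Brick i (f y) := v y m)"
      by (simp add: step[rule_format, OF y])
    show ?case unfolding r
    proof (intro conjI ballI allI impI)
      fix x assume x: "x \<in> set (ys @ [y])"
      show "(?r(Brick i (f y) := v y m)) (Brick i (f x)) = v x m"
      proof (cases "x = y")
        case False
        then have "f x \<noteq> f y" using inj_onD[OF inj, of x y] x y ys by auto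
        then show ?thesis using IH(1) x False by auto
      qed simp
    qed (use IH(2) in auto)
  qed simp
  from this[of xs] show "x \<in> set xs \<Longrightarrow> run n (seqs (map p xs)) \<iota> m (Brick i (f x)) = v x m"
    and "(\<And>y. y \<in> set xs \<Longrightarrow> l \<noteq> Brick i (f y)) \<Longrightarrow> run n (seqs (map p xs)) \<iota> m l = m l"
    unfolding run_seqs_map by auto
qed

lemma loop_assigns:
  assumes step: "\<forall>i x m. i < n \<longrightarrow> x \<in> set xs \<longrightarrow> run n (p x) (\<iota>(d := i)) m = m(Brick i (f x) := v i x m)"
    and indep: "\<forall>i x m m'. i < n \<longrightarrow> x \<in> set xs \<longrightarrow>
      (\<forall>l. (\<forall>i'<n. \<forall>y\<in>set xs. l \<noteq> Brick i' (f y)) \<longrightarrow> m' l = m l) \<longrightarrow> v i x m' = v i x m"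
    and inj: "inj_on f (set xs)"
  shows "i < n \<Longrightarrow> x \<in> set xs \<Longrightarrow> run n (HUp d (seqs (map p xs))) \<iota> m (Brick i (f x)) = v i x m"
    and "(\<And>i y. i < n \<Longrightarrow> y \<in> set xs \<Longrightarrow> l \<noteq> Brick i (f y)) \<Longrightarrow>
      run n (HUp d (seqs (map p xs))) \<iota> m l = m l"
proof -
  define P where "P k m' \<longleftrightarrow> (\<forall>i<k. \<forall>x\<in>set xs. m' (Brick i (f x)) = v i x m) \<and>
     (\<forall>l. (\<forall>i<k. \<forall>y\<in>set xs. l \<noteq> Brick i (f y)) \<longrightarrow> m' l = m l)" for k m'
  have "P n (fold (\<lambda>i. run n (seqs (map p xs)) (\<iota>(d := i))) [0..<n] m)"
  proof (rule fold_upt[where P = P])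
    show "P 0 m" by (simp add: P_def)
    fix k m' assume k: "k < n" and m': "P k m'"
    have stp: "\<forall>x m. x \<in> set xs \<longrightarrow> run n (p x) (\<iota>(d := k)) m = m(Brick k (f x) := v k x m)"
      using step k by blast
    have ind: "\<forall>x m m'. x \<in> set xs \<longrightarrow> (\<forall>l. (\<forall>y\<in>set xs. l \<noteq> Brick k (f y)) \<longrightarrow> m' l = m l) \<longrightarrow>
        v k x m' = v k x m"
    proof (intro allI impI)
      fix x and m1 m2 :: store assume "x \<in> set xs" and eq: "\<forall>l. (\<forall>y\<in>set xs. l \<noteq> Brick k (f y)) \<longrightarrow> m2 l = m1 l"
      then show "v k x m2 = v k x m1"
        by (intro indep[rule_format, OF k]) (use k in blast)+
    qed
    note R = run_assigns[OF stp ind inj]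
    have vm': "v k x m' = v k x m" if "x \<in> set xs" for x
      by (rule indep[rule_format, OF k that]) (use m' k in \<open>auto simp: P_def\<close>)
    show "P (Suc k) (run n (seqs (map p xs)) (\<iota>(d := k)) m')" unfolding P_def
    proof (intro conjI allI ballI impI)
      fix i x assume i: "i < Suc k" and x: "x \<in> set xs"
      show "run n (seqs (map p xs)) (\<iota>(d := k)) m' (Brick i (f x)) = v i x m"
      proof (cases "i = k")
        case True
        then show ?thesis using R(1)[OF x, of m'] vm'[OF x] by simp
      next
        case False
        then have "run n (seqs (map p xs)) (\<iota>(d := k)) m' (Brick i (f x)) = m' (Brick i (f x))"
          by (intro R(2)) auto
        then show ?thesis using False i x m' by (simp add: P_def)
      qed
    next
      fix l assume l: "\<forall>i<Suc k. \<forall>y\<in>set xs. l \<noteq> Brick i (f y)"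
      then have "run n (seqs (map p xs)) (\<iota>(d := k)) m' l = m' l" by (intro R(2)) auto
      then show "run n (seqs (map p xs)) (\<iota>(d := k)) m' l = m l" using l m' by (simp add: P_def)
    qed
  qed
  then show "i < n \<Longrightarrow> x \<in> set xs \<Longrightarrow> run n (HUp d (seqs (map p xs))) \<iota> m (Brick i (f x)) = v i x m"
    and "(\<And>i y. i < n \<Longrightarrow> y \<in> set xs \<Longrightarrow> l \<noteq> Brick i (f y)) \<Longrightarrow>
      run n (HUp d (seqs (map p xs))) \<iota> m l = m l" by (auto simp: P_def)
qed

abbreviation grid :: "nat \<Rightarrow> nat \<Rightarrow> (nat \<times> nat) set" where
  "grid n T \<equiv> {..<n} \<times> {..<T}"

lemma cost_grid: "cost (grid n T) c h = (\<Sum>i<n. \<Sum>j<T. c (i, j) * h (i, j))"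
  by (simp add: cost_def sum.cartesian_product case_prod_unfold)

text \<open>State \<open>k\<close> stands for the vector \<open>sts k\<close> of partial sums of the
  top rows. Entries of the top block are at most \<open>b1\<close> and the relevant kernel elements
  have 1-norm at most \<open>C\<close>, so these sums stay within \<open>b1 * C\<close> regardless
  of the number of bricks; all such vectors must occur as states.\<close>

locale nfold_transitions = transitions T E S C
  for T E S C +
  fixes r s :: nat and a1 a2 :: "nat \<Rightarrow> nat \<Rightarrow> int" and sts :: "nat \<Rightarrow> nat \<Rightarrow> int" and b1 :: int
  assumes C_nonneg: "0 \<le> C"
    and generation_bound: "h \<in> nfold_kernel T r s a1 a2 n \<Longrightarrow> h p \<noteq> 0 \<Longrightarrow>
      \<exists>g\<in>nfold_kernel T r s a1 a2 n. conformal g h \<and> g p \<noteq> 0 \<and> (\<Sum>q\<in>grid n T. \<bar>g q\<bar>) \<le> C"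
    and b1_nonneg: "0 \<le> b1"
    and sts_0: "sts 0 = (\<lambda>_. 0)"
    and a1_bound: "k < r \<Longrightarrow> j < T \<Longrightarrow> \<bar>a1 k j\<bar> \<le> b1"
    and sts_complete: "(\<And>l. \<bar>x l\<bar> \<le> b1 * C) \<Longrightarrow> (\<And>l. r \<le> l \<Longrightarrow> x l = 0) \<Longrightarrow> \<exists>k<S. sts k = x"
    and edge_sound: "k < S \<Longrightarrow> (v, k') \<in> set (E k) \<Longrightarrow> v \<in> brick_kernel T s a2 \<and>
      sts k' = (\<lambda>l. sts k l + (if l < r then \<Sum>j<T. a1 l j * v j else 0))"
    and edge_complete: "k < S \<Longrightarrow> k' < S \<Longrightarrow> v \<in> brick_kernel T s a2 \<Longrightarrow> (\<And>j. \<bar>v j\<bar> \<le> C) \<Longrightarrow>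
      sts k' = (\<lambda>l. sts k l + (if l < r then \<Sum>j<T. a1 l j * v j else 0)) \<Longrightarrow> (v, k') \<in> set (E k)"
begin

abbreviation ker :: "nat \<Rightarrow> (nat \<times> nat \<Rightarrow> int) set" where
  "ker n \<equiv> nfold_kernel T r s a1 a2 n"

text \<open>The bound is on the 1-norm and not on single entries: a sum over the first bricks is
  then bounded independently of \<open>n\<close>, which is what makes the set of states
  finite.\<close>

definition gens :: "nat \<Rightarrow> (nat \<times> nat \<Rightarrow> int) set" where
  "gens n = {g \<in> ker n. (\<Sum>q\<in>grid n T. \<bar>g q\<bar>) \<le> C}"

lemma ker_generated: "generated (grid n T) (ker n) (gens n)"
proof
  show "finite (grid n T)" by simp
  show "\<And>x i. x \<in> ker n \<Longrightarrow> i \<notin> grid n T \<Longrightarrow> x i = 0" by (cases) (auto simp: nfold_kernel_def)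
  show "(\<lambda>_. 0) \<in> ker n" by (simp add: nfold_kernel_def)
  show "(\<lambda>i. x i - y i) \<in> ker n" if "x \<in> ker n" "y \<in> ker n" for x y
    using that by (simp add: nfold_kernel_def right_diff_distrib sum_subtractf)
  show "gens n \<subseteq> ker n" by (auto simp: gens_def)
  show "\<exists>g\<in>gens n. conformal g h \<and> g i \<noteq> 0" if hi: "h \<in> ker n" "h i \<noteq> 0" for h i
  proof -
    obtain g where "g \<in> ker n" "conformal g h" "g i \<noteq> 0" "(\<Sum>q\<in>grid n T. \<bar>g q\<bar>) \<le> C"
      using generation_bound[OF hi] by blast
    then show ?thesis by (intro bexI[of _ g]) (simp_all add: gens_def)
  qed
qed

lemma gens_bound:
  assumes "g \<in> gens n"
  shows "\<bar>g p\<bar> \<le> C"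
proof (cases "p \<in> grid n T")
  case True
  then have "\<bar>g p\<bar> \<le> (\<Sum>q\<in>grid n T. \<bar>g q\<bar>)"
    by (intro member_le_sum) auto
  then show ?thesis using assms by (simp add: gens_def)
next
  case False
  have "g p = 0"
    by (rule generated.supp[OF ker_generated _ False]) (use assms in \<open>simp add: gens_def\<close>)
  then show ?thesis using C_nonneg by simp
qed

text \<open>The kernel is cut out by homogeneous equations, in which the factor 2 cancels. This
  saturation is what \<open>proximity\<close> requires.\<close>

lemma ker_halve: "\<forall>x. (\<lambda>i. 2 * x i) \<in> ker n \<longrightarrow> x \<in> ker n"
proof (intro allI impI)
  fix x :: "nat \<times> nat \<Rightarrow> int" assume x: "(\<lambda>i. 2 * x i) \<in> ker n"
  have 1: "(\<Sum>j<T. f j * (2 * y j)) = 2 * (\<Sum>j<T. f j * y j)" for f y :: "nat \<Rightarrow> int"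
    by (simp add: sum_distrib_left mult.left_commute)
  have 2: "(\<Sum>i<n. 2 * f i) = 2 * (\<Sum>i<n. f i)" for f :: "nat \<Rightarrow> int"
    by (simp add: sum_distrib_left)
  show "x \<in> ker n" using x unfolding nfold_kernel_def mem_Collect_eq 1 2 by auto
qed

abbreviation opt :: "nat \<Rightarrow> (bool \<Rightarrow> nat \<times> nat \<Rightarrow> int) \<Rightarrow> (nat \<times> nat \<Rightarrow> int) \<Rightarrow> int \<Rightarrow> (nat \<times> nat \<Rightarrow> int) \<Rightarrow> bool"
  where "opt n \<equiv> generated.scale_opt (grid n T) (ker n)"

lemmas opt_def = generated.scale_opt_def[OF ker_generated]

lemma path_sum:
  assumes "path n st g" "m \<le> n"
  shows "sts (st m) = (\<lambda>l. if l < r then \<Sum>i<m. \<Sum>j<T. a1 l j * g i j else 0)"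
  using assms(2)
proof (induction m)
  case 0
  then show ?case using assms(1) by (simp add: path_def sts_0 cong: if_cong)
next
  case (Suc m)
  have "st m < S" using path_states[OF assms(1)] Suc by simp
  moreover have "(g m, st (Suc m)) \<in> set (E (st m))" using assms(1) Suc by (simp add: path_def)
  ultimately have "sts (st (Suc m)) = (\<lambda>l. sts (st m) l + (if l < r then \<Sum>j<T. a1 l j * g m j else 0))"
    using edge_sound by blast
  then show ?case using Suc by (auto simp: fun_eq_iff)
qed

text \<open>Such an element need not be in \<open>gens\<close>: many bricks may be nonzero. The
  dynamic program thus searches a larger set than the generators, which is harmless because an
  augmentation may be any kernel element at least as good as all of them.\<close>

lemma path_kernel:
  assumes "path n st g" "st n = 0"
  shows "(\<lambda>(i, j). if i < n then g i j else 0) \<in> ker n"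
proof -
  have brick: "g i \<in> brick_kernel T s a2" if "i < n" for i
    using edge_sound[of "st i" "g i" "st (Suc i)"] path_states[OF assms(1), of i] assms(1) that
    by (auto simp: path_def)
  have "(\<Sum>i<n. \<Sum>j<T. a1 k j * g i j) = 0" if "k < r" for k
  proof -
    have "sts (st n) k = (\<Sum>i<n. \<Sum>j<T. a1 k j * g i j)" using path_sum[OF assms(1), of n] that by simp
    then show ?thesis using assms(2) sts_0 by simp
  qed
  then show ?thesis unfolding nfold_kernel_def using brick by (auto simp: brick_kernel_def)
qed

lemma kernel_path:
  assumes "h \<in> gens n"
  shows "\<exists>st. path n st (\<lambda>i j. h (i, j)) \<and> st n = 0"
proof -
  have h: "h \<in> ker n" and small: "(\<Sum>q\<in>grid n T. \<bar>h q\<bar>) \<le> C" using assms by (auto simp: gens_def)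
  define x where "x m = (\<lambda>l. if l < r then \<Sum>i<m. \<Sum>j<T. a1 l j * h (i, j) else 0)" for m
  have b1: "0 \<le> b1 * C" using b1_nonneg C_nonneg by simp
  have "\<exists>k<S. sts k = x m" if "m \<le> n" for m
  proof (rule sts_complete)
    fix l
    show "\<bar>x m l\<bar> \<le> b1 * C"
    proof (cases "l < r")
      case True
      have b: "\<bar>a1 l j\<bar> \<le> b1" if "j < T" for j using a1_bound[OF True that] .
      have "\<bar>x m l\<bar> \<le> (\<Sum>i<m. \<Sum>j<T. \<bar>a1 l j * h (i, j)\<bar>)"
        using True by (auto simp: x_def intro!: order_trans[OF sum_abs] sum_mono)
      also have "\<dots> \<le> (\<Sum>i<m. \<Sum>j<T. b1 * \<bar>h (i, j)\<bar>)"
        using b by (auto simp: abs_mult intro!: sum_mono mult_right_mono)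
      also have "\<dots> \<le> (\<Sum>i<n. \<Sum>j<T. b1 * \<bar>h (i, j)\<bar>)"
        by (rule sum_mono2) (use that b1_nonneg in \<open>auto intro!: sum_nonneg\<close>)
      also have "\<dots> = b1 * (\<Sum>q\<in>grid n T. \<bar>h q\<bar>)"
        by (simp add: sum_distrib_left sum.cartesian_product case_prod_unfold)
      also have "\<dots> \<le> b1 * C"
        using small b1_nonneg by (rule mult_left_mono)
      finally show ?thesis .
    qed (use b1 in \<open>simp add: x_def\<close>)
  qed (simp add: x_def)
  then obtain k where k: "\<And>m. m \<le> n \<Longrightarrow> k m < S \<and> sts (k m) = x m" by metis
  \<comment> \<open>The zero vector may be represented by several states, but a path has to start
    and end in state 0; hence this state is preferred whenever the partial sum is zero.\<close>
  define st where "st m = (if x m = (\<lambda>_. 0) then 0 else k m)" for m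
  have st: "st m < S" "sts (st m) = x m" if "m \<le> n" for m
    using k[OF that] S_pos sts_0 by (auto simp: st_def)
  have "x n = (\<lambda>_. 0)" using h by (auto simp: x_def nfold_kernel_def)
  then have "st n = 0" by (simp add: st_def)
  moreover have "path n st (\<lambda>i j. h (i, j))" unfolding path_def
  proof (intro conjI allI impI)
    have "x 0 = (\<lambda>_. 0)" by (auto simp: x_def)
    then show "st 0 = 0" by (simp add: st_def)
    fix i assume i: "i < n"
    show "((\<lambda>j. h (i, j)), st (Suc i)) \<in> set (E (st i))"
    proof (rule edge_complete)
      show "st i < S" "st (Suc i) < S" using st i by simp_all
      show "(\<lambda>j. h (i, j)) \<in> brick_kernel T s a2" using h i by (auto simp: nfold_kernel_def brick_kernel_def)
      show "\<bar>h (i, j)\<bar> \<le> C" for j using gens_bound[OF assms] .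
      show "sts (st (Suc i)) = (\<lambda>l. sts (st i) l + (if l < r then \<Sum>j<T. a1 l j * h (i, j) else 0))"
        using st(2)[of i] st(2)[of "Suc i"] i by (auto simp: x_def fun_eq_iff)
    qed
  qed
  ultimately show ?thesis by blast
qed

text \<open>The scale is a real number because the last phase leaves 1/2 in it. The bound
  \<open>P\<close> exceeds the absolute cost of every path, whose bricks have entries at most
  \<open>C\<close>.\<close>

definition state_rep :: "nat \<Rightarrow> store \<Rightarrow> (nat \<times> nat \<Rightarrow> int) \<Rightarrow> (bool \<Rightarrow> nat \<times> nat \<Rightarrow> int) \<Rightarrow>
    (bool \<Rightarrow> nat \<times> nat \<Rightarrow> int) \<Rightarrow> (nat \<times> nat \<Rightarrow> int) \<Rightarrow> real \<Rightarrow> bool" where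
  "state_rep n m z U B c \<delta> \<longleftrightarrow>
     (\<forall>i<n. \<forall>j<T. m (Brick i (Pos j)) = of_int (z (i, j)) \<and> m (Brick i (Cost j)) = of_int (c (i, j)) \<and>
        (\<forall>\<sigma>. m (Brick i (Bnd \<sigma> j)) = of_int (U \<sigma> (i, j)) \<and> m (Brick i (Box \<sigma> j)) = of_int (B \<sigma> (i, j)))) \<and>
     m (Glob Scale) = \<delta> \<and>
     (\<exists>P. of_int (\<Sum>i<n. \<Sum>j<T. C * \<bar>c (i, j)\<bar>) < P \<and>
        (\<forall>k<S. m (Brick n (Val k)) = (if k = 0 then 0 else P)))"

text \<open>Not moving is a path from state 0 to state 0, so the optimal value is at most 0. A path
  ending in another state would pay \<open>P\<close>, which exceeds anything it can gain, and have
  positive value; therefore the path that is followed returns to 0 and is a kernel element.\<close>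

lemma augment_spec:
  assumes rep: "state_rep n m z U B c (of_int \<Delta>)" and box: "in_box (grid n T) B z"
  shows "\<exists>g\<in>ker n. state_rep n (run n (augment d) \<iota> m) (shift z \<Delta> g) U B c (of_int \<Delta>) \<and>
    in_box (grid n T) B (shift z \<Delta> g) \<and> cost (grid n T) c g \<le> 0 \<and>
    (\<forall>h\<in>gens n. in_box (grid n T) B (shift z \<Delta> h) \<longrightarrow> cost (grid n T) c g \<le> cost (grid n T) c h)"
proof -
  let ?G = "grid n T"
  define m1 where "m1 = run n (dp d) \<iota> m"
  have fits_iff: "fits m' i v \<longleftrightarrow> (\<forall>\<sigma>. \<forall>j<T. sg \<sigma> * (z (i, j) + \<Delta> * v j) \<le> B \<sigma> (i, j))"
    if "i < n" "\<And>j. m' (Brick i (Pos j)) = m (Brick i (Pos j))" "m' (Glob Scale) = m (Glob Scale)"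
      "\<And>\<sigma> j. m' (Brick i (Box \<sigma> j)) = m (Brick i (Box \<sigma> j))" for m' i v
  proof -
    have "fits m' i v \<longleftrightarrow> (\<forall>\<sigma>. \<forall>j<T. real_of_int (sg \<sigma> * (z (i, j) + \<Delta> * v j)) \<le> of_int (B \<sigma> (i, j)))"
      using rep that unfolding fits_def state_rep_def by simp
    then show ?thesis by (simp only: of_int_le_iff)
  qed
  have z_fits: "fits m i (\<lambda>_. 0)" if "i < n" for i
    using box that by (subst fits_iff[OF that]) (auto simp: in_box_def)
  have fr: "dp_frame (\<lambda>i k'. i < n \<and> k' < S) m m1" unfolding m1_def by (rule dp_spec(1)) (rule z_fits)
  have bell: "bellman m1 i k" if "i < n" "k < S" for i k
    unfolding m1_def by (rule dp_spec(2)[OF _ that]) (rule z_fits)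
  note same = dp_frameD[OF fr]
  have fits1: "fits m1 i v \<longleftrightarrow> (\<forall>\<sigma>. \<forall>j<T. sg \<sigma> * (z (i, j) + \<Delta> * v j) \<le> B \<sigma> (i, j))" if "i < n" for i v
    using that by (rule fits_iff) (simp_all add: same)
  have bcost1: "bcost m1 i v = of_int (\<Sum>j<T. c (i, j) * v j)" if "i < n" for i v
    using rep that by (simp add: bcost_def same state_rep_def mult.commute)
  obtain P where P: "of_int (\<Sum>i<n. \<Sum>j<T. C * \<bar>c (i, j)\<bar>) < P"
      "\<forall>k<S. m (Brick n (Val k)) = (if k = 0 then 0 else P)"
    using rep unfolding state_rep_def by blast
  have last: "m1 (Brick n (Val k)) = (if k = 0 then 0 else P)" if "k < S" for k
    using P(2) that by (simp add: same)
  obtain st g where path: "path n st g" and fitg: "\<forall>i<n. fits m1 i (g i)"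
    and steps: "\<forall>i<n. m1 (Brick i (Val (st i))) = bcost m1 i (g i) + m1 (Brick (Suc i) (Val (st (Suc i))))"
    and run: "run n (forward d) \<iota> m1 = (\<lambda>l. case l of Glob State \<Rightarrow> real (st n)
     | Brick i (Pos j) \<Rightarrow> m1 l + (if i < n \<and> j < T then m1 (Glob Scale) * of_int (g i j) else 0)
     | _ \<Rightarrow> m1 l)"
    using forward_spec[where n = n and m = m1 and d = d and \<iota> = \<iota>] bell by blast
  have tele: "m1 (Brick 0 (Val 0)) = (\<Sum>i<k. bcost m1 i (g i)) + m1 (Brick k (Val (st k)))" if "k \<le> n" for k
    using that
  proof (induction k)
    case 0
    then show ?case using path by (simp add: path_def)
  next
    case (Suc k)
    then show ?case using steps by simp
  qed
  define h where "h = (\<lambda>(i, j). if i < n then g i j else 0)"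
  have stn: "st n < S" using path_states[OF path] by simp
  have gb: "\<bar>g i j\<bar> \<le> C" if "i < n" for i j
    using E_bound[of "st i" "g i" "st (Suc i)"] path_states[OF path, of i] path that by (simp add: path_def)
  have sum_cost: "(\<Sum>i<n. bcost m1 i (g i)) = of_int (cost ?G c h)"
    by (simp add: cost_grid bcost1 h_def)
  have path0: "path n (\<lambda>_. 0) (\<lambda>_ _. 0)"
    using E_zero[OF S_pos] E_ne[OF S_pos] nth_mem[of 0 "E 0"] by (simp add: path_def)
  have "m1 (Brick 0 (Val 0)) \<le> (\<Sum>i'<n. bcost m1 i' (\<lambda>_. 0)) + m1 (Brick n (Val 0))"
    by (rule bellman_lower[OF bell path0]) (use box in \<open>auto simp: fits1 in_box_def\<close>)
  then have le0: "m1 (Brick 0 (Val 0)) \<le> 0" using last[OF S_pos] by (simp add: bcost_def)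
  have "\<bar>cost ?G c h\<bar> \<le> (\<Sum>i<n. \<Sum>j<T. C * \<bar>c (i, j)\<bar>)"
  proof -
    have "\<bar>cost ?G c h\<bar> \<le> (\<Sum>i<n. \<Sum>j<T. \<bar>c (i, j) * h (i, j)\<bar>)"
      unfolding cost_grid by (auto intro!: order_trans[OF sum_abs] sum_mono)
    also have "\<dots> \<le> (\<Sum>i<n. \<Sum>j<T. C * \<bar>c (i, j)\<bar>)"
      using gb by (auto simp: abs_mult h_def mult.commute intro!: sum_mono mult_right_mono)
    finally show ?thesis .
  qed
  then have "- P < of_int (cost ?G c h)" using P(1) by linarith
  then have st0: "st n = 0" using tele[of n] le0 last[OF stn] sum_cost by (cases "st n = 0") auto
  have hk: "h \<in> ker n" unfolding h_def using path st0 by (rule path_kernel)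
  have best: "m1 (Brick 0 (Val 0)) = of_int (cost ?G c h)" using tele[of n] st0 last[OF S_pos] sum_cost by simp
  have box': "in_box ?G B (shift z \<Delta> h)" unfolding in_box_def
    using fitg fits1 by (auto simp: h_def)
  have "cost ?G c h \<le> cost ?G c h'" if h': "h' \<in> gens n" "in_box ?G B (shift z \<Delta> h')" for h'
  proof -
    obtain st' where st': "path n st' (\<lambda>i j. h' (i, j))" "st' n = 0" using kernel_path[OF h'(1)] by blast
    have "m1 (Brick 0 (Val 0)) \<le> (\<Sum>i'<n. bcost m1 i' (\<lambda>j. h' (i', j))) + m1 (Brick n (Val (st' n)))"
      by (rule bellman_lower[OF bell st'(1)]) (use h'(2) in \<open>auto simp: fits1 in_box_def\<close>)
    also have "\<dots> = of_int (cost ?G c h')" using st'(2) last[OF S_pos] by (simp add: cost_grid bcost1)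
    finally show ?thesis using best by simp
  qed
  moreover have "state_rep n (run n (augment d) \<iota> m) (shift z \<Delta> h) U B c (of_int \<Delta>)"
    using rep unfolding augment_def run.simps m1_def[symmetric] run state_rep_def
    by (auto simp: same h_def)
  ultimately show ?thesis using hk box' best le0 by (intro bexI[of _ h]) auto
qed


section \<open>The phase as a program and its invariant\<close>

definition relax :: "nat \<Rightarrow> bool \<Rightarrow> nat \<Rightarrow> hprog" where
  "relax d \<sigma> j = HIf (HAdd (HRead (here d 0 (Box \<sigma> j))) (HRead (HGlob Scale))) (HRead (here d 0 (Bnd \<sigma> j)))
     (HSet (here d 0 (Box \<sigma> j)) (HAdd (HRead (here d 0 (Box \<sigma> j))) (HRead (HGlob Scale))))
     (HSet (here d 0 (Box \<sigma> j)) (HRead (here d 0 (Bnd \<sigma> j))))"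

text \<open>Each single relaxation is followed at once by an augmentation, since one augmentation
  repairs one relaxation only. Columns and directions are unfolded; only the bricks are looped
  over.\<close>

definition sweep :: hprog where
  "sweep = seqs (map (\<lambda>(\<sigma>, j). HUp 1 (HSeq (relax 1 \<sigma> j) (augment 2))) sides)"

definition reset :: hprog where
  "reset = HUp 0 (seqs (map (\<lambda>(\<sigma>, j). HSet (here 0 0 (Box \<sigma> j))
     (HMul (HConst (sg \<sigma>)) (HRead (here 0 0 (Pos j))))) sides))"

text \<open>\<open>T * nat C\<close> copies of a loop of \<open>n\<close> sweeps relax each bound at
  least \<open>n * T * C\<close> times, the distance allowed by proximity for a grid of
  \<open>n * T\<close> coordinates. The halving at the end prepares the next phase.\<close>

definition phase :: hprog where
  "phase = HSeq (HSeq reset (seqs (map (\<lambda>_. HUp 0 sweep) [0..<T * nat C])))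
     (HSet (HGlob Scale) (HHalf (HRead (HGlob Scale))))"

text \<open>\<open>cnt\<close> counts the relaxations of each bound since the box was shrunk to
  \<open>z\<close>. The box then has a closed form, and the current point, reached from
  \<open>z\<close> by steps of length \<open>\<Delta>\<close>, is optimal in it.\<close>

definition progress :: "nat \<Rightarrow> (nat \<times> nat \<Rightarrow> int) \<Rightarrow> (bool \<Rightarrow> nat \<times> nat \<Rightarrow> int) \<Rightarrow> (nat \<times> nat \<Rightarrow> int) \<Rightarrow> int \<Rightarrow>
    (bool \<Rightarrow> nat \<times> nat \<Rightarrow> int) \<Rightarrow> store \<Rightarrow> bool" where
  "progress n z U c \<Delta> cnt m \<longleftrightarrow> (\<exists>y\<in>ker n. \<exists>B. state_rep n m (shift z \<Delta> y) U B c (of_int \<Delta>) \<and>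
     opt n B c \<Delta> (shift z \<Delta> y) \<and>
     (\<forall>p\<in>grid n T. \<forall>\<sigma>. B \<sigma> p = min (U \<sigma> p) (sg \<sigma> * z p + cnt \<sigma> p * \<Delta>)))"

lemma step_progress:
  assumes prog: "progress n z U c \<Delta> cnt m" and \<Delta>: "0 < \<Delta>" and i: "\<iota> d = i" "i < n" "j < T"
  shows "progress n z U c \<Delta> (\<lambda>\<tau> q. cnt \<tau> q + (if \<tau> = \<sigma> \<and> q = (i, j) then 1 else 0))
    (run n (HSeq (relax d \<sigma> j) (augment d')) \<iota> m)"
proof -
  let ?G = "grid n T"
  obtain y B where y: "y \<in> ker n" and rep: "state_rep n m (shift z \<Delta> y) U B c (of_int \<Delta>)"
    and opt: "opt n B c \<Delta> (shift z \<Delta> y)"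
    and B: "\<And>p \<sigma>. p \<in> ?G \<Longrightarrow> B \<sigma> p = min (U \<sigma> p) (sg \<sigma> * z p + cnt \<sigma> p * \<Delta>)"
    using prog unfolding progress_def by blast
  let ?p = "(i, j)"
  have p: "?p \<in> ?G" using i by simp
  define b where "b = min (U \<sigma> ?p) (B \<sigma> ?p + \<Delta>)"
  define B' where "B' = B(\<sigma> := (B \<sigma>)(?p := b))"
  define m1 where "m1 = run n (relax d \<sigma> j) \<iota> m"
  have at: "m (Brick i (Box \<sigma> j)) = of_int (B \<sigma> ?p)" "m (Brick i (Bnd \<sigma> j)) = of_int (U \<sigma> ?p)"
    "m (Glob Scale) = of_int \<Delta>" using rep i by (auto simp: state_rep_def)
  have m1: "m1 = m(Brick i (Box \<sigma> j) := of_int b)"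
    using i(1) by (auto simp: m1_def relax_def at b_def min_def simp flip: of_int_add)
  have rep1: "state_rep n m1 (shift z \<Delta> y) U B' c (of_int \<Delta>)"
    using rep unfolding state_rep_def m1 B'_def by auto
  have b: "B \<sigma> ?p \<le> b" "b \<le> B \<sigma> ?p + \<Delta>" using B[OF p, of \<sigma>] \<Delta> by (auto simp: b_def)
  have "in_box ?G B (shift z \<Delta> y)" using opt by (simp add: opt_def)
  then have box1: "in_box ?G B' (shift z \<Delta> y)"
    using b(1) unfolding in_box_def B'_def by (auto simp: fun_upd_def intro: order_trans)
  obtain g where g: "g \<in> ker n" "state_rep n (run n (augment d') \<iota> m1) (shift (shift z \<Delta> y) \<Delta> g) U B' c (of_int \<Delta>)"
    "in_box ?G B' (shift (shift z \<Delta> y) \<Delta> g)" "cost ?G c g \<le> 0"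
    "\<forall>h\<in>gens n. in_box ?G B' (shift (shift z \<Delta> y) \<Delta> h) \<longrightarrow> cost ?G c g \<le> cost ?G c h"
    using augment_spec[OF rep1 box1, of d' \<iota>] by blast
  have opt': "opt n B' c \<Delta> (shift (shift z \<Delta> y) \<Delta> g)"
    using generated.augment_after_relaxation[OF ker_generated opt \<Delta> b B'_def g(1,3,4)] g(5) by blast
  have eq: "shift (shift z \<Delta> y) \<Delta> g = shift z \<Delta> (\<lambda>p. y p + g p)" by (simp add: algebra_simps)
  have yg: "(\<lambda>p. y p + g p) \<in> ker n" using generated.add[OF ker_generated y g(1)] .
  \<comment> \<open>Capping at \<open>U\<close> before adding \<open>\<Delta>\<close> and capping
    again gives the same as capping once afterwards, because \<open>\<Delta>\<close> is
    positive.\<close>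
  have B'_eq: "B' \<tau> q = min (U \<tau> q) (sg \<tau> * z q + (cnt \<tau> q + (if \<tau> = \<sigma> \<and> q = ?p then 1 else 0)) * \<Delta>)"
    if q: "q \<in> ?G" for \<tau> q
  proof (cases "\<tau> = \<sigma> \<and> q = ?p")
    case True
    then show ?thesis using B[OF p, of \<sigma>] \<Delta> by (auto simp: B'_def b_def min_def distrib_right)
  next
    case False
    then have "B' \<tau> q = B \<tau> q" by (auto simp: B'_def)
    then show ?thesis using B[OF q, of \<tau>] False by auto
  qed
  show ?thesis unfolding progress_def run.simps m1_def[symmetric]
    by (rule bexI[OF _ yg], rule exI[of _ B'])
      (intro conjI ballI allI B'_eq g(2)[unfolded eq] opt'[unfolded eq])
qed

text \<open>Occurrences in \<open>sides\<close> are the form that the induction over this list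
  yields; from then on it enters through the lower bound 1.\<close>

definition sweep_count :: "nat \<Rightarrow> bool \<Rightarrow> nat \<times> nat \<Rightarrow> int" where
  "sweep_count n \<tau> q = (if fst q < n then int (count_list sides (\<tau>, snd q)) else 0)"

lemma sweep_count_pos: "q \<in> grid n T \<Longrightarrow> 1 \<le> sweep_count n \<tau> q"
proof -
  assume q: "q \<in> grid n T"
  then have "(\<tau>, snd q) \<in> set sides" by (auto simp: set_sides)
  then have "count_list sides (\<tau>, snd q) \<noteq> 0" by (simp add: count_list_0_iff)
  then show ?thesis using q by (auto simp: sweep_count_def)
qed

lemma sweep_progress:
  assumes "progress n z U c \<Delta> cnt m" "0 < \<Delta>"
  shows "progress n z U c \<Delta> (\<lambda>\<tau> q. cnt \<tau> q + sweep_count n \<tau> q) (run n sweep \<iota> m)"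
proof -
  have "progress n z U c \<Delta> (\<lambda>\<tau> q. cnt \<tau> q + (if fst q < n then int (count_list xs (\<tau>, snd q)) else 0))
     (fold (\<lambda>x. run n ((\<lambda>(\<sigma>, j). HUp 1 (HSeq (relax 1 \<sigma> j) (augment 2))) x) \<iota>) xs m)"
    if "set xs \<subseteq> set sides" for xs
    using that assms(1)
  proof (induction xs arbitrary: cnt m)
    case Nil
    then show ?case by (simp cong: if_cong)
  next
    case (Cons x xs)
    obtain \<sigma> j where x: "x = (\<sigma>, j)" by fastforce
    have j: "j < T" using Cons.prems(1) x by (auto simp: set_sides)
    let ?cnt = "\<lambda>i \<tau> q. cnt \<tau> q + (if \<tau> = \<sigma> \<and> snd q = j \<and> fst q < i then 1 else 0)"
    have "progress n z U c \<Delta> (?cnt n)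
       (fold (\<lambda>i. run n (HSeq (relax 1 \<sigma> j) (augment 2)) (\<iota>(1 := i))) [0..<n] m)"
    proof (rule fold_upt[where P = "\<lambda>i. progress n z U c \<Delta> (?cnt i)"])
      show "progress n z U c \<Delta> (?cnt 0) m" using Cons.prems(2) by simp
      fix i m' assume i: "i < n" and m': "progress n z U c \<Delta> (?cnt i) m'"
      have "progress n z U c \<Delta> (\<lambda>\<tau> q. ?cnt i \<tau> q + (if \<tau> = \<sigma> \<and> q = (i, j) then 1 else 0))
          (run n (HSeq (relax 1 \<sigma> j) (augment 2)) (\<iota>(1 := i)) m')"
        by (rule step_progress[OF m' assms(2)]) (use i j in auto)
      moreover have "(\<lambda>\<tau> q. ?cnt i \<tau> q + (if \<tau> = \<sigma> \<and> q = (i, j) then 1 else 0)) = ?cnt (Suc i)"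
        by (auto simp: fun_eq_iff)
      ultimately show "progress n z U c \<Delta> (?cnt (Suc i))
          (run n (HSeq (relax 1 \<sigma> j) (augment 2)) (\<iota>(1 := i)) m')" by simp
    qed
    then have "progress n z U c \<Delta> (?cnt n) (run n (HUp 1 (HSeq (relax 1 \<sigma> j) (augment 2))) \<iota> m)" by simp
    from Cons.IH[OF _ this] Cons.prems(1)
    have "progress n z U c \<Delta> (\<lambda>\<tau> q. ?cnt n \<tau> q + (if fst q < n then int (count_list xs (\<tau>, snd q)) else 0))
       (fold (\<lambda>x. run n ((\<lambda>(\<sigma>, j). HUp 1 (HSeq (relax 1 \<sigma> j) (augment 2))) x) \<iota>) (x # xs) m)"
      by (simp add: x)
    moreover have "(\<lambda>\<tau> q. ?cnt n \<tau> q + (if fst q < n then int (count_list xs (\<tau>, snd q)) else 0)) =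
       (\<lambda>\<tau> q. cnt \<tau> q + (if fst q < n then int (count_list (x # xs) (\<tau>, snd q)) else 0))"
      by (auto simp: fun_eq_iff x)
    ultimately show ?case by simp
  qed
  from this[of sides] show ?thesis by (simp add: sweep_def run_seqs_map sweep_count_def)
qed

lemma sweeps_progress:
  assumes "progress n z U c \<Delta> cnt m" "0 < \<Delta>"
  shows "progress n z U c \<Delta> (\<lambda>\<tau> q. cnt \<tau> q + int (R * n) * sweep_count n \<tau> q)
    (run n (seqs (map (\<lambda>_. HUp 0 sweep) [0..<R])) \<iota> m)"
proof -
  have up: "progress n z U c \<Delta> (\<lambda>\<tau> q. cnt \<tau> q + int n * sweep_count n \<tau> q) (run n (HUp 0 sweep) \<iota> m)"
    if "progress n z U c \<Delta> cnt m" for cnt m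
  proof -
    let ?P = "\<lambda>k. progress n z U c \<Delta> (\<lambda>\<tau> q. cnt \<tau> q + int k * sweep_count n \<tau> q)"
    have "?P n (fold (\<lambda>i. run n sweep (\<iota>(0 := i))) [0..<n] m)"
    proof (rule fold_upt[where P = ?P])
      show "?P 0 m" using that by simp
      fix k m' assume "?P k m'"
      from sweep_progress[OF this assms(2), of "\<iota>(0 := k)"]
      show "?P (Suc k) (run n sweep (\<iota>(0 := k)) m')" by (simp add: algebra_simps)
    qed
    then show ?thesis by simp
  qed
  let ?P = "\<lambda>k. progress n z U c \<Delta> (\<lambda>\<tau> q. cnt \<tau> q + int (k * n) * sweep_count n \<tau> q)"
  have "?P R (fold (\<lambda>_. run n (HUp 0 sweep) \<iota>) [0..<R] m)"
  proof (rule fold_upt[where P = ?P])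
    show "?P 0 m" using assms(1) by simp
    fix k m' assume "?P k m'"
    from up[OF this] show "?P (Suc k) (run n (HUp 0 sweep) \<iota> m')" by (simp add: algebra_simps)
  qed
  then show ?thesis by (simp add: run_seqs_map)
qed

lemma reset_spec:
  assumes rep: "state_rep n m z U B c \<delta>"
  shows "state_rep n (run n reset \<iota> m) z U (\<lambda>\<sigma> p. sg \<sigma> * z p) c \<delta>"
proof -
  let ?p = "\<lambda>(\<sigma>, j). HSet (here 0 0 (Box \<sigma> j)) (HMul (HConst (sg \<sigma>)) (HRead (here 0 0 (Pos j))))"
  let ?f = "\<lambda>(\<sigma>, j). Box \<sigma> j"
  let ?v = "\<lambda>i (\<sigma>, j) m. real_of_int (sg \<sigma>) * m (Brick i (Pos j))"
  have run: "\<forall>i x m. i < n \<longrightarrow> x \<in> set sides \<longrightarrow> run n (?p x) (\<iota>(0 := i)) m = m(Brick i (?f x) := ?v i x m)"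
    by (simp split: prod.split)
  have indep: "\<forall>i x m m'. i < n \<longrightarrow> x \<in> set sides \<longrightarrow>
      (\<forall>l. (\<forall>i'<n. \<forall>y\<in>set sides. l \<noteq> Brick i' (?f y)) \<longrightarrow> m' l = m l) \<longrightarrow> ?v i x m' = ?v i x m"
    by (simp split: prod.split)
  have inj: "inj_on ?f (set sides)" by (auto simp: inj_on_def)
  note * = loop_assigns[OF run indep inj, folded reset_def]
  have box: "run n reset \<iota> m (Brick i (Box \<sigma> j)) = of_int (sg \<sigma>) * m (Brick i (Pos j))"
    if "i < n" "j < T" for i \<sigma> j
    using *(1)[of i "(\<sigma>, j)" m] that by (simp add: set_sides)
  have other: "run n reset \<iota> m l = m l" if "\<And>i \<sigma> j. l \<noteq> Brick i (Box \<sigma> j)" for l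
    by (rule *(2)) (use that in auto)
  show ?thesis using rep unfolding state_rep_def by (simp add: box other)
qed

lemma phase_spec:
  assumes rep: "state_rep n m z U B0 c (of_int \<Delta>)" and opt: "opt n U c (2 * \<Delta>) z" and \<Delta>: "0 < \<Delta>"
  shows "\<exists>y\<in>ker n. \<exists>B. state_rep n (run n phase \<iota> m) (shift z \<Delta> y) U B c (of_int \<Delta> / 2) \<and>
    opt n U c \<Delta> (shift z \<Delta> y)"
proof -
  let ?G = "grid n T"
  define m1 where "m1 = run n reset \<iota> m"
  define B1 where "B1 = (\<lambda>\<sigma> p. sg \<sigma> * z p)"
  have rep1: "state_rep n m1 z U B1 c (of_int \<Delta>)"
    unfolding m1_def B1_def using rep by (rule reset_spec)
  have box: "in_box ?G U z" using opt by (simp add: opt_def)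
  \<comment> \<open>The box \<open>B1\<close> consists of the point \<open>z\<close> alone, so only
    the zero direction is feasible and the invariant holds at the start for any cost.\<close>
  have opt1: "opt n B1 c \<Delta> z" unfolding opt_def
  proof (intro conjI ballI impI)
    show "in_box ?G B1 z" by (simp add: in_box_def B1_def)
    fix h assume "in_box ?G B1 (shift z \<Delta> h)"
    then have h: "sg \<sigma> * (z p + \<Delta> * h p) \<le> sg \<sigma> * z p" if "p \<in> ?G" for p \<sigma>
      using that unfolding in_box_def B1_def by blast
    have "h p = 0" if "p \<in> ?G" for p
      using h[OF that, of True] h[OF that, of False] \<Delta> by (simp add: distrib_left mult_le_0_iff zero_le_mult_iff)
    then show "0 \<le> cost ?G c h" unfolding cost_def by (simp add: sum.neutral)
  qed
  have "progress n z U c \<Delta> (\<lambda>_ _. 0) m1" unfolding progress_def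
  proof (intro bexI[of _ "\<lambda>_. 0"] exI[of _ B1] conjI ballI allI)
    fix p \<sigma> assume "p \<in> ?G"
    then have "sg \<sigma> * z p \<le> U \<sigma> p" using box unfolding in_box_def by blast
    then show "B1 \<sigma> p = min (U \<sigma> p) (sg \<sigma> * z p + 0 * \<Delta>)" by (simp add: B1_def)
  qed (use rep1 opt1 generated.zero[OF ker_generated] in simp_all)
  from sweeps_progress[OF this \<Delta>, of "T * nat C" \<iota>]
  obtain y B where y: "y \<in> ker n"
    and rep2: "state_rep n (run n (seqs (map (\<lambda>_. HUp 0 sweep) [0..<T * nat C])) \<iota> m1) (shift z \<Delta> y) U B c (of_int \<Delta>)"
    and opt2: "opt n B c \<Delta> (shift z \<Delta> y)"
    and B: "\<And>\<sigma> p. p \<in> ?G \<Longrightarrow> B \<sigma> p = min (U \<sigma> p) (sg \<sigma> * z p + (int (T * nat C * n) * sweep_count n \<sigma> p) * \<Delta>)"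
    unfolding progress_def by auto
  have "int (card ?G) * C \<le> int (T * nat C * n) * sweep_count n \<sigma> p" if "p \<in> ?G" for \<sigma> p
  proof -
    have "int (card ?G) * C = int (T * nat C * n) * 1" using C_nonneg by simp
    also have "\<dots> \<le> int (T * nat C * n) * sweep_count n \<sigma> p"
      using sweep_count_pos[OF that] by (intro mult_left_mono) auto
    finally show ?thesis .
  qed
  then have "opt n U c \<Delta> (shift z \<Delta> y)"
    using generated.scale_opt_from_box[OF ker_generated ker_halve opt \<Delta> C_nonneg _ _ B y opt2] gens_bound
    by blast
  moreover have "state_rep n (run n phase \<iota> m) (shift z \<Delta> y) U B c (of_int \<Delta> / 2)"
    using rep2 unfolding state_rep_def phase_def by (simp add: m1_def)
  ultimately show ?thesis using y by blast
qed

end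


section \<open>Setting up the first scale\<close>

text \<open>For loops whose only effect is to update one global. The update function may read the
  store, but sees the accumulator only through its last argument, so it can be evaluated in the
  initial store.\<close>

lemma loop_accumulates:
  assumes step: "\<forall>i x m. i < n \<longrightarrow> x \<in> set xs \<longrightarrow> run n (p x) (\<iota>(d := i)) m = m(Glob g := \<phi> m i x (m (Glob g)))"
    and indep: "\<forall>i x m y. \<phi> (m(Glob g := y)) i x = \<phi> m i x"
  shows "run n (HUp d (seqs (map p xs))) \<iota> m =
    m(Glob g := fold (\<lambda>i. fold (\<phi> m i) xs) [0..<n] (m (Glob g)))"
proof -
  have row: "fold (\<lambda>x. run n (p x) (\<iota>(d := i))) ys (m(Glob g := y)) = m(Glob g := fold (\<phi> m i) ys y)"
    if "i < n" "set ys \<subseteq> set xs" for i ys y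
    using that(2)
  proof (induction ys arbitrary: y)
    case (Cons x ys)
    have eq: "run n (p x) (\<iota>(d := i)) (m(Glob g := y)) = m(Glob g := \<phi> m i x y)"
      using step[rule_format, OF that(1), of x] indep Cons.prems by simp
    have "set ys \<subseteq> set xs" using Cons.prems by simp
    then show ?case by (simp only: fold_simps eq Cons.IH)
  qed simp
  have loop: "fold (\<lambda>i. run n (seqs (map p xs)) (\<iota>(d := i))) js (m(Glob g := y)) =
      m(Glob g := fold (\<lambda>i. fold (\<phi> m i) xs) js y)" if "set js \<subseteq> {..<n}" for js y
    using that
  proof (induction js arbitrary: y)
    case (Cons i js)
    have eq: "run n (seqs (map p xs)) (\<iota>(d := i)) (m(Glob g := y)) = m(Glob g := fold (\<phi> m i) xs y)"
      using row[of i xs y] Cons.prems by (simp add: run_seqs_map)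
    have "set js \<subseteq> {..<n}" using Cons.prems by simp
    then show ?case by (simp only: fold_simps eq Cons.IH)
  qed simp
  have "set [0..<n] \<subseteq> {..<n}" by auto
  from loop[OF this, of "m (Glob g)"] show ?thesis by simp
qed

lemma fold_add_real: "fold (\<lambda>x y. y + v x) xs y = y + sum_list (map v xs)" for y :: real
  by (induction xs arbitrary: y) simp_all

lemma fold_flag:
  "fold (\<lambda>i. fold (\<lambda>x y. if Q i x then y else (0 :: real)) xs) js y =
    (if \<forall>i\<in>set js. \<forall>x\<in>set xs. Q i x then y else 0)"
proof -
  have "fold (\<lambda>x y. if Q i x then y else (0 :: real)) ys y = (if \<forall>x\<in>set ys. Q i x then y else 0)" for i ys y
    by (induction ys arbitrary: y) auto
  then show ?thesis by (induction js arbitrary: y) auto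
qed

lemma fold_max:
  "fold (\<lambda>i. fold (\<lambda>x y. if f i x \<le> y then y else f i x) xs) js y =
    fold (\<lambda>i. fold (\<lambda>x. max (f i x)) xs) js (y :: real)"
proof -
  have "(\<lambda>x y. if f i x \<le> y then y else f i x) = (\<lambda>x. max (f i x))" for i
    by (simp add: fun_eq_iff max_def)
  then show ?thesis by simp
qed

lemma fold_max_bounds:
  fixes y :: real
  shows "i \<in> set js \<Longrightarrow> x \<in> set xs \<Longrightarrow> f i x \<le> fold (\<lambda>i. fold (\<lambda>x. max (f i x)) xs) js y"
    and "y \<le> R \<Longrightarrow> (\<And>i x. i \<in> set js \<Longrightarrow> x \<in> set xs \<Longrightarrow> f i x \<le> R) \<Longrightarrow>
      fold (\<lambda>i. fold (\<lambda>x. max (f i x)) xs) js y \<le> R"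
proof -
  have row: "y \<le> fold (\<lambda>x. max (f i x)) ys y \<and> (\<forall>x\<in>set ys. f i x \<le> fold (\<lambda>x. max (f i x)) ys y)" for i ys y
    by (induction ys rule: rev_induct) auto
  have "y \<le> fold (\<lambda>i. fold (\<lambda>x. max (f i x)) xs) is y \<and>
     (\<forall>i\<in>set is. \<forall>x\<in>set xs. f i x \<le> fold (\<lambda>i. fold (\<lambda>x. max (f i x)) xs) is y)" for "is"
  proof (induction "is" rule: rev_induct)
    case (snoc k "is")
    let ?y = "fold (\<lambda>i. fold (\<lambda>x. max (f i x)) xs) is y"
    have "?y \<le> fold (\<lambda>x. max (f k x)) xs ?y" "\<forall>x\<in>set xs. f k x \<le> fold (\<lambda>x. max (f k x)) xs ?y"
      using row by blast+
    then show ?case using snoc by fastforce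
  qed simp
  then show "i \<in> set js \<Longrightarrow> x \<in> set xs \<Longrightarrow> f i x \<le> fold (\<lambda>i. fold (\<lambda>x. max (f i x)) xs) js y" by blast
  have rowR: "fold (\<lambda>x. max (f i x)) ys y \<le> R" if "y \<le> R" "\<forall>x\<in>set ys. f i x \<le> R" for i ys y
    using that by (induction ys arbitrary: y) auto
  show "y \<le> R \<Longrightarrow> (\<And>i x. i \<in> set js \<Longrightarrow> x \<in> set xs \<Longrightarrow> f i x \<le> R) \<Longrightarrow>
      fold (\<lambda>i. fold (\<lambda>x. max (f i x)) xs) js y \<le> R"
    by (induction js arbitrary: y) (auto intro: rowR)
qed

text \<open>Both blocks are extended by identity columns. Every brick receives slacks for the top
  rows too, although one copy would balance them, because then the extended matrix is again an
  n-fold product of a fixed bimatrix.\<close>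

locale nfold_solver = nfold_transitions T E S C r s a1 a2 sts b1
  for T E S C r s a1 a2 sts b1 +
  fixes t :: nat and A :: "int mat"
  assumes T_def: "T = t + r + s"
    and a1_def: "a1 = (\<lambda>k j. if j < t then A $$ (k, j) else if j = t + k then 1 else 0)"
    and a2_def: "a2 = (\<lambda>k j. if j < t then A $$ (r + k, j) else if j = t + r + k then 1 else 0)"
begin

text \<open>Columns \<open>t, ..., T - 1\<close> are slack columns; column \<open>t + k\<close> belongs to row \<open>k\<close> of the bimatrix.\<close>

definition w_in :: "nat \<Rightarrow> hloc" where "w_in j = HLow (Aff (1 + j) 0 t 0)"
definition l_in :: "nat \<Rightarrow> hloc" where "l_in j = HLow (Aff (1 + r + j) (t + s) t 0)"
definition l_in0 :: "nat \<Rightarrow> hloc" where "l_in0 j = HLow (Aff (1 + r + j) (t + s) 0 0)"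
definition u_in :: "nat \<Rightarrow> hloc" where "u_in j = HLow (Aff (1 + r + j) (t + s + t) t 0)"
definition b_top :: "nat \<Rightarrow> hloc" where "b_top k = HLow (Aff (1 + k) t 0 0)"
definition b_bottom :: "nat \<Rightarrow> hloc" where "b_bottom k = HLow (Aff (1 + r + k) t s 0)"

abbreviation glob :: "field \<Rightarrow> hexp" where "glob f \<equiv> HRead (HGlob f)"
abbreviation loc0 :: "field \<Rightarrow> hexp" where "loc0 f \<equiv> HRead (here 0 0 f)"

definition row_value :: "(nat \<Rightarrow> hloc) \<Rightarrow> nat \<Rightarrow> hexp" where
  "row_value l k = hsum (map (\<lambda>j. HMul (HConst (A $$ (k, j))) (HRead (l j))) [0..<t])"

definition start_pos :: "nat \<Rightarrow> hexp" where
  "start_pos j = (if j < t then HRead (l_in j)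
     else HSub (if j < t + r then HConst 0 else HRead (b_bottom (j - (t + r)))) (row_value l_in (j - t)))"

text \<open>The first brick alone carries the top part of the right-hand side.\<close>

definition init_pos :: hprog where
  "init_pos = HSeq (HUp 0 (seqs (map (\<lambda>j. HSet (here 0 0 (Pos j)) (start_pos j)) [0..<T])))
     (seqs (map (\<lambda>k. HSet (HBrick (Aff 0 0 0 0) (Pos (t + k))) (HSub (HRead (b_top k)) (row_value l_in0 k))) [0..<r]))"

text \<open>Crossing bounds have to be ruled out beforehand: the starting point has the lower bounds
  as coordinates and would otherwise lie outside its box.\<close>

definition check_bounds :: hprog where
  "check_bounds = HSeq (HSet (HGlob Flag) (HConst 1)) (HUp 0 (seqs (map (\<lambda>j.
     HIf (HRead (l_in j)) (HRead (u_in j)) HSkip (HSet (HGlob Flag) (HConst 0))) [0..<t])))"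

definition init_weight :: hprog where
  "init_weight = HSeq (HSet (HGlob Weight) (HConst 1)) (HUp 0 (seqs (map (\<lambda>j.
     HSet (HGlob Weight) (HAdd (glob Weight) (HMul (HMul (HRead (w_in j)) (HRead (w_in j)))
       (HSub (HRead (u_in j)) (HRead (l_in j)))))) [0..<t])))"

definition choose_sign :: "nat \<Rightarrow> field \<Rightarrow> hexp \<Rightarrow> hexp \<Rightarrow> hexp \<Rightarrow> hprog" where
  "choose_sign j f e1 e2 e3 = (if j < t then HSet (here 0 0 f) e1
     else HIf (loc0 (Pos j)) (HConst 0) (HSet (here 0 0 f) e2) (HSet (here 0 0 f) e3))"

definition init_upper :: hprog where
  "init_upper = HUp 0 (seqs (map (\<lambda>j. choose_sign j (Bnd True j) (HRead (u_in j)) (HConst 0) (loc0 (Pos j))) [0..<T]))"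

definition init_lower :: hprog where
  "init_lower = HUp 0 (seqs (map (\<lambda>j. choose_sign j (Bnd False j) (HSub (HConst 0) (HRead (l_in j)))
     (HSub (HConst 0) (loc0 (Pos j))) (HConst 0)) [0..<T]))"

definition init_cost :: hprog where
  "init_cost = HUp 0 (seqs (map (\<lambda>j. choose_sign j (Cost j) (HRead (w_in j))
     (HSub (HConst 0) (glob Weight)) (glob Weight)) [0..<T]))"

definition init_range :: hprog where
  "init_range = HSeq (HSet (HGlob Range) (HConst 0)) (HUp 0 (seqs (map (\<lambda>j.
     HIf (HAdd (loc0 (Bnd True j)) (loc0 (Bnd False j))) (glob Range) HSkip
       (HSet (HGlob Range) (HAdd (loc0 (Bnd True j)) (loc0 (Bnd False j))))) [0..<T])))"

definition init_penalty :: hprog where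
  "init_penalty = HSeq (HSet (HGlob Penalty) (HConst 1)) (HUp 0 (seqs (map (\<lambda>j.
     HSet (HGlob Penalty) (HAdd (glob Penalty) (HMul (HConst C) (HMul (loc0 (Cost j)) (loc0 (Cost j)))))) [0..<T])))"

definition init_final :: hprog where
  "init_final = HSeq (seqs (map (\<lambda>k. HSet (HBrick (Aff 0 1 0 0) (Val k)) (if k = 0 then HConst 0 else glob Penalty)) [0..<S]))
     (HSet (HGlob Scale) (HConst 1))"

definition init :: hprog where
  "init = seqs [init_pos, check_bounds, init_weight, init_upper, init_lower, init_cost,
     init_range, init_penalty, init_final]"

definition inputs :: "nat \<Rightarrow> store \<Rightarrow> (nat \<times> nat \<Rightarrow> int) \<Rightarrow> (nat \<Rightarrow> int) \<Rightarrow> (nat \<times> nat \<Rightarrow> int) \<Rightarrow>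
    (nat \<times> nat \<Rightarrow> int) \<Rightarrow> (nat \<times> nat \<Rightarrow> int) \<Rightarrow> bool" where
  "inputs n m w bt bb l u \<longleftrightarrow>
     (\<forall>\<iota>. \<iota> 0 < n \<longrightarrow> (\<forall>j<t. m (lval n \<iota> (w_in j)) = of_int (w (\<iota> 0, j)) \<and>
         m (lval n \<iota> (l_in j)) = of_int (l (\<iota> 0, j)) \<and> m (lval n \<iota> (u_in j)) = of_int (u (\<iota> 0, j))) \<and>
       (\<forall>k<s. m (lval n \<iota> (b_bottom k)) = of_int (bb (\<iota> 0, k)))) \<and>
     (\<forall>\<iota>. (\<forall>k<r. m (lval n \<iota> (b_top k)) = of_int (bt k)) \<and>
       (\<forall>j<t. m (lval n \<iota> (l_in0 j)) = of_int (l (0, j))))"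

lemma inputs_low: "inputs n m w bt bb l u \<Longrightarrow> (\<And>a. m' (Low a) = m (Low a)) \<Longrightarrow> inputs n m' w bt bb l u"
  unfolding inputs_def w_in_def l_in_def l_in0_def u_in_def b_top_def b_bottom_def by simp

definition z0 :: "(nat \<Rightarrow> int) \<Rightarrow> (nat \<times> nat \<Rightarrow> int) \<Rightarrow> (nat \<times> nat \<Rightarrow> int) \<Rightarrow> nat \<times> nat \<Rightarrow> int" where
  "z0 bt bb l = (\<lambda>(i, j). if j < t then l (i, j)
     else (if j < t + r then (if i = 0 then bt (j - t) else 0) else bb (i, j - (t + r))) -
       (\<Sum>j'<t. A $$ (j - t, j') * l (i, j')))"

text \<open>A slack is confined to the interval between 0 and its starting value. Its sign is thus
  known in advance, which makes its absolute value a linear function on the box.\<close>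

definition U0 :: "(nat \<Rightarrow> int) \<Rightarrow> (nat \<times> nat \<Rightarrow> int) \<Rightarrow> (nat \<times> nat \<Rightarrow> int) \<Rightarrow> (nat \<times> nat \<Rightarrow> int) \<Rightarrow> bool \<Rightarrow> nat \<times> nat \<Rightarrow> int" where
  "U0 bt bb l u \<sigma> = (\<lambda>(i, j). if j < t then (if \<sigma> then u (i, j) else - l (i, j))
     else max 0 (sg \<sigma> * z0 bt bb l (i, j)))"

text \<open>The squares bound the absolute values of the integers \<open>w\<close> without a sign
  test. The sum bounds how much the objective can vary between the bounds, and the 1 makes a single
  unit of slack more expensive than that.\<close>

definition big :: "nat \<Rightarrow> (nat \<times> nat \<Rightarrow> int) \<Rightarrow> (nat \<times> nat \<Rightarrow> int) \<Rightarrow> (nat \<times> nat \<Rightarrow> int) \<Rightarrow> int" where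
  "big n w l u = 1 + (\<Sum>i<n. \<Sum>j<t. w (i, j) * w (i, j) * (u (i, j) - l (i, j)))"

text \<open>On the box the slack part of this linear cost is \<open>big\<close> times the sum of the
  absolute values of the slacks.\<close>

definition c0 :: "nat \<Rightarrow> (nat \<times> nat \<Rightarrow> int) \<Rightarrow> (nat \<Rightarrow> int) \<Rightarrow> (nat \<times> nat \<Rightarrow> int) \<Rightarrow> (nat \<times> nat \<Rightarrow> int) \<Rightarrow> (nat \<times> nat \<Rightarrow> int) \<Rightarrow> nat \<times> nat \<Rightarrow> int" where
  "c0 n w bt bb l u = (\<lambda>(i, j). if j < t then w (i, j)
     else if z0 bt bb l (i, j) \<le> 0 then - big n w l u else big n w l u)"

lemma hval_row_value:
  assumes "\<And>j. j < t \<Longrightarrow> m (lval n \<iota> (f j)) = of_int (x j)"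
  shows "hval n \<iota> m (row_value f k) = of_int (\<Sum>j<t. A $$ (k, j) * x j)"
  unfolding row_value_def hval_hsum using assms by simp

section \<open>Effect of the initialisation\<close>

lemma init_pos_spec:
  assumes inp: "inputs n m w bt bb l u"
  shows "i < n \<Longrightarrow> j < T \<Longrightarrow> run n init_pos \<iota> m (Brick i (Pos j)) = of_int (z0 bt bb l (i, j))"
    and "(\<And>i j. x \<noteq> Brick i (Pos j)) \<Longrightarrow> run n init_pos \<iota> m x = m x"
proof -
  let ?p = "\<lambda>j. HSet (here 0 0 (Pos j)) (start_pos j)"
  let ?v = "\<lambda>i j m. hval n (\<iota>(0 := i)) m (start_pos j)"
  have low: "hval n \<iota> m' (start_pos j) = hval n \<iota> m (start_pos j)"
    if "\<And>a. m' (Low a) = m (Low a)" for m' m \<iota> j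
    using that by (simp add: start_pos_def row_value_def hval_hsum l_in_def b_bottom_def)
  have step: "\<forall>i x m. i < n \<longrightarrow> x \<in> set [0..<T] \<longrightarrow> run n (?p x) (\<iota>(0 := i)) m = m(Brick i (Pos x) := ?v i x m)"
    by simp
  have indep: "\<forall>i x m m'. i < n \<longrightarrow> x \<in> set [0..<T] \<longrightarrow>
      (\<forall>l. (\<forall>i'<n. \<forall>y\<in>set [0..<T]. l \<noteq> Brick i' (Pos y)) \<longrightarrow> m' l = m l) \<longrightarrow> ?v i x m' = ?v i x m"
  proof (intro allI impI)
    fix i x and m m' :: store
    assume "\<forall>l. (\<forall>i'<n. \<forall>y\<in>set [0..<T]. l \<noteq> Brick i' (Pos y)) \<longrightarrow> m' l = m l"
    then show "?v i x m' = ?v i x m" by (intro low) simp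
  qed
  have inj: "inj_on Pos (set [0..<T])" by (simp add: inj_on_def)
  note L = loop_assigns[OF step indep inj, where m = m]
  define m1 where "m1 = run n (HUp 0 (seqs (map ?p [0..<T]))) \<iota> m"
  let ?p2 = "\<lambda>k. HSet (HBrick (Aff 0 0 0 0) (Pos (t + k))) (HSub (HRead (b_top k)) (row_value l_in0 k))"
  let ?v2 = "\<lambda>k m. hval n \<iota> m (HSub (HRead (b_top k)) (row_value l_in0 k))"
  have step2: "\<forall>x m. x \<in> set [0..<r] \<longrightarrow> run n (?p2 x) \<iota> m = m(Brick 0 (Pos (t + x)) := ?v2 x m)"
    by simp
  have indep2: "\<forall>x m m'. x \<in> set [0..<r] \<longrightarrow> (\<forall>l. (\<forall>y\<in>set [0..<r]. l \<noteq> Brick 0 (Pos (t + y))) \<longrightarrow> m' l = m l) \<longrightarrow>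
      ?v2 x m' = ?v2 x m"
    by (simp add: row_value_def hval_hsum l_in0_def b_top_def)
  have inj2: "inj_on (\<lambda>k. Pos (t + k)) (set [0..<r])" by (simp add: inj_on_def)
  note R = run_assigns[OF step2 indep2 inj2, where m = m1]
  have run: "run n init_pos \<iota> m = run n (seqs (map ?p2 [0..<r])) \<iota> m1"
    by (simp add: init_pos_def m1_def)
  have m1: "m1 (Brick i (Pos j)) = ?v i j m" if "i < n" "j < T" for i j
    unfolding m1_def using L(1)[OF that(1), of j] that(2) by simp
  have m1_other: "m1 x = m x" if "\<And>i j. x \<noteq> Brick i (Pos j)" for x
    unfolding m1_def by (rule L(2)) (use that in auto)
  have inp1: "inputs n m1 w bt bb l u" using inp by (rule inputs_low) (rule m1_other, simp)
  have row: "hval n (\<iota>(0 := i)) m (row_value l_in k) = of_int (\<Sum>j<t. A $$ (k, j) * l (i, j))" if "i < n" for i k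
    by (rule hval_row_value) (use inp that in \<open>auto simp: inputs_def\<close>)
  have row0: "hval n \<iota> m1 (row_value l_in0 k) = of_int (\<Sum>j<t. A $$ (k, j) * l (0, j))" for k
    by (rule hval_row_value) (use inp1 in \<open>auto simp: inputs_def\<close>)
  show "run n init_pos \<iota> m (Brick i (Pos j)) = of_int (z0 bt bb l (i, j))" if i: "i < n" and j: "j < T"
  proof (cases "i = 0 \<and> t \<le> j \<and> j < t + r")
    case True
    then have "run n init_pos \<iota> m (Brick 0 (Pos (t + (j - t)))) = ?v2 (j - t) m1"
      unfolding run by (intro R(1)) auto
    moreover have "m1 (lval n \<iota> (b_top (j - t))) = of_int (bt (j - t))"
      using inp1 True by (auto simp: inputs_def)
    ultimately show ?thesis using True row0 by (simp add: z0_def)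
  next
    case False
    have "run n init_pos \<iota> m (Brick i (Pos j)) = m1 (Brick i (Pos j))"
      unfolding run by (rule R(2)) (use False in auto)
    also have "\<dots> = ?v i j m" using i j by (rule m1)
    also have "\<dots> = of_int (z0 bt bb l (i, j))"
    proof -
      have "m (lval n (\<iota>(0 := i)) (l_in j)) = of_int (l (i, j))" if "j < t"
        using inp i that by (auto simp: inputs_def)
      moreover have "m (lval n (\<iota>(0 := i)) (b_bottom (j - (t + r)))) = of_int (bb (i, j - (t + r)))" if "\<not> j < t + r"
      proof -
        have "j - (t + r) < s" using that j T_def by simp
        then show ?thesis using inp i by (auto simp: inputs_def)
      qed
      ultimately show ?thesis using row[OF i] False by (auto simp: start_pos_def z0_def)
    qed
    finally show ?thesis .
  qed
  show "run n init_pos \<iota> m x = m x" if "\<And>i j. x \<noteq> Brick i (Pos j)"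
    unfolding run using R(2)[of x] m1_other[OF that] that by auto
qed

lemma check_bounds_spec:
  assumes inp: "inputs n m w bt bb l u"
  shows "run n check_bounds \<iota> m = m(Glob Flag := (if \<forall>i<n. \<forall>j<t. l (i, j) \<le> u (i, j) then 1 else 0))"
proof -
  let ?p = "\<lambda>j. HIf (HRead (l_in j)) (HRead (u_in j)) HSkip (HSet (HGlob Flag) (HConst 0))"
  let ?\<phi> = "\<lambda>m i j y. if m (lval n (\<iota>(0 := i)) (l_in j)) \<le> m (lval n (\<iota>(0 := i)) (u_in j)) then y else (0 :: real)"
  have step: "\<forall>i x m. i < n \<longrightarrow> x \<in> set [0..<t] \<longrightarrow> run n (?p x) (\<iota>(0 := i)) m = m(Glob Flag := ?\<phi> m i x (m (Glob Flag)))"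
    by simp
  have indep: "\<forall>i x m y. ?\<phi> (m(Glob Flag := y)) i x = ?\<phi> m i x" by (simp add: l_in_def u_in_def)
  have "m (lval n (\<iota>(0 := i)) (l_in j)) = of_int (l (i, j))" "m (lval n (\<iota>(0 := i)) (u_in j)) = of_int (u (i, j))"
    if "i < n" "j < t" for i j
    using inp that by (auto simp: inputs_def)
  then have "fold (\<lambda>i. fold (?\<phi> m i) [0..<t]) [0..<n] 1 =
     fold (\<lambda>i. fold (\<lambda>j y. if l (i, j) \<le> u (i, j) then y else 0) [0..<t]) [0..<n] 1"
    by (intro fold_cong refl ext) simp
  also have "\<dots> = (if \<forall>i<n. \<forall>j<t. l (i, j) \<le> u (i, j) then 1 else 0)"
    by (subst fold_flag) auto
  finally show ?thesis
    using loop_accumulates[OF step indep, of "m(Glob Flag := 1)"]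
    by (simp add: check_bounds_def l_in_def u_in_def)
qed

lemma sum_fold:
  "fold (\<lambda>i. fold (\<lambda>j y. y + v i j) [0..<N]) [0..<n] y = y + (\<Sum>i<n. \<Sum>j<N. v i j)" for y :: real
proof -
  have "fold (\<lambda>j y. y + v i j) [0..<N] y = y + (\<Sum>j<N. v i j)" for i y
    by (simp add: fold_add_real interv_sum_list_conv_sum_set_nat atLeast0LessThan)
  then have "(\<lambda>i. fold (\<lambda>j y. y + v i j) [0..<N]) = (\<lambda>i y. y + (\<Sum>j<N. v i j))" by (simp add: fun_eq_iff)
  then show ?thesis by (simp add: fold_add_real interv_sum_list_conv_sum_set_nat atLeast0LessThan)
qed

lemma init_weight_spec:
  assumes inp: "inputs n m w bt bb l u"
  shows "run n init_weight \<iota> m = m(Glob Weight := of_int (big n w l u))"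
proof -
  let ?\<iota> = "\<lambda>i. \<iota>(0 := i)"
  let ?p = "\<lambda>j. HSet (HGlob Weight) (HAdd (glob Weight) (HMul (HMul (HRead (w_in j)) (HRead (w_in j)))
       (HSub (HRead (u_in j)) (HRead (l_in j)))))"
  let ?v = "\<lambda>m i j. m (lval n (?\<iota> i) (w_in j)) * m (lval n (?\<iota> i) (w_in j)) *
     (m (lval n (?\<iota> i) (u_in j)) - m (lval n (?\<iota> i) (l_in j)))"
  let ?\<phi> = "\<lambda>m i j (y :: real). y + ?v m i j"
  have step: "\<forall>i x m. i < n \<longrightarrow> x \<in> set [0..<t] \<longrightarrow> run n (?p x) (?\<iota> i) m = m(Glob Weight := ?\<phi> m i x (m (Glob Weight)))"
    by simp
  have indep: "\<forall>i x m y. ?\<phi> (m(Glob Weight := y)) i x = ?\<phi> m i x" by (simp add: w_in_def l_in_def u_in_def)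
  have "(\<Sum>i<n. \<Sum>j<t. ?v m i j) = (\<Sum>i<n. \<Sum>j<t. of_int (w (i, j) * w (i, j) * (u (i, j) - l (i, j))))"
    using inp by (intro sum.cong refl) (auto simp: inputs_def)
  then have "1 + (\<Sum>i<n. \<Sum>j<t. ?v m i j) = of_int (big n w l u)" by (simp add: big_def)
  then show ?thesis
    using loop_accumulates[OF step indep, of "m(Glob Weight := 1)"]
    by (simp add: init_weight_def sum_fold w_in_def l_in_def u_in_def)
qed

lemma choose_sign_spec:
  assumes inj: "inj_on f (set [0..<T])" and f: "\<And>j j'. f j \<noteq> Pos j'"
    and v: "\<And>i j m m'. (\<forall>l. (\<forall>i' y. l \<noteq> Brick i' (f y)) \<longrightarrow> m' l = m l) \<Longrightarrow>
      hval n (\<iota>(0 := i)) m' (e1 j) = hval n (\<iota>(0 := i)) m (e1 j) \<and>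
      hval n (\<iota>(0 := i)) m' (e2 j) = hval n (\<iota>(0 := i)) m (e2 j) \<and>
      hval n (\<iota>(0 := i)) m' (e3 j) = hval n (\<iota>(0 := i)) m (e3 j)"
  shows "i < n \<Longrightarrow> j < T \<Longrightarrow>
      run n (HUp 0 (seqs (map (\<lambda>j. choose_sign j (f j) (e1 j) (e2 j) (e3 j)) [0..<T]))) \<iota> m (Brick i (f j)) =
      hval n (\<iota>(0 := i)) m (if j < t then e1 j else if m (Brick i (Pos j)) \<le> 0 then e2 j else e3 j)"
    and "(\<And>i j. x \<noteq> Brick i (f j)) \<Longrightarrow>
      run n (HUp 0 (seqs (map (\<lambda>j. choose_sign j (f j) (e1 j) (e2 j) (e3 j)) [0..<T]))) \<iota> m x = m x"
proof -
  let ?p = "\<lambda>j. choose_sign j (f j) (e1 j) (e2 j) (e3 j)"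
  let ?v = "\<lambda>i j m. hval n (\<iota>(0 := i)) m (if j < t then e1 j else if m (Brick i (Pos j)) \<le> 0 then e2 j else e3 j)"
  have step: "\<forall>i x m. i < n \<longrightarrow> x \<in> set [0..<T] \<longrightarrow> run n (?p x) (\<iota>(0 := i)) m = m(Brick i (f x) := ?v i x m)"
    by (simp add: choose_sign_def)
  have indep: "\<forall>i x m m'. i < n \<longrightarrow> x \<in> set [0..<T] \<longrightarrow>
      (\<forall>l. (\<forall>i'<n. \<forall>y\<in>set [0..<T]. l \<noteq> Brick i' (f y)) \<longrightarrow> m' l = m l) \<longrightarrow> ?v i x m' = ?v i x m"
  proof (intro allI impI)
    fix i x and m m' :: store
    assume eq: "\<forall>l. (\<forall>i'<n. \<forall>y\<in>set [0..<T]. l \<noteq> Brick i' (f y)) \<longrightarrow> m' l = m l"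
    have "m' (Brick i (Pos x)) = m (Brick i (Pos x))" using eq f[symmetric] by auto
    moreover have "\<forall>l. (\<forall>i' y. l \<noteq> Brick i' (f y)) \<longrightarrow> m' l = m l" using eq by blast
    from v[OF this, of i x] calculation show "?v i x m' = ?v i x m" by simp
  qed
  note L = loop_assigns[OF step indep inj, where m = m]
  show "i < n \<Longrightarrow> j < T \<Longrightarrow> run n (HUp 0 (seqs (map ?p [0..<T]))) \<iota> m (Brick i (f j)) = ?v i j m"
    using L(1)[of i j] by simp
  show "(\<And>i j. x \<noteq> Brick i (f j)) \<Longrightarrow> run n (HUp 0 (seqs (map ?p [0..<T]))) \<iota> m x = m x"
    by (rule L(2)) auto
qed

lemma init_spec:
  fixes \<iota> :: env and m :: store and n :: nat
  assumes inp: "inputs n m w bt bb l u" and zero: "\<And>i \<sigma> j. m (Brick i (Box \<sigma> j)) = 0"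
  defines "m' \<equiv> run n init \<iota> m"
  shows "m' (Glob Flag) = (if \<forall>i<n. \<forall>j<t. l (i, j) \<le> u (i, j) then 1 else 0)"
    and "state_rep n m' (z0 bt bb l) (U0 bt bb l u) (\<lambda>_ _. 0) (c0 n w bt bb l u) 1"
    and "i < n \<Longrightarrow> j < T \<Longrightarrow> of_int (U0 bt bb l u True (i, j) + U0 bt bb l u False (i, j)) \<le> m' (Glob Range)"
    and "0 \<le> R \<Longrightarrow> (\<And>i j. i < n \<Longrightarrow> j < T \<Longrightarrow> of_int (U0 bt bb l u True (i, j) + U0 bt bb l u False (i, j)) \<le> R) \<Longrightarrow>
      m' (Glob Range) \<le> R"
proof -
  let ?Z = "z0 bt bb l" and ?U = "U0 bt bb l u" and ?c = "c0 n w bt bb l u"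
  define m1 where "m1 = run n init_pos \<iota> m"
  define m2 where "m2 = run n check_bounds \<iota> m1"
  define m3 where "m3 = run n init_weight \<iota> m2"
  define m4 where "m4 = run n init_upper \<iota> m3"
  define m5 where "m5 = run n init_lower \<iota> m4"
  define m6 where "m6 = run n init_cost \<iota> m5"
  define m7 where "m7 = run n init_range \<iota> m6"
  define m8 where "m8 = run n init_penalty \<iota> m7"
  have m': "m' = run n init_final \<iota> m8"
    by (simp add: m'_def init_def seqs_def m8_def m7_def m6_def m5_def m4_def m3_def m2_def m1_def)
  have z1: "m1 (Brick i (Pos j)) = of_int (?Z (i, j))" if "i < n" "j < T" for i j
    unfolding m1_def using init_pos_spec(1)[OF inp that] .
  have o1: "m1 x = m x" if "\<And>i j. x \<noteq> Brick i (Pos j)" for x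
    unfolding m1_def using init_pos_spec(2)[OF inp that] .
  have inp1: "inputs n m1 w bt bb l u" using inp by (rule inputs_low) (simp add: o1)
  have m2: "m2 = m1(Glob Flag := (if \<forall>i<n. \<forall>j<t. l (i, j) \<le> u (i, j) then 1 else 0))"
    unfolding m2_def using check_bounds_spec[OF inp1] .
  have inp2: "inputs n m2 w bt bb l u" using inp1 by (rule inputs_low) (simp add: m2)
  have m3: "m3 = m2(Glob Weight := of_int (big n w l u))"
    unfolding m3_def using init_weight_spec[OF inp2] .
  have inp3: "inputs n m3 w bt bb l u" using inp2 by (rule inputs_low) (simp add: m3)
  have z3: "m3 (Brick i (Pos j)) = of_int (?Z (i, j))" if "i < n" "j < T" for i j
    using z1[OF that] by (simp add: m3 m2)
  have in3: "m3 (lval n (\<iota>(0 := i)) (u_in j)) = of_int (u (i, j))" "m3 (lval n (\<iota>(0 := i)) (l_in j)) = of_int (l (i, j))"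
    "m3 (lval n (\<iota>(0 := i)) (w_in j)) = of_int (w (i, j))" if "i < n" "j < t" for i j
    using inp3 that by (auto simp: inputs_def)
  have up: "m4 (Brick i (Bnd True j)) = hval n (\<iota>(0 := i)) m3 (if j < t then HRead (u_in j)
      else if m3 (Brick i (Pos j)) \<le> 0 then HConst 0 else loc0 (Pos j))" if "i < n" "j < T" for i j
    unfolding m4_def init_upper_def by (rule choose_sign_spec(1)) (auto simp: inj_on_def u_in_def that)
  have o4: "m4 x = m3 x" if "\<And>i j. x \<noteq> Brick i (Bnd True j)" for x
    unfolding m4_def init_upper_def by (rule choose_sign_spec(2)) (auto simp: inj_on_def u_in_def that)
  have lo: "m5 (Brick i (Bnd False j)) = hval n (\<iota>(0 := i)) m4 (if j < t then HSub (HConst 0) (HRead (l_in j))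
      else if m4 (Brick i (Pos j)) \<le> 0 then HSub (HConst 0) (loc0 (Pos j)) else HConst 0)" if "i < n" "j < T" for i j
    unfolding m5_def init_lower_def by (rule choose_sign_spec(1)) (auto simp: inj_on_def l_in_def that)
  have o5: "m5 x = m4 x" if "\<And>i j. x \<noteq> Brick i (Bnd False j)" for x
    unfolding m5_def init_lower_def by (rule choose_sign_spec(2)) (auto simp: inj_on_def l_in_def that)
  have co: "m6 (Brick i (Cost j)) = hval n (\<iota>(0 := i)) m5 (if j < t then HRead (w_in j)
      else if m5 (Brick i (Pos j)) \<le> 0 then HSub (HConst 0) (glob Weight) else glob Weight)" if "i < n" "j < T" for i j
    unfolding m6_def init_cost_def by (rule choose_sign_spec(1)) (auto simp: inj_on_def w_in_def that)
  have o6: "m6 x = m5 x" if "\<And>i j. x \<noteq> Brick i (Cost j)" for x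
    unfolding m6_def init_cost_def by (rule choose_sign_spec(2)) (auto simp: inj_on_def w_in_def that)
  have Low: "m5 (Low a) = m3 (Low a)" "m4 (Low a) = m3 (Low a)" for a by (simp_all add: o5 o4)
  have lv: "m4 (lval n \<iota>' (l_in j)) = m3 (lval n \<iota>' (l_in j))" "m5 (lval n \<iota>' (w_in j)) = m3 (lval n \<iota>' (w_in j))" for \<iota>' j
    by (simp_all add: l_in_def w_in_def Low)
  have U6: "m6 (Brick i (Bnd \<sigma> j)) = of_int (?U \<sigma> (i, j))" if ij: "i < n" "j < T" for i j \<sigma>
  proof (cases \<sigma>)
    case True
    have "m6 (Brick i (Bnd True j)) = m4 (Brick i (Bnd True j))" by (simp add: o6 o5)
    then show ?thesis using up[OF ij] in3[OF ij(1)] z3[OF ij] True by (auto simp: U0_def max_def)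
  next
    case False
    have "m6 (Brick i (Bnd False j)) = m5 (Brick i (Bnd False j))" by (simp add: o6)
    then show ?thesis using lo[OF ij] in3[OF ij(1)] z3[OF ij] False by (auto simp: U0_def max_def o4 lv)
  qed
  have C6: "m6 (Brick i (Cost j)) = of_int (?c (i, j))" if ij: "i < n" "j < T" for i j
    using co[OF ij] in3[OF ij(1)] z3[OF ij] by (auto simp: c0_def o4 o5 lv m3)
  have Z6: "m6 (Brick i (Pos j)) = of_int (?Z (i, j))" if "i < n" "j < T" for i j
    using z3[OF that] by (simp add: o6 o5 o4)
  let ?p = "\<lambda>j. HIf (HAdd (loc0 (Bnd True j)) (loc0 (Bnd False j))) (glob Range) HSkip
       (HSet (HGlob Range) (HAdd (loc0 (Bnd True j)) (loc0 (Bnd False j))))"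
  let ?f = "\<lambda>m i j. m (Brick i (Bnd True j)) + m (Brick i (Bnd False j)) :: real"
  let ?\<phi> = "\<lambda>m i j y. if ?f m i j \<le> y then y else ?f m i j"
  have step: "\<forall>i x m. i < n \<longrightarrow> x \<in> set [0..<T] \<longrightarrow> run n (?p x) (\<iota>(0 := i)) m = m(Glob Range := ?\<phi> m i x (m (Glob Range)))"
    by simp
  have indep: "\<forall>i x m y. ?\<phi> (m(Glob Range := y)) i x = ?\<phi> m i x" by (simp cong: if_cong)
  define rg where "rg = fold (\<lambda>i. fold (\<lambda>j. max (?f m6 i j)) [0..<T]) [0..<n] 0"
  have m7: "m7 = m6(Glob Range := rg)"
    using loop_accumulates[OF step indep, of "m6(Glob Range := 0)"]
    by (simp add: m7_def init_range_def rg_def fold_max cong: if_cong)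
  let ?p8 = "\<lambda>j. HSet (HGlob Penalty) (HAdd (glob Penalty) (HMul (HConst C) (HMul (loc0 (Cost j)) (loc0 (Cost j)))))"
  let ?\<phi>8 = "\<lambda>m i j (y :: real). y + of_int C * (m (Brick i (Cost j)) * m (Brick i (Cost j)))"
  have step8: "\<forall>i x m. i < n \<longrightarrow> x \<in> set [0..<T] \<longrightarrow> run n (?p8 x) (\<iota>(0 := i)) m = m(Glob Penalty := ?\<phi>8 m i x (m (Glob Penalty)))"
    by simp
  have indep8: "\<forall>i x m y. ?\<phi>8 (m(Glob Penalty := y)) i x = ?\<phi>8 m i x" by simp
  define pen where "pen = 1 + (\<Sum>i<n. \<Sum>j<T. of_int C * (m7 (Brick i (Cost j)) * m7 (Brick i (Cost j))))"
  have m8: "m8 = m7(Glob Penalty := pen)"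
    using loop_accumulates[OF step8 indep8, of "m7(Glob Penalty := 1)"]
    by (simp add: m8_def init_penalty_def pen_def sum_fold)
  have pen: "of_int (\<Sum>i<n. \<Sum>j<T. C * \<bar>?c (i, j)\<bar>) < pen"
  proof -
    have "pen = of_int (1 + (\<Sum>i<n. \<Sum>j<T. C * (?c (i, j) * ?c (i, j))))"
      unfolding pen_def using C6 by (simp add: m7)
    \<comment> \<open>The penalty is built from squares, which dominate absolute values since the
      costs are integers.\<close>
    moreover have "(\<Sum>i<n. \<Sum>j<T. C * \<bar>?c (i, j)\<bar>) \<le> (\<Sum>i<n. \<Sum>j<T. C * (?c (i, j) * ?c (i, j)))"
    proof (intro sum_mono mult_left_mono C_nonneg)
      fix i j show "\<bar>?c (i, j)\<bar> \<le> ?c (i, j) * ?c (i, j)"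
        using mult_right_mono[of 1 "\<bar>?c (i, j)\<bar>" "\<bar>?c (i, j)\<bar>"] by (cases "?c (i, j) = 0") (auto simp flip: abs_mult)
    qed
    ultimately show ?thesis by linarith
  qed
  let ?p9 = "\<lambda>k. HSet (HBrick (Aff 0 1 0 0) (Val k)) (if k = 0 then HConst 0 else glob Penalty)"
  let ?v9 = "\<lambda>k m. if k = 0 then 0 else m (Glob Penalty) :: real"
  have step9: "\<forall>x m. x \<in> set [0..<S] \<longrightarrow> run n (?p9 x) \<iota> m = m(Brick n (Val x) := ?v9 x m)" by simp
  have indep9: "\<forall>x m m'. x \<in> set [0..<S] \<longrightarrow> (\<forall>l. (\<forall>y\<in>set [0..<S]. l \<noteq> Brick n (Val y)) \<longrightarrow> m' l = m l) \<longrightarrow>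
      ?v9 x m' = ?v9 x m" by simp
  have inj9: "inj_on Val (set [0..<S])" by (simp add: inj_on_def)
  note R = run_assigns[OF step9 indep9 inj9, where m = m8]
  have m'_eq: "m' = (run n (seqs (map ?p9 [0..<S])) \<iota> m8)(Glob Scale := 1)"
    by (simp add: m' init_final_def)
  have val: "m' (Brick n (Val k)) = (if k = 0 then 0 else pen)" if "k < S" for k
    using R(1)[of k] that by (simp add: m'_eq m8)
  have o': "m' x = m8 x" if "\<And>k. x \<noteq> Brick n (Val k)" "x \<noteq> Glob Scale" for x
    using R(2)[of x] that by (simp add: m'_eq)
  show "m' (Glob Flag) = (if \<forall>i<n. \<forall>j<t. l (i, j) \<le> u (i, j) then 1 else 0)"
    by (simp add: o' m8 m7 o6 o5 o4 m3 m2)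
  have box: "m' (Brick i (Box \<sigma> j)) = 0" for i \<sigma> j
    by (simp add: o' m8 m7 o6 o5 o4 m3 m2 o1 zero)
  show "state_rep n m' ?Z ?U (\<lambda>_ _. 0) ?c 1" unfolding state_rep_def
  proof (intro conjI allI impI exI[of _ pen])
    show "m' (Glob Scale) = 1" by (simp add: m'_eq)
  qed (use pen val in \<open>auto simp: o' m8 m7 Z6 U6 C6 box\<close>)
  have rg: "m' (Glob Range) = rg" by (simp add: o' m8 m7)
  show "i < n \<Longrightarrow> j < T \<Longrightarrow> of_int (?U True (i, j) + ?U False (i, j)) \<le> m' (Glob Range)"
    unfolding rg rg_def using fold_max_bounds(1)[of i "[0..<n]" j "[0..<T]" "?f m6" 0] U6 by simp
  show "0 \<le> R \<Longrightarrow> (\<And>i j. i < n \<Longrightarrow> j < T \<Longrightarrow> of_int (?U True (i, j) + ?U False (i, j)) \<le> R) \<Longrightarrow> m' (Glob Range) \<le> R"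
    unfolding rg rg_def using U6 by (intro fold_max_bounds(2)) auto
qed


section \<open>Reading off the solution\<close>

definition check_slack :: hprog where
  "check_slack = HUp 0 (seqs (map (\<lambda>j. HIf (loc0 (Pos j)) (HConst 0)
     (HIf (HConst 0) (loc0 (Pos j)) HSkip (HSet (HGlob Flag) (HConst 0))) (HSet (HGlob Flag) (HConst 0))) [t..<T]))"

definition write_out :: hprog where
  "write_out = HUp 0 (seqs (map (\<lambda>j. HSet (HLow (Aff (1 + j) 0 t 0)) (loc0 (Pos j))) [0..<t]))"

definition double :: hprog where
  "double = HSet (HGlob Scale) (HAdd (glob Scale) (glob Scale))"

lemma check_slack_spec:
  "run n check_slack \<iota> m =
     m(Glob Flag := (if \<forall>i<n. \<forall>j\<in>{t..<T}. m (Brick i (Pos j)) = 0 then m (Glob Flag) else 0))"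
proof -
  let ?p = "\<lambda>j. HIf (loc0 (Pos j)) (HConst 0)
     (HIf (HConst 0) (loc0 (Pos j)) HSkip (HSet (HGlob Flag) (HConst 0))) (HSet (HGlob Flag) (HConst 0))"
  let ?\<phi> = "\<lambda>m i j y. if m (Brick i (Pos j)) = 0 then y else (0 :: real)"
  have step: "\<forall>i x m. i < n \<longrightarrow> x \<in> set [t..<T] \<longrightarrow> run n (?p x) (\<iota>(0 := i)) m = m(Glob Flag := ?\<phi> m i x (m (Glob Flag)))"
    by auto
  have indep: "\<forall>i x m y. ?\<phi> (m(Glob Flag := y)) i x = ?\<phi> m i x" by simp
  show ?thesis unfolding check_slack_def loop_accumulates[OF step indep, of m] fold_flag by (simp add: Ball_def)
qed

lemma write_out_spec:
  shows "(\<And>a. x \<noteq> Low a) \<Longrightarrow> run n write_out \<iota> m x = m x"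
    and "i < n \<Longrightarrow> j < t \<Longrightarrow> run n write_out \<iota> m (Low (1 + (j + t * i))) = m (Brick i (Pos j))"
proof -
  define P where "P i k m' \<longleftrightarrow> (\<forall>x. (\<forall>a. x \<noteq> Low a) \<longrightarrow> m' x = m x) \<and>
    (\<forall>i' j. j < t \<longrightarrow> i' < i \<or> i' = i \<and> j < k \<longrightarrow> m' (Low (1 + (j + t * i'))) = m (Brick i' (Pos j)))" for i k and m' :: store
  have "P n 0 (fold (\<lambda>i. run n (seqs (map (\<lambda>j. HSet (HLow (Aff (1 + j) 0 t 0)) (loc0 (Pos j))) [0..<t])) (\<iota>(0 := i))) [0..<n] m)"
  proof (rule fold_upt[where P = "\<lambda>i. P i 0"])
    show "P 0 0 m" by (simp add: P_def)
    fix i m' assume m': "P i 0 m'"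
    have "P i t (fold (\<lambda>j. run n (HSet (HLow (Aff (1 + j) 0 t 0)) (loc0 (Pos j))) (\<iota>(0 := i))) [0..<t] m')"
    proof (rule fold_upt[where P = "P i"])
      fix k m2 assume k: "k < t" and m2: "P i k m2"
      have r: "run n (HSet (HLow (Aff (1 + k) 0 t 0)) (loc0 (Pos k))) (\<iota>(0 := i)) m2 =
          m2(Low (1 + (k + t * i)) := m (Brick i (Pos k)))"
        using m2 by (simp add: P_def)
      have ne: "j + t * i' = k + t * i \<Longrightarrow> i' = i \<and> j = k" if "j < t" for i' j
        using record_eq[of t i' j i k] that k by (simp add: add.commute)
      show "P i (Suc k) (run n (HSet (HLow (Aff (1 + k) 0 t 0)) (loc0 (Pos k))) (\<iota>(0 := i)) m2)"
        unfolding r P_def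
      proof (intro conjI allI impI)
        fix i' j assume j: "j < t" and ij: "i' < i \<or> i' = i \<and> j < Suc k"
        show "(m2(Low (1 + (k + t * i)) := m (Brick i (Pos k)))) (Low (1 + (j + t * i'))) = m (Brick i' (Pos j))"
        proof (cases "i' = i \<and> j = k")
          case False
          then have "j + t * i' \<noteq> k + t * i" using ne[OF j] by blast
          then have "(m2(Low (1 + (k + t * i)) := m (Brick i (Pos k)))) (Low (1 + (j + t * i'))) = m2 (Low (1 + (j + t * i')))"
            by simp
          also have "\<dots> = m (Brick i' (Pos j))"
          proof -
            have "i' < i \<or> i' = i \<and> j < k" using ij False by auto
            then show ?thesis using m2 j unfolding P_def by blast
          qed
          finally show ?thesis .
        qed simp
      qed (use m2 in \<open>auto simp: P_def\<close>)
    qed (rule m')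
    then show "P (Suc i) 0 (run n (seqs (map (\<lambda>j. HSet (HLow (Aff (1 + j) 0 t 0)) (loc0 (Pos j))) [0..<t])) (\<iota>(0 := i)) m')"
      unfolding run_seqs_map P_def by (auto simp: less_Suc_eq)
  qed
  then have "P n 0 (run n write_out \<iota> m)" by (simp add: write_out_def)
  then show "(\<And>a. x \<noteq> Low a) \<Longrightarrow> run n write_out \<iota> m x = m x"
    and "i < n \<Longrightarrow> j < t \<Longrightarrow> run n write_out \<iota> m (Low (1 + (j + t * i))) = m (Brick i (Pos j))"
    unfolding P_def by blast+
qed


section \<open>Correctness of the extended program\<close>

lemma sum_columns: "(\<Sum>j<T. f j) = (\<Sum>j<t. f j) + (\<Sum>j\<in>{t..<T}. f j)" for f :: "nat \<Rightarrow> int"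
  using sum.atLeastLessThan_concat[of 0 t T f] T_def by (simp add: atLeast0LessThan)

lemma sum_pick: "k \<in> {t..<T} \<Longrightarrow> (\<Sum>j\<in>{t..<T}. (if j = k then 1 else 0) * f j) = f k" for f :: "nat \<Rightarrow> int"
  by (simp add: sum.delta if_distrib[of "\<lambda>x. x * _"] cong: if_cong)

lemma row_top:
  assumes "k < r"
  shows "(\<Sum>j<T. a1 k j * y j) = (\<Sum>j<t. A $$ (k, j) * y j) + y (t + k)"
proof -
  have "(\<Sum>j\<in>{t..<T}. a1 k j * y j) = (\<Sum>j\<in>{t..<T}. (if j = t + k then 1 else 0) * y j)"
    by (rule sum.cong) (auto simp: a1_def)
  also have "\<dots> = y (t + k)" using assms T_def by (intro sum_pick) auto
  finally show ?thesis unfolding sum_columns by (simp add: a1_def)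
qed

lemma row_bottom:
  assumes "k < s"
  shows "(\<Sum>j<T. a2 k j * y j) = (\<Sum>j<t. A $$ (r + k, j) * y j) + y (t + r + k)"
proof -
  have "(\<Sum>j\<in>{t..<T}. a2 k j * y j) = (\<Sum>j\<in>{t..<T}. (if j = t + r + k then 1 else 0) * y j)"
    by (rule sum.cong) (auto simp: a2_def)
  also have "\<dots> = y (t + r + k)" using assms T_def by (intro sum_pick) auto
  finally show ?thesis unfolding sum_columns by (simp add: a2_def)
qed

definition feas :: "nat \<Rightarrow> (nat \<Rightarrow> int) \<Rightarrow> (nat \<times> nat \<Rightarrow> int) \<Rightarrow> (nat \<times> nat \<Rightarrow> int) \<Rightarrow> (nat \<times> nat \<Rightarrow> int) \<Rightarrow>
    (nat \<times> nat \<Rightarrow> int) \<Rightarrow> bool" where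
  "feas n bt bb l u x \<longleftrightarrow> (\<forall>i<n. \<forall>j<t. l (i, j) \<le> x (i, j) \<and> x (i, j) \<le> u (i, j)) \<and>
     (\<forall>k<r. (\<Sum>i<n. \<Sum>j<t. A $$ (k, j) * x (i, j)) = bt k) \<and>
     (\<forall>i<n. \<forall>k<s. (\<Sum>j<t. A $$ (r + k, j) * x (i, j)) = bb (i, k))"

lemma z0_rows:
  assumes "1 \<le> n"
  shows "k < r \<Longrightarrow> (\<Sum>i<n. \<Sum>j<T. a1 k j * z0 bt bb l (i, j)) = bt k"
    and "k < s \<Longrightarrow> (\<Sum>j<T. a2 k j * z0 bt bb l (i, j)) = bb (i, k)"
proof -
  show "(\<Sum>i<n. \<Sum>j<T. a1 k j * z0 bt bb l (i, j)) = bt k" if k: "k < r"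
  proof -
    have "(\<Sum>i<n. \<Sum>j<T. a1 k j * z0 bt bb l (i, j)) = (\<Sum>i<n. if i = 0 then bt k else 0)"
    proof (rule sum.cong[OF refl])
      fix i
      have "(\<Sum>j<t. A $$ (k, j) * z0 bt bb l (i, j)) = (\<Sum>j<t. A $$ (k, j) * l (i, j))"
        by (rule sum.cong) (auto simp: z0_def)
      then show "(\<Sum>j<T. a1 k j * z0 bt bb l (i, j)) = (if i = 0 then bt k else 0)"
        unfolding row_top[OF k] using k by (simp add: z0_def)
    qed
    also have "\<dots> = bt k" using assms by simp
    finally show ?thesis .
  qed
  show "(\<Sum>j<T. a2 k j * z0 bt bb l (i, j)) = bb (i, k)" if k: "k < s"
  proof -
    have "(\<Sum>j<t. A $$ (r + k, j) * z0 bt bb l (i, j)) = (\<Sum>j<t. A $$ (r + k, j) * l (i, j))"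
      by (rule sum.cong) (auto simp: z0_def)
    then show ?thesis unfolding row_bottom[OF k] by (simp add: z0_def)
  qed
qed

text \<open>A feasible point of the original problem, with slacks 0, is a competitor in the extended
  one. If the optimum has slack 0 it is compared with it in the original objective; if not, its
  slack alone costs more than the objective can vary, so there is no such competitor.\<close>

lemma final_correct:
  assumes n: "1 \<le> n" and lu: "\<And>i j. i < n \<Longrightarrow> j < t \<Longrightarrow> l (i, j) \<le> u (i, j)"
    and y: "y \<in> ker n" and z: "z = (\<lambda>p. z0 bt bb l p + y p)"
    and opt: "opt n (U0 bt bb l u) (c0 n w bt bb l u) 1 z"
  shows "(\<And>i j. i < n \<Longrightarrow> j \<in> {t..<T} \<Longrightarrow> z (i, j) = 0) \<Longrightarrow> feas n bt bb l u z"
    and "(\<And>i j. i < n \<Longrightarrow> j \<in> {t..<T} \<Longrightarrow> z (i, j) = 0) \<Longrightarrow> feas n bt bb l u x \<Longrightarrow>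
      (\<Sum>i<n. \<Sum>j<t. w (i, j) * z (i, j)) \<le> (\<Sum>i<n. \<Sum>j<t. w (i, j) * x (i, j))"
    and "i0 < n \<Longrightarrow> j0 \<in> {t..<T} \<Longrightarrow> z (i0, j0) \<noteq> 0 \<Longrightarrow> \<not> feas n bt bb l u x"
proof -
  let ?G = "grid n T" and ?U = "U0 bt bb l u" and ?c = "c0 n w bt bb l u" and ?M = "big n w l u"
  have box: "in_box ?G ?U z" using opt by (simp add: opt_def)
  have top: "(\<Sum>i<n. \<Sum>j<T. a1 k j * z (i, j)) = bt k" if "k < r" for k
    using z0_rows(1)[OF n that] y that
    by (simp add: z distrib_left sum.distrib nfold_kernel_def)
  have bot: "(\<Sum>j<T. a2 k j * z (i, j)) = bb (i, k)" if "k < s" "i < n" for k i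
    using z0_rows(2)[OF n that(1)] y that
    by (simp add: z distrib_left sum.distrib nfold_kernel_def)
  have ub: "sg \<sigma> * z (i, j) \<le> ?U \<sigma> (i, j)" if "i < n" "j < T" for i j \<sigma>
    using box that unfolding in_box_def by blast
  have tT: "j < T" if "j < t" for j using that T_def by simp
  have bounds: "l (i, j) \<le> z (i, j) \<and> z (i, j) \<le> u (i, j)" if "i < n" "j < t" for i j
    using ub[OF that(1) tT[OF that(2)], of True] ub[OF that(1) tT[OF that(2)], of False] that by (simp add: U0_def)
  show fz: "feas n bt bb l u z" if slack: "\<And>i j. i < n \<Longrightarrow> j \<in> {t..<T} \<Longrightarrow> z (i, j) = 0"
    unfolding feas_def
  proof (intro conjI allI impI)
    fix k assume k: "k < r"
    have "(\<Sum>j<T. a1 k j * z (i, j)) = (\<Sum>j<t. A $$ (k, j) * z (i, j))" if "i < n" for i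
      using row_top[OF k] slack[OF that, of "t + k"] k T_def by simp
    then show "(\<Sum>i<n. \<Sum>j<t. A $$ (k, j) * z (i, j)) = bt k" using top[OF k] by simp
  next
    fix i k assume "i < n" and k: "k < s"
    then show "(\<Sum>j<t. A $$ (r + k, j) * z (i, j)) = bb (i, k)"
      using row_bottom[OF k, of "\<lambda>j. z (i, j)"] slack[of i "t + r + k"] bot[of k i] T_def by simp
  qed (use bounds in auto)
  have M: "1 \<le> ?M"
  proof -
    have "0 \<le> (\<Sum>i<n. \<Sum>j<t. w (i, j) * w (i, j) * (u (i, j) - l (i, j)))"
      using lu by (auto intro!: sum_nonneg mult_nonneg_nonneg[OF zero_le_square])
    then show ?thesis by (simp add: big_def)
  qed
  have slack_cost: "?c (i, j) * z (i, j) = ?M * \<bar>z (i, j)\<bar>" if "i < n" "j \<in> {t..<T}" for i j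
  proof (cases "z0 bt bb l (i, j) \<le> 0")
    case True
    then have "z (i, j) \<le> 0" using ub[of i j True] that by (simp add: U0_def)
    then show ?thesis using True that by (simp add: c0_def)
  next
    case False
    then have "0 \<le> z (i, j)" using ub[of i j False] that by (simp add: U0_def)
    then show ?thesis using False that by (simp add: c0_def)
  qed
  have cost_z: "cost ?G ?c z = (\<Sum>i<n. \<Sum>j<t. w (i, j) * z (i, j)) + ?M * (\<Sum>i<n. \<Sum>j\<in>{t..<T}. \<bar>z (i, j)\<bar>)"
  proof -
    have "(\<Sum>j<T. ?c (i, j) * z (i, j)) = (\<Sum>j<t. w (i, j) * z (i, j)) + ?M * (\<Sum>j\<in>{t..<T}. \<bar>z (i, j)\<bar>)"
      if "i < n" for i
    proof -
      have "(\<Sum>j<t. ?c (i, j) * z (i, j)) = (\<Sum>j<t. w (i, j) * z (i, j))"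
        by (rule sum.cong) (auto simp: c0_def)
      moreover have "(\<Sum>j\<in>{t..<T}. ?c (i, j) * z (i, j)) = ?M * (\<Sum>j\<in>{t..<T}. \<bar>z (i, j)\<bar>)"
        using slack_cost[OF that] by (simp add: sum_distrib_left)
      ultimately show ?thesis unfolding sum_columns by simp
    qed
    then show ?thesis unfolding cost_grid by (simp add: sum.distrib sum_distrib_left)
  qed
  have main: "cost ?G ?c z \<le> (\<Sum>i<n. \<Sum>j<t. w (i, j) * x (i, j))" if fx: "feas n bt bb l u x" for x
  proof -
    \<comment> \<open>The competitor with slacks 0; it lies in the box because the interval of each
      slack contains 0.\<close>
    define zx where "zx = (\<lambda>(i, j). if j < t then x (i, j) else 0)"
    define h where "h p = (if p \<in> ?G then zx p - z p else 0)" for p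
    have h: "h (i, j) = zx (i, j) - z (i, j)" if "i < n" "j < T" for i j using that by (simp add: h_def)
    have zt: "(\<Sum>j<t. f j * zx (i, j)) = (\<Sum>j<t. f j * x (i, j))" for f i
      by (rule sum.cong) (auto simp: zx_def)
    have "h \<in> ker n" unfolding nfold_kernel_def
    proof (intro CollectI conjI allI impI)
      fix k assume k: "k < r"
      have "(\<Sum>i<n. \<Sum>j<T. a1 k j * h (i, j)) =
          (\<Sum>i<n. \<Sum>j<T. a1 k j * zx (i, j)) - (\<Sum>i<n. \<Sum>j<T. a1 k j * z (i, j))"
        by (simp add: h right_diff_distrib sum_subtractf)
      also have "(\<Sum>i<n. \<Sum>j<T. a1 k j * zx (i, j)) = bt k"
        unfolding row_top[OF k] zt using fx k by (simp add: feas_def zx_def)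
      finally show "(\<Sum>i<n. \<Sum>j<T. a1 k j * h (i, j)) = 0" using top[OF k] by simp
    next
      fix i k assume i: "i < n" and k: "k < s"
      have "(\<Sum>j<T. a2 k j * h (i, j)) = (\<Sum>j<T. a2 k j * zx (i, j)) - (\<Sum>j<T. a2 k j * z (i, j))"
        using i by (simp add: h right_diff_distrib sum_subtractf)
      also have "(\<Sum>j<T. a2 k j * zx (i, j)) = bb (i, k)"
        unfolding row_bottom[OF k] zt using fx k i by (simp add: feas_def zx_def)
      finally show "(\<Sum>j<T. a2 k j * h (i, j)) = 0" using bot[OF k i] by simp
    qed (simp add: h_def)
    moreover have "in_box ?G ?U (shift z 1 h)" unfolding in_box_def
    proof (intro ballI allI)
      fix p \<sigma> assume p: "p \<in> ?G"
      obtain i j where ij: "p = (i, j)" "i < n" "j < T" using p by auto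
      have "z p + 1 * h p = zx p" using p by (simp add: h_def)
      moreover have "sg \<sigma> * zx (i, j) \<le> ?U \<sigma> (i, j)"
        using fx ij by (cases \<sigma>) (auto simp: feas_def zx_def U0_def)
      ultimately show "sg \<sigma> * (z p + 1 * h p) \<le> ?U \<sigma> p" using ij by simp
    qed
    ultimately have "0 \<le> cost ?G ?c h" using opt by (simp add: opt_def)
    also have "cost ?G ?c h = cost ?G ?c zx - cost ?G ?c z"
      unfolding cost_def by (simp add: h_def right_diff_distrib sum_subtractf)
    also have "cost ?G ?c zx = (\<Sum>i<n. \<Sum>j<t. w (i, j) * x (i, j))"
      unfolding cost_grid sum_columns by (simp add: zx_def c0_def)
    finally show ?thesis by simp
  qed
  show "(\<Sum>i<n. \<Sum>j<t. w (i, j) * z (i, j)) \<le> (\<Sum>i<n. \<Sum>j<t. w (i, j) * x (i, j))"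
    if "\<And>i j. i < n \<Longrightarrow> j \<in> {t..<T} \<Longrightarrow> z (i, j) = 0" "feas n bt bb l u x"
    using main[OF that(2)] that(1) unfolding cost_z by simp
  show "\<not> feas n bt bb l u x" if i0: "i0 < n" and j0: "j0 \<in> {t..<T}" and nz: "z (i0, j0) \<noteq> 0"
  proof
    assume fx: "feas n bt bb l u x"
    have "\<bar>z (i0, j0)\<bar> \<le> (\<Sum>j\<in>{t..<T}. \<bar>z (i0, j)\<bar>)" using j0 by (intro member_le_sum) auto
    also have "\<dots> \<le> (\<Sum>i<n. \<Sum>j\<in>{t..<T}. \<bar>z (i, j)\<bar>)"
      using i0 by (intro member_le_sum[of i0 "{..<n}" "\<lambda>i. \<Sum>j\<in>{t..<T}. \<bar>z (i, j)\<bar>"] sum_nonneg) auto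
    finally have "1 \<le> (\<Sum>i<n. \<Sum>j\<in>{t..<T}. \<bar>z (i, j)\<bar>)" using nz by linarith
    then have "?M * 1 \<le> ?M * (\<Sum>i<n. \<Sum>j\<in>{t..<T}. \<bar>z (i, j)\<bar>)" using M by (intro mult_left_mono) auto
    then have "(\<Sum>i<n. \<Sum>j<t. w (i, j) * z (i, j)) + ?M \<le> (\<Sum>i<n. \<Sum>j<t. w (i, j) * x (i, j))"
      using main[OF fx] unfolding cost_z by linarith
    \<comment> \<open>Both points lie between \<open>l\<close> and \<open>u\<close>, so the
      objectives differ by less than \<open>big\<close>; the contradiction is with a difference of
      at least \<open>big\<close>.\<close>
    moreover have "(\<Sum>i<n. \<Sum>j<t. w (i, j) * x (i, j)) - (\<Sum>i<n. \<Sum>j<t. w (i, j) * z (i, j)) \<le> ?M - 1"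
    proof -
      have "w (i, j) * x (i, j) - w (i, j) * z (i, j) \<le> w (i, j) * w (i, j) * (u (i, j) - l (i, j))"
        if ij: "i < n" "j < t" for i j
      proof -
        have "\<bar>x (i, j) - z (i, j)\<bar> \<le> u (i, j) - l (i, j)"
          using fx bounds[OF ij] ij unfolding feas_def by (smt (verit, best))
        then have "\<bar>w (i, j)\<bar> * \<bar>x (i, j) - z (i, j)\<bar> \<le> \<bar>w (i, j)\<bar> * (u (i, j) - l (i, j))"
          by (intro mult_left_mono) auto
        also have "\<dots> \<le> (w (i, j) * w (i, j)) * (u (i, j) - l (i, j))"
        proof (rule mult_right_mono)
          show "\<bar>w (i, j)\<bar> \<le> w (i, j) * w (i, j)"
            using mult_right_mono[of 1 "\<bar>w (i, j)\<bar>" "\<bar>w (i, j)\<bar>"] by (cases "w (i, j) = 0") (auto simp flip: abs_mult)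
          show "0 \<le> u (i, j) - l (i, j)" using lu[OF ij] by simp
        qed
        finally have "\<bar>w (i, j) * (x (i, j) - z (i, j))\<bar> \<le> w (i, j) * w (i, j) * (u (i, j) - l (i, j))"
          by (simp only: abs_mult)
        moreover have "w (i, j) * x (i, j) - w (i, j) * z (i, j) = w (i, j) * (x (i, j) - z (i, j))"
          by (simp only: right_diff_distrib)
        ultimately show ?thesis by linarith
      qed
      then have "(\<Sum>i<n. \<Sum>j<t. w (i, j) * x (i, j) - w (i, j) * z (i, j)) \<le>
          (\<Sum>i<n. \<Sum>j<t. w (i, j) * w (i, j) * (u (i, j) - l (i, j)))"
        by (intro sum_mono) auto
      then show ?thesis by (simp add: big_def sum_subtractf)
    qed
    ultimately show False by linarith
  qed
qed

text \<open>In an original column the width is at most \<open>2 * L\<close>. In a slack column it is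
  the absolute value of the starting slack, a right-hand side minus a row of \<open>A\<close>
  applied to lower bounds; one sum over all rows serves every column.\<close>

lemma range_bound:
  assumes L: "\<And>i j. i < n \<Longrightarrow> j < t \<Longrightarrow> \<bar>l (i, j)\<bar> \<le> L \<and> \<bar>u (i, j)\<bar> \<le> L"
    "\<And>k. k < r \<Longrightarrow> \<bar>bt k\<bar> \<le> L" "\<And>i k. i < n \<Longrightarrow> k < s \<Longrightarrow> \<bar>bb (i, k)\<bar> \<le> L" and L0: "0 \<le> L"
    and i: "i < n" and j: "j < T"
  shows "U0 bt bb l u True (i, j) + U0 bt bb l u False (i, j) \<le>
    (2 + (\<Sum>k<r + s. \<Sum>j<t. \<bar>A $$ (k, j)\<bar>)) * L"
proof -
  let ?\<alpha> = "\<Sum>k<r + s. \<Sum>j<t. \<bar>A $$ (k, j)\<bar>"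
  have \<alpha>: "0 \<le> ?\<alpha>" by (intro sum_nonneg) auto
  show ?thesis
  proof (cases "j < t")
    case True
    then have "U0 bt bb l u True (i, j) + U0 bt bb l u False (i, j) \<le> 2 * L"
      using L(1)[OF i True] by (simp add: U0_def, linarith)
    also have "\<dots> \<le> (2 + ?\<alpha>) * L" using \<alpha> L0 by (intro mult_right_mono) auto
    finally show ?thesis .
  next
    case False
    let ?b = "if j < t + r then (if i = 0 then bt (j - t) else 0) else bb (i, j - (t + r))"
    let ?z = "z0 bt bb l (i, j)"
    have z: "?z = ?b - (\<Sum>j'<t. A $$ (j - t, j') * l (i, j'))" using False by (simp add: z0_def)
    have "\<bar>?b\<bar> \<le> L" using L(2)[of "j - t"] L(3)[OF i, of "j - (t + r)"] L0 False j T_def by auto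
    moreover have "\<bar>\<Sum>j'<t. A $$ (j - t, j') * l (i, j')\<bar> \<le> ?\<alpha> * L"
    proof -
      have "\<bar>\<Sum>j'<t. A $$ (j - t, j') * l (i, j')\<bar> \<le> (\<Sum>j'<t. \<bar>A $$ (j - t, j') * l (i, j')\<bar>)" by (rule sum_abs)
      also have "\<dots> \<le> (\<Sum>j'<t. \<bar>A $$ (j - t, j')\<bar> * L)"
        using L(1)[OF i] by (auto simp: abs_mult intro!: sum_mono mult_left_mono)
      also have "\<dots> = (\<Sum>j'<t. \<bar>A $$ (j - t, j')\<bar>) * L" by (simp add: sum_distrib_right)
      also have "\<dots> \<le> ?\<alpha> * L"
        using False j T_def L0 by (intro mult_right_mono member_le_sum[of "j - t" "{..<r + s}" "\<lambda>k. \<Sum>j<t. \<bar>A $$ (k, j)\<bar>"] sum_nonneg) auto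
      finally show ?thesis .
    qed
    ultimately have "\<bar>?z\<bar> \<le> L + ?\<alpha> * L" using z by linarith
    moreover have "U0 bt bb l u True (i, j) + U0 bt bb l u False (i, j) = \<bar>?z\<bar>"
      using False by (simp add: U0_def max_def)
    ultimately show ?thesis using L0 by (simp add: distrib_right)
  qed
qed

text \<open>The step length exceeds every width of the box, so the zero direction is the only
  feasible one. No property of the cost enters.\<close>

lemma initial_opt:
  assumes n: "1 \<le> n" and lu: "\<And>i j. i < n \<Longrightarrow> j < t \<Longrightarrow> l (i, j) \<le> u (i, j)"
    and \<Delta>: "0 < \<Delta>" "\<And>i j. i < n \<Longrightarrow> j < T \<Longrightarrow> U0 bt bb l u True (i, j) + U0 bt bb l u False (i, j) < \<Delta>"
  shows "opt n (U0 bt bb l u) c \<Delta> (z0 bt bb l)"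
  unfolding opt_def
proof (intro conjI ballI impI)
  let ?G = "grid n T" and ?U = "U0 bt bb l u" and ?z = "z0 bt bb l"
  show "in_box ?G ?U ?z" unfolding in_box_def
  proof (intro ballI allI)
    fix p \<sigma> assume "p \<in> ?G"
    then obtain i j where "p = (i, j)" "i < n" "j < T" by auto
    then show "sg \<sigma> * ?z p \<le> ?U \<sigma> p" using lu[of i j] by (cases \<sigma>; cases "j < t") (auto simp: U0_def z0_def)
  qed
  then have b0: "sg \<sigma> * ?z p \<le> ?U \<sigma> p" if "p \<in> ?G" for p \<sigma> using that unfolding in_box_def by blast
  fix h assume "in_box ?G ?U (shift ?z \<Delta> h)"
  then have b1: "sg \<sigma> * (?z p + \<Delta> * h p) \<le> ?U \<sigma> p" if "p \<in> ?G" for p \<sigma> using that unfolding in_box_def by blast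
  have "h p = 0" if p: "p \<in> ?G" for p
  proof -
    obtain i j where ij: "p = (i, j)" "i < n" "j < T" using p by auto
    have "\<bar>\<Delta> * h p\<bar> < \<Delta>"
      using b0[OF p, of True] b0[OF p, of False] b1[OF p, of True] b1[OF p, of False] \<Delta>(2)[OF ij(2,3)] ij(1)
      by (simp add: distrib_left)
    then have "\<Delta> * \<bar>h p\<bar> < \<Delta> * 1" using \<Delta>(1) by (simp add: abs_mult)
    then show ?thesis using \<Delta>(1) by (simp only: mult_less_cancel_left) auto
  qed
  then show "0 \<le> cost ?G c h" unfolding cost_def by (simp add: sum.neutral)
qed


section \<open>The solver\<close>

definition finish :: hprog where
  "finish = HSeq check_slack write_out"

text \<open>A sum of everything that the record size has to dominate: the widths of the four
  programs, the codes of the globals read by the outer program, and the number of input cells per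
  brick, so that the input ends below \<open>W * n\<close>.\<close>

definition W :: nat where
  "W = width init + width double + width phase + width finish +
     to_nat Flag + to_nat Scale + to_nat Range + 3 * t + r + s + 3"

text \<open>The two while loops first double the scale until it exceeds the range and then run
  phases until it falls below 1. Cell 0 holds \<open>n\<close> as long as compiled code runs and
  receives the verdict only in the final step.\<close>

definition solver :: program where
  "solver = Seq (compile W init) (Seq (If_Le (Const 1) (comp_exp W (glob Flag))
     (Seq (While_Le (comp_exp W (glob Scale)) (comp_exp W (glob Range)) (compile W double))
     (Seq (While_Le (comp_exp W (HConst 1)) (comp_exp W (glob Scale)) (compile W phase))
       (compile W finish))) Skip) (Store (Const 0) (comp_exp W (glob Flag))))"

lemma scoped_augment: "d = D \<Longrightarrow> scoped D (augment d)"
  by (auto simp: augment_def dp_def dp_state_def try_edge_def forward_def take_edge_def cand_def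
      brick_cost_def brick_guards_def switch_simps)

lemma scoped_phase: "scoped 0 phase"
  by (auto simp: phase_def reset_def sweep_def relax_def scoped_augment)

lemma scoped_row_value:
  "scoped_exp D (row_value f k) \<longleftrightarrow> (\<forall>j<t. scoped_loc D (f j))"
  by (auto simp: row_value_def)

lemma scoped_init: "scoped 0 init"
  by (auto simp: init_def init_pos_def start_pos_def scoped_row_value l_in_def l_in0_def b_top_def
      b_bottom_def check_bounds_def u_in_def init_weight_def w_in_def init_upper_def init_lower_def
      init_cost_def choose_sign_def init_range_def init_penalty_def init_final_def)

lemma scoped_finish: "scoped 0 finish"
  by (auto simp: finish_def check_slack_def write_out_def)

lemma degree_augment: "degree (augment d) \<le> 1"
proof -
  have "degree (dp d) \<le> 1"
    by (simp add: dp_def dp_state_def try_edge_def)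
  moreover have "degree (forward d) \<le> 1"
    by (simp add: forward_def take_edge_def)
  ultimately show ?thesis by (simp add: augment_def)
qed

lemma degree_phase: "degree phase \<le> 3"
proof -
  have "degree sweep \<le> 2" unfolding sweep_def
    using degree_augment[of 2] by (intro degree_seqs_le) (auto simp: relax_def)
  moreover have "degree reset \<le> 1"
    by (auto simp: reset_def)
  moreover have "degree (seqs (map (\<lambda>_. HUp 0 sweep) [0..<T * nat C])) \<le> 3"
    using calculation(1) by (intro degree_seqs_le) auto
  ultimately show ?thesis by (simp add: phase_def)
qed

lemma degree_init: "degree init \<le> 1"
  unfolding init_def
  by (rule degree_seqs_le) (auto simp: init_pos_def check_bounds_def init_weight_def init_upper_def
      init_lower_def init_cost_def choose_sign_def init_range_def init_penalty_def init_final_def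
      intro!: degree_seqs_le)

lemma degree_finish: "degree finish \<le> 1"
  by (simp add: finish_def check_slack_def write_out_def)

lemma flag_frame: "Flag \<notin> wfields phase"
  by (auto simp: phase_def reset_def sweep_def relax_def augment_def dp_def dp_state_def try_edge_def
      forward_def take_edge_def switch_simps split: if_splits)

lemma steps_cubic:
  assumes "degree p \<le> 3"
  shows "\<exists>K. \<forall>n\<ge>1. steps W n p \<le> K * n ^ 3"
proof -
  obtain K where K: "\<forall>n\<ge>1. steps W n p \<le> K * n ^ degree p" using steps_poly by blast
  have "steps W n p \<le> K * n ^ 3" if n: "1 \<le> n" for n
  proof -
    have "K * n ^ degree p \<le> K * n ^ 3" using n assms by (intro mult_left_mono power_increasing) auto
    then show ?thesis using K n by (meson le_trans)
  qed
  then show ?thesis by blast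
qed

lemma ker_scale: "y \<in> ker n \<Longrightarrow> (\<lambda>p. \<Delta> * y p) \<in> ker n"
proof -
  have 1: "(\<Sum>j<T. f j * (\<Delta> * x j)) = \<Delta> * (\<Sum>j<T. f j * x j)" for f x :: "nat \<Rightarrow> int"
    by (simp add: sum_distrib_left mult.left_commute)
  have 2: "(\<Sum>i<n. \<Delta> * f i) = \<Delta> * (\<Sum>i<n. f i)" for f :: "nat \<Rightarrow> int"
    by (simp add: sum_distrib_left)
  assume "y \<in> ker n"
  then show ?thesis unfolding nfold_kernel_def mem_Collect_eq 1 2 by auto
qed

lemma double_iterate:
  "m (Glob Scale) = 1 \<Longrightarrow> (run n double \<iota> ^^ k) m = m(Glob Scale := 2 ^ k)"
  by (induction k) (auto simp: double_def fun_eq_iff)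

text \<open>The scale is always half the step length at which the current point is known to be
  optimal. After \<open>K + 1\<close> phases that step length is 1 and the scale is 1/2, hence the
  quotient of reals.\<close>

lemma phases_spec:
  assumes rep: "state_rep n m z U B c (2 ^ K)" and opt: "opt n U c (2 ^ (K + 1)) z" and "k \<le> K + 1"
  shows "\<exists>y\<in>ker n. \<exists>B. state_rep n ((run n phase \<iota> ^^ k) m) (\<lambda>p. z p + y p) U B c (2 ^ K / 2 ^ k) \<and>
    opt n U c (2 ^ (K + 1 - k)) (\<lambda>p. z p + y p)"
  using assms(3)
proof (induction k)
  case 0
  show ?case using rep opt generated.zero[OF ker_generated]
    by (intro bexI[of _ "\<lambda>_. 0"] exI[of _ B]) simp_all
next
  case (Suc k)
  then obtain y B where y: "y \<in> ker n"
    and rep: "state_rep n ((run n phase \<iota> ^^ k) m) (\<lambda>p. z p + y p) U B c (2 ^ K / 2 ^ k)"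
    and opt: "opt n U c (2 ^ (K + 1 - k)) (\<lambda>p. z p + y p)" by auto
  define \<Delta> :: int where "\<Delta> = 2 ^ (K - k)"
  have k: "k \<le> K" using Suc.prems by simp
  have \<Delta>: "(2 :: real) ^ K / 2 ^ k = of_int \<Delta>" "(2 :: int) ^ (K + 1 - k) = 2 * \<Delta>"
  proof -
    have "(2 :: real) ^ K / 2 ^ k = 2 ^ (K - k)" using k by (simp add: power_diff)
    then show "(2 :: real) ^ K / 2 ^ k = of_int \<Delta>" by (simp add: \<Delta>_def)
    show "(2 :: int) ^ (K + 1 - k) = 2 * \<Delta>" using k by (simp add: \<Delta>_def Suc_diff_le)
  qed
  have \<Delta>_pos: "0 < \<Delta>" by (simp add: \<Delta>_def)
  obtain x B' where x: "x \<in> ker n"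
    and rep': "state_rep n (run n phase \<iota> ((run n phase \<iota> ^^ k) m)) (shift (\<lambda>p. z p + y p) \<Delta> x) U B' c (of_int \<Delta> / 2)"
    and opt': "opt n U c \<Delta> (shift (\<lambda>p. z p + y p) \<Delta> x)"
    using phase_spec[OF rep[unfolded \<Delta>(1)] opt[unfolded \<Delta>(2)] \<Delta>_pos, where \<iota> = \<iota>] by blast
  have eq: "shift (\<lambda>p. z p + y p) \<Delta> x = (\<lambda>p. z p + (y p + \<Delta> * x p))" by (simp add: add.assoc)
  have yx: "(\<lambda>p. y p + \<Delta> * x p) \<in> ker n"
    using generated.add[OF ker_generated y ker_scale[OF x]] .
  have half: "of_int \<Delta> / 2 = (2 :: real) ^ K / 2 ^ Suc k" using \<Delta>(1) by simp
  have \<Delta>_eq: "2 ^ (K + 1 - Suc k) = \<Delta>" by (simp add: \<Delta>_def)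
  show ?case unfolding \<Delta>_eq funpow.simps comp_def
    by (rule bexI[OF _ yx], rule conjI[THEN exI[of _ B']]) (rule rep'[unfolded eq half] opt'[unfolded eq])+
qed

lemma store_zero:
  assumes "1 \<le> n" "coupled W n 0 \<iota> m M"
  shows "exec (Store (Const 0) (comp_exp W (glob Flag))) M (arith_ops (comp_exp W (glob Flag))) (M(0 := m (Glob Flag)))"
proof -
  have e: "val (comp_exp W (glob Flag)) M = m (Glob Flag)" "well_defined (comp_exp W (glob Flag)) M"
    using exp_val[OF assms, of "glob Flag"] by (simp_all add: W_def)
  have "address 0 = 0" using address_of_nat[of 0] by simp
  then show ?thesis
    using exec.Store[of "Const 0" M "comp_exp W (glob Flag)"] e by simp
qed

text \<open>\<open>N\<close> is the binary logarithm of a bound on all widths; the constant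
  \<open>C1\<close> is fixed before it and before \<open>n\<close>.\<close>

lemma solver_exec:
  "\<exists>C1. \<forall>n \<iota> m M w bt bb l u N. 1 \<le> n \<longrightarrow> coupled W n 0 \<iota> m M \<longrightarrow> inputs n m w bt bb l u \<longrightarrow>
     (\<forall>i \<sigma> j. m (Brick i (Box \<sigma> j)) = 0) \<longrightarrow>
     (\<forall>i<n. \<forall>j<T. U0 bt bb l u True (i, j) + U0 bt bb l u False (i, j) \<le> 2 ^ N) \<longrightarrow>
     (\<exists>Tm M'. exec solver M Tm M' \<and> Tm \<le> C1 * ((N + 1) * n ^ 3) \<and>
       (M' 0 = 1 \<and> (\<exists>z. feas n bt bb l u z \<and> (\<forall>x. feas n bt bb l u x \<longrightarrow>
            (\<Sum>i<n. \<Sum>j<t. w (i, j) * z (i, j)) \<le> (\<Sum>i<n. \<Sum>j<t. w (i, j) * x (i, j))) \<and>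
          (\<forall>i<n. \<forall>j<t. M' (1 + (j + t * i)) = of_int (z (i, j)))) \<or>
        M' 0 = 0 \<and> (\<forall>x. \<not> feas n bt bb l u x)))"
proof -
  obtain K1 where K1: "\<forall>n\<ge>1. steps W n init \<le> K1 * n ^ 3" using steps_cubic[of init] degree_init by auto
  obtain K2 where K2: "\<forall>n\<ge>1. steps W n double \<le> K2 * n ^ 3" using steps_cubic[of double] by (auto simp: double_def)
  obtain K3 where K3: "\<forall>n\<ge>1. steps W n phase \<le> K3 * n ^ 3" using steps_cubic[of phase] degree_phase by auto
  obtain K4 where K4: "\<forall>n\<ge>1. steps W n finish \<le> K4 * n ^ 3" using steps_cubic[of finish] degree_finish by auto
  define e1 where "e1 = arith_ops (Const 1) + arith_ops (comp_exp W (glob Flag)) + 1"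
  define e2 where "e2 = arith_ops (comp_exp W (glob Scale)) + arith_ops (comp_exp W (glob Range)) + 1"
  define e3 where "e3 = arith_ops (comp_exp W (HConst 1)) + arith_ops (comp_exp W (glob Scale)) + 1"
  define e4 where "e4 = arith_ops (comp_exp W (glob Flag))"
  \<comment> \<open>With \<open>K \<le> N + 1\<close> doublings and \<open>K + 1\<close> phases, and
    one failing test for each loop, the factors are \<open>K + 1 \<le> 2 * (N + 1)\<close> and
    \<open>K + 2 \<le> 3 * (N + 1)\<close>.\<close>
  define C1 where "C1 = K1 + e1 + 2 * (K2 + e2) + 3 * (K3 + e3) + K4 + e4"
  have time: "Ti + (e1 + (Td + (Tp + To))) + e4 \<le> C1 * ((N + 1) * n ^ 3)"
    if n: "1 \<le> n" and K: "K \<le> N + 1" and Ti: "Ti \<le> steps W n init"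
      and Td: "Td \<le> (K + 1) * (steps W n double + e2)"
      and Tp: "Tp \<le> (K + 1 + 1) * (steps W n phase + e3)" and To: "To \<le> steps W n finish"
    for n K N Ti Td Tp To
  proof -
    define q where "q = n ^ 3"
    define pq where "pq = (N + 1) * q"
    have q: "1 \<le> q" using n by (simp add: q_def)
    have qpq: "q \<le> pq" by (simp add: pq_def)
    have le: "X \<le> X * pq" for X :: nat using q qpq by simp
    have leq: "X * q \<le> X * pq" for X :: nat using qpq by simp
    have lin: "X * q + e \<le> (X + e) * q" for X e :: nat using q by (simp add: distrib_right)
    have "Ti \<le> K1 * pq" using Ti K1 n leq[of K1] unfolding q_def by (meson le_trans)
    moreover have "To \<le> K4 * pq" using To K4 n leq[of K4] unfolding q_def by (meson le_trans)
    moreover have "Td \<le> (2 * (K2 + e2)) * pq"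
    proof -
      have "steps W n double + e2 \<le> K2 * q + e2" using K2 n by (simp add: q_def)
      also have "\<dots> \<le> (K2 + e2) * q" by (rule lin)
      finally have "(K + 1) * (steps W n double + e2) \<le> (2 * (N + 1)) * ((K2 + e2) * q)"
        using K by (intro mult_mono) auto
      also have "\<dots> = (2 * (K2 + e2)) * pq" by (simp only: pq_def mult_ac)
      finally show ?thesis using Td by linarith
    qed
    moreover have "Tp \<le> (3 * (K3 + e3)) * pq"
    proof -
      have "steps W n phase + e3 \<le> K3 * q + e3" using K3 n by (simp add: q_def)
      also have "\<dots> \<le> (K3 + e3) * q" by (rule lin)
      finally have "(K + 1 + 1) * (steps W n phase + e3) \<le> (3 * (N + 1)) * ((K3 + e3) * q)"
        using K by (intro mult_mono) auto
      also have "\<dots> = (3 * (K3 + e3)) * pq" by (simp only: pq_def mult_ac)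
      finally show ?thesis using Tp by linarith
    qed
    moreover have "C1 * pq = K1 * pq + e1 * pq + (2 * (K2 + e2)) * pq + (3 * (K3 + e3)) * pq + K4 * pq + e4 * pq"
      by (simp only: C1_def distrib_right)
    ultimately have "Ti + (e1 + (Td + (Tp + To))) + e4 \<le> C1 * pq"
      using le[of e1] le[of e4] by linarith
    then show ?thesis by (simp add: pq_def q_def)
  qed
  have "\<exists>Tm M'. exec solver M Tm M' \<and> Tm \<le> C1 * ((N + 1) * n ^ 3) \<and>
       (M' 0 = 1 \<and> (\<exists>z. feas n bt bb l u z \<and> (\<forall>x. feas n bt bb l u x \<longrightarrow>
            (\<Sum>i<n. \<Sum>j<t. w (i, j) * z (i, j)) \<le> (\<Sum>i<n. \<Sum>j<t. w (i, j) * x (i, j))) \<and>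
          (\<forall>i<n. \<forall>j<t. M' (1 + (j + t * i)) = of_int (z (i, j)))) \<or>
        M' 0 = 0 \<and> (\<forall>x. \<not> feas n bt bb l u x))"
    if n: "1 \<le> n" and cp: "coupled W n 0 \<iota> m M" and inp: "inputs n m w bt bb l u"
      and zero: "\<forall>i \<sigma> j. m (Brick i (Box \<sigma> j)) = 0"
      and range: "\<forall>i<n. \<forall>j<T. U0 bt bb l u True (i, j) + U0 bt bb l u False (i, j) \<le> 2 ^ N"
    for n \<iota> m M w bt bb l u N
  proof -
    let ?U = "U0 bt bb l u" and ?Z = "z0 bt bb l" and ?c = "c0 n w bt bb l u"
    have wd: "width init \<le> W" "width double \<le> W" "width phase \<le> W" "width finish \<le> W"
      "width_exp (glob Flag) \<le> W" "width_exp (glob Scale) \<le> W" "width_exp (glob Range) \<le> W" "t < W"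
      by (simp_all add: W_def)
    define m1 where "m1 = run n init \<iota> m"
    note init = init_spec[OF inp zero[rule_format], where \<iota> = \<iota>, folded m1_def]
    obtain Ti M1 where ex1: "exec (compile W init) M Ti M1" "Ti \<le> steps W n init" "coupled W n 0 \<iota> m1 M1"
      using exec_compile[OF n cp scoped_init wd(1)] by (auto simp: m1_def)
    have flag1: "val (comp_exp W (glob Flag)) M1 = m1 (Glob Flag)" "well_defined (comp_exp W (glob Flag)) M1"
      using exp_val[OF n ex1(3), of "glob Flag"] wd by simp_all
    show ?thesis
    proof (cases "\<forall>i<n. \<forall>j<t. l (i, j) \<le> u (i, j)")
      case False
      have f0: "m1 (Glob Flag) = 0" using init(1) False by auto
      have "exec (If_Le (Const 1) (comp_exp W (glob Flag))
          (Seq (While_Le (comp_exp W (glob Scale)) (comp_exp W (glob Range)) (compile W double))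
          (Seq (While_Le (comp_exp W (HConst 1)) (comp_exp W (glob Scale)) (compile W phase))
            (compile W finish))) Skip) M1
          (arith_ops (Const 1) + arith_ops (comp_exp W (glob Flag)) + 1 + 0) M1"
        by (rule exec.If_False) (use flag1 f0 exec.Skip in auto)
      note ex = exec.Seq[OF ex1(1) exec.Seq[OF this store_zero[OF n ex1(3)]], folded solver_def]
      have "\<not> feas n bt bb l u x" for x
      proof
        assume "feas n bt bb l u x"
        then have "l (i, j) \<le> u (i, j)" if "i < n" "j < t" for i j
          using that unfolding feas_def by (meson order_trans)
        then show False using False by blast
      qed
      moreover have "Ti + (arith_ops (Const 1) + arith_ops (comp_exp W (glob Flag)) + 1 + 0 +
          arith_ops (comp_exp W (glob Flag))) \<le> C1 * ((N + 1) * n ^ 3)"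
        using time[OF n, of 0 N Ti 0 0 0] ex1(2) by (simp add: e1_def e4_def)
      ultimately show ?thesis using ex f0 by (intro exI conjI) (assumption | simp)+
    next
      case lu: True
      have f1: "m1 (Glob Flag) = 1" using init(1) lu by auto
      have rg: "m1 (Glob Range) \<le> 2 ^ N"
        using range by (intro init(4)) (auto simp flip: of_int_add simp: of_int_le_numeral_power_cancel_iff)
      have scale1: "m1 (Glob Scale) = 1" using init(2) by (simp add: state_rep_def)
      \<comment> \<open>The number of doublings that the first while loop performs, starting from
        scale 1.\<close>
      define K where "K = (LEAST k. m1 (Glob Range) < 2 ^ k)"
      have rgN: "m1 (Glob Range) < 2 ^ (N + 1)"
        using rg by (rule le_less_trans) simp
      have K: "m1 (Glob Range) < 2 ^ K" unfolding K_def using rgN by (rule LeastI)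
      have KN: "K \<le> N + 1" unfolding K_def using rgN by (rule Least_le)
      have notK: "2 ^ k \<le> m1 (Glob Range)" if "k < K" for k
        using not_less_Least[of k "\<lambda>k. m1 (Glob Range) < 2 ^ k"] that unfolding K_def by simp
      note dbl = double_iterate[where m = m1 and n = n and \<iota> = \<iota>, OF scale1]
      define m2 where "m2 = m1(Glob Scale := 2 ^ K)"
      obtain Td M2 where ex2: "exec (While_Le (comp_exp W (glob Scale)) (comp_exp W (glob Range)) (compile W double)) M1 Td M2"
          "Td \<le> (K + 1) * (steps W n double + e2)" "coupled W n 0 \<iota> m2 M2"
        using exec_while[OF n ex1(3) _ wd(2) _ _ _ wd(6,7), of K] notK K
        unfolding dbl by (auto simp: double_def e2_def m2_def)
      have rep2: "state_rep n m2 ?Z ?U (\<lambda>_ _. 0) ?c (2 ^ K)"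
        using init(2) unfolding state_rep_def m2_def by simp
      \<comment> \<open>The exponent is one above that of the scale: the first phase works at step
        length \<open>2 ^ K\<close> and takes optimality at twice this length as its starting
        point.\<close>
      have "?U True (i, j) + ?U False (i, j) < 2 ^ (K + 1)" if "i < n" "j < T" for i j
      proof -
        have "real_of_int (?U True (i, j) + ?U False (i, j)) < 2 ^ K"
          using init(3)[OF that] K by linarith
        also have "\<dots> \<le> 2 ^ (K + 1)" by simp
        finally have "real_of_int (?U True (i, j) + ?U False (i, j)) < real_of_int (2 ^ (K + 1))" by simp
        then show ?thesis by (simp only: of_int_less_iff)
      qed
      then have opt2: "opt n ?U ?c (2 ^ (K + 1)) ?Z"
        using lu by (intro initial_opt[OF n]) auto
      define mk where "mk k = (run n phase \<iota> ^^ k) m2" for k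
      note ph = phases_spec[OF rep2 opt2, where \<iota> = \<iota>, folded mk_def]
      have sc: "mk k (Glob Scale) = 2 ^ K / 2 ^ k" if "k \<le> K + 1" for k
        using ph[OF that] by (auto simp: state_rep_def)
      have c1: "hval n \<iota> (mk k) (HConst 1) \<le> hval n \<iota> (mk k) (glob Scale)" if "k < K + 1" for k
        using sc[of k] that by (simp add: power_increasing)
      have c2: "\<not> hval n \<iota> (mk (K + 1)) (HConst 1) \<le> hval n \<iota> (mk (K + 1)) (glob Scale)"
        using sc[of "K + 1"] by simp
      obtain Tp M3 where ex3: "exec (While_Le (comp_exp W (HConst 1)) (comp_exp W (glob Scale)) (compile W phase)) M2 Tp M3"
          "Tp \<le> (K + 1 + 1) * (steps W n phase + e3)" "coupled W n 0 \<iota> (mk (K + 1)) M3"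
        using exec_while[OF n ex2(3) scoped_phase wd(3) _ _ _ _ wd(6) c1[unfolded mk_def] c2[unfolded mk_def]]
        by (auto simp: e3_def mk_def)
      define m3 where "m3 = mk (K + 1)"
      obtain y B where y: "y \<in> ker n" and rep3: "state_rep n m3 (\<lambda>p. ?Z p + y p) ?U B ?c (2 ^ K / 2 ^ (K + 1))"
        and opt3: "opt n ?U ?c 1 (\<lambda>p. ?Z p + y p)"
        using ph[of "K + 1"] by (auto simp: m3_def)
      define z where "z = (\<lambda>p. ?Z p + y p)"
      have flag3: "m3 (Glob Flag) = 1"
      proof -
        have "mk k (Glob Flag) = 1" for k
          by (induction k) (simp_all add: mk_def m2_def f1 run_frame(1)[OF flag_frame])
        then show ?thesis by (simp add: m3_def)
      qed
      have pos3: "m3 (Brick i (Pos j)) = of_int (z (i, j))" if "i < n" "j < T" for i j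
        using rep3 that by (simp add: state_rep_def z_def)
      define slack where "slack \<longleftrightarrow> (\<forall>i<n. \<forall>j\<in>{t..<T}. z (i, j) = 0)"
      define m4 where "m4 = run n finish \<iota> m3"
      have m4: "m4 = run n write_out \<iota> (m3(Glob Flag := (if slack then 1 else 0)))"
      proof -
        have "(\<forall>i<n. \<forall>j\<in>{t..<T}. m3 (Brick i (Pos j)) = 0) \<longleftrightarrow> slack"
          unfolding slack_def using pos3 by auto
        then show ?thesis unfolding m4_def finish_def run.simps check_slack_spec by (simp only: flag3)
      qed
      have flag4: "m4 (Glob Flag) = (if slack then 1 else 0)" by (simp add: m4 write_out_spec(1))
      have out4: "m4 (Low (1 + (j + t * i))) = of_int (z (i, j))" if "i < n" "j < t" for i j
        using write_out_spec(2)[OF that] pos3[of i j] that T_def by (simp add: m4)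
      obtain To M4 where ex4: "exec (compile W finish) M3 To M4" "To \<le> steps W n finish" "coupled W n 0 \<iota> m4 M4"
        using exec_compile[OF n ex3(3) scoped_finish wd(4)] by (auto simp: m4_def m3_def)
      define M5 where "M5 = M4(0 := m4 (Glob Flag))"
      have ex_if: "exec (If_Le (Const 1) (comp_exp W (glob Flag))
          (Seq (While_Le (comp_exp W (glob Scale)) (comp_exp W (glob Range)) (compile W double))
          (Seq (While_Le (comp_exp W (HConst 1)) (comp_exp W (glob Scale)) (compile W phase))
            (compile W finish))) Skip) M1
          (arith_ops (Const 1) + arith_ops (comp_exp W (glob Flag)) + 1 + (Td + (Tp + To))) M4"
        by (rule exec.If_True[OF _ _ _ exec.Seq[OF ex2(1) exec.Seq[OF ex3(1) ex4(1)]]])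
          (use flag1 f1 in auto)
      note ex = exec.Seq[OF ex1(1) exec.Seq[OF ex_if store_zero[OF n ex4(3)]], folded solver_def M5_def]
      have tm: "Ti + (arith_ops (Const 1) + arith_ops (comp_exp W (glob Flag)) + 1 + (Td + (Tp + To)) +
          arith_ops (comp_exp W (glob Flag))) \<le> C1 * ((N + 1) * n ^ 3)"
        using time[OF n KN ex1(2) ex2(2) ex3(2) ex4(2)] by (simp add: e1_def e4_def)
      have out5: "M5 (1 + (j + t * i)) = of_int (z (i, j))" if ij: "i < n" "j < t" for i j
      proof -
        have "j + t * i < t * Suc i" using ij by simp
        also have "\<dots> \<le> t * n" using ij by (intro mult_le_mono2) simp
        finally have "1 + (j + t * i) < (t + 1) * n + 1" using n by simp
        also have "(t + 1) * n \<le> W * n" using wd(8) by (intro mult_le_mono1) simp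
        finally have "valid W n (Low (1 + (j + t * i)))"
          using \<open>j + t * i < t * Suc i\<close> \<open>t * Suc i \<le> t * n\<close> wd(8) n
          by (simp, intro le_less_trans[of "Suc (j + t * i)" "t * n" "W * n"]) auto
        then have "M4 (addr W n (Low (1 + (j + t * i)))) = m4 (Low (1 + (j + t * i)))"
          using ex4(3) unfolding coupled_def by blast
        then show ?thesis using out4[OF ij] by (simp add: M5_def)
      qed
      note fin = final_correct[OF n _ y z_def opt3[folded z_def]]
      show ?thesis
      proof (cases slack)
        case True
        then have sl: "\<And>i j. i < n \<Longrightarrow> j \<in> {t..<T} \<Longrightarrow> z (i, j) = 0" unfolding slack_def by blast
        have fz: "feas n bt bb l u z" by (rule fin(1)) (use lu sl in auto)
        have best: "(\<Sum>i<n. \<Sum>j<t. w (i, j) * z (i, j)) \<le> (\<Sum>i<n. \<Sum>j<t. w (i, j) * x (i, j))"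
          if "feas n bt bb l u x" for x
          by (rule fin(2)[OF _ _ that]) (use lu sl in auto)
        have "M5 0 = 1" using flag4 True by (simp add: M5_def)
        then show ?thesis using ex tm fz best out5 by blast
      next
        case False
        then obtain i j where "i < n" "j \<in> {t..<T}" "z (i, j) \<noteq> 0" unfolding slack_def by blast
        then have "\<not> feas n bt bb l u x" for x
          by (intro fin(3)) (use lu in auto)
        moreover have "M5 0 = 0" using flag4 False by (simp add: M5_def)
        ultimately show ?thesis using ex tm by blast
      qed
    qed
  qed
  then show ?thesis by blast
qed

end


section \<open>Instantiation for a fixed bimatrix\<close>

text \<open>All tables are finite enumerations obtained from the fixed bimatrix, through the
  constant \<open>C\<close> that serves all \<open>n\<close> at once; they become part of the
  program text.\<close>

lemma nfold_solver_exists: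
  "\<exists>T E S C a1 a2 sts b1. nfold_solver T E S C r s a1 a2 sts b1 t A"
proof -
  define T where "T = t + r + s"
  define a1 where "a1 = (\<lambda>k j. if j < t then A $$ (k, j) else if j = t + k then 1 else 0)"
  define a2 where "a2 = (\<lambda>k j. if j < t then A $$ (r + k, j) else if j = t + r + k then 1 else 0)"
  obtain C where C: "0 \<le> C" "\<forall>n. \<forall>h\<in>nfold_kernel T r s a1 a2 n. \<forall>p. h p \<noteq> 0 \<longrightarrow>
     (\<exists>g\<in>nfold_kernel T r s a1 a2 n. conformal g h \<and> g p \<noteq> 0 \<and> (\<Sum>q\<in>grid n T. \<bar>g q\<bar>) \<le> C)"
    using nfold_bounded_generation[of T r s a1 a2] by (elim exE conjE)
  define b1 where "b1 = (\<Sum>k<r. \<Sum>j<T. \<bar>a1 k j\<bar>)"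
  have b1: "0 \<le> b1" by (auto simp: b1_def intro!: sum_nonneg)
  have a1_b1: "\<bar>a1 k j\<bar> \<le> b1" if "k < r" "j < T" for k j
  proof -
    have "\<bar>a1 k j\<bar> \<le> (\<Sum>j<T. \<bar>a1 k j\<bar>)" using that by (intro member_le_sum) auto
    also have "\<dots> \<le> b1" unfolding b1_def
      using that by (intro member_le_sum[of k "{..<r}" "\<lambda>k. \<Sum>j<T. \<bar>a1 k j\<bar>"] sum_nonneg) auto
    finally show ?thesis .
  qed
  define V where "V = {v \<in> brick_kernel T s a2. \<forall>j. \<bar>v j\<bar> \<le> C}"
  have "finite V"
    by (rule finite_subset[OF _ finite_bounded_funs[of "{..<T}" C]]) (auto simp: V_def brick_kernel_def)
  then obtain vs where vs: "set vs = V" using finite_list by blast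
  define X where "X = {x :: nat \<Rightarrow> int. (\<forall>l. \<bar>x l\<bar> \<le> b1 * C) \<and> (\<forall>l. l \<notin> {..<r} \<longrightarrow> x l = 0)}"
  have "finite X" unfolding X_def by (rule finite_bounded_funs) simp
  then obtain xs' where xs': "set xs' = X" using finite_list by blast
  \<comment> \<open>The zero vector is put in front so that it gets number 0; it occurs again in
    \<open>xs'\<close>.\<close>
  define xs where "xs = (\<lambda>_. 0) # xs'"
  define S where "S = length xs"
  define sts where "sts = (\<lambda>k. xs ! k)"
  define upd where "upd x v = (\<lambda>l. x l + (if l < r then \<Sum>j<T. a1 l j * v j else 0))" for x v :: "nat \<Rightarrow> int"
  \<comment> \<open>The zero brick that stays in the same state is put in front, as the default edge
    of the dynamic program.\<close>
  define E where "E k = (\<lambda>_. 0, k) # concat (map (\<lambda>v. map (Pair v) (filter (\<lambda>k'. sts k' = upd (sts k) v) [0..<S])) vs)" for k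
  have E_set: "(v, k') \<in> set (E k) \<longleftrightarrow> v = (\<lambda>_. 0) \<and> k' = k \<or> v \<in> V \<and> k' < S \<and> sts k' = upd (sts k) v" for v k' k
    by (auto simp: E_def vs)
  have upd0: "upd x (\<lambda>_. 0) = x" for x by (simp add: upd_def cong: if_cong)
  have "nfold_solver T E S C r s a1 a2 sts b1 t A"
  proof
    show "0 < S" by (simp add: S_def xs_def)
    show "E k \<noteq> []" "E k ! 0 = (\<lambda>_. 0, k)" for k by (simp_all add: E_def)
    show "k' < S" if "k < S" "(v, k') \<in> set (E k)" for k v k' using that by (auto simp: E_set)
    show "\<bar>v j\<bar> \<le> C" if "k < S" "(v, k') \<in> set (E k)" for k v k' j using that C(1) by (auto simp: E_set V_def)
    show "0 \<le> C" by (rule C(1))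
    show "\<exists>g\<in>nfold_kernel T r s a1 a2 n. conformal g h \<and> g p \<noteq> 0 \<and> (\<Sum>q\<in>grid n T. \<bar>g q\<bar>) \<le> C"
      if "h \<in> nfold_kernel T r s a1 a2 n" "h p \<noteq> 0" for h n p using C(2) that by blast
    show "0 \<le> b1" by (rule b1)
    show "sts 0 = (\<lambda>_. 0)" by (simp add: sts_def xs_def)
    show "\<bar>a1 k j\<bar> \<le> b1" if "k < r" "j < T" for k j using a1_b1[OF that] .
    show "\<exists>k<S. sts k = x" if "\<And>l. \<bar>x l\<bar> \<le> b1 * C" "\<And>l. r \<le> l \<Longrightarrow> x l = 0" for x
    proof -
      have "x \<in> set xs" using that xs' by (simp add: X_def xs_def)
      then show ?thesis by (simp add: in_set_conv_nth S_def sts_def)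
    qed
    show "v \<in> brick_kernel T s a2 \<and> sts k' = (\<lambda>l. sts k l + (if l < r then \<Sum>j<T. a1 l j * v j else 0))"
      if "k < S" "(v, k') \<in> set (E k)" for k v k'
    proof -
      have "v \<in> brick_kernel T s a2 \<and> sts k' = upd (sts k) v"
        using that by (auto simp: E_set V_def upd0 brick_kernel_def)
      then show ?thesis by (simp only: upd_def)
    qed
    show "(v, k') \<in> set (E k)"
      if "k < S" "k' < S" "v \<in> brick_kernel T s a2" "\<And>j. \<bar>v j\<bar> \<le> C"
        "sts k' = (\<lambda>l. sts k l + (if l < r then \<Sum>j<T. a1 l j * v j else 0))" for k k' v
      unfolding E_set using that by (simp add: V_def upd_def)
    show "T = t + r + s" by (rule T_def)
    show "a1 = (\<lambda>k j. if j < t then A $$ (k, j) else if j = t + k then 1 else 0)" by (rule a1_def)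
    show "a2 = (\<lambda>k j. if j < t then A $$ (r + k, j) else if j = t + r + k then 1 else 0)" by (rule a2_def)
  qed
  then show ?thesis by blast
qed

section \<open>Encoding length and index arithmetic\<close>

lemma abs_less_binary_length: "\<bar>z\<bar> < 2 ^ binary_length z"
proof -
  define k where "k = nat \<lceil>log 2 (real_of_int (\<bar>z\<bar> + 1))\<rceil>"
  have "log 2 (real_of_int (\<bar>z\<bar> + 1)) \<le> real k" unfolding k_def by (rule real_nat_ceiling_ge)
  then have "real_of_int (\<bar>z\<bar> + 1) \<le> 2 powr real k" by (subst (asm) log_le_iff) auto
  also have "\<dots> = real_of_int (2 ^ k)" by (simp add: powr_realpow)
  finally have "\<bar>z\<bar> + 1 \<le> 2 ^ k" by (simp only: of_int_le_iff)
  moreover have "(2 :: int) ^ k \<le> 2 ^ (1 + k)" by simp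
  moreover have "binary_length z = 1 + k" by (simp add: binary_length_def k_def)
  ultimately show ?thesis by simp
qed

lemma abs_entry_le:
  assumes "i < dim_vec v" "binary_length_vec v \<le> L"
  shows "\<bar>v $ i\<bar> \<le> 2 ^ L"
proof -
  have "binary_length (v $ i) \<le> binary_length_vec v"
    unfolding binary_length_vec_def using assms(1) by (intro member_le_sum) auto
  then have "(2 :: int) ^ binary_length (v $ i) \<le> 2 ^ L" using assms(2) by (intro power_increasing) auto
  then show ?thesis using abs_less_binary_length[of "v $ i"] by linarith
qed

text \<open>Each entry contributes at least its sign bit. So the length of a nonempty input is at
  least 1 and can absorb additive constants.\<close>

lemma dim_le_binary_length: "dim_vec v \<le> binary_length_vec v"
proof -
  have "(\<Sum>i<dim_vec v. 1) \<le> binary_length_vec v"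
    unfolding binary_length_vec_def by (intro sum_mono) (simp add: binary_length_def)
  then show ?thesis by simp
qed

lemma sum_blocks: "(\<Sum>c<n * t. f c) = (\<Sum>i<n. \<Sum>j<t. f (j + t * i))" for f :: "nat \<Rightarrow> int" and n t :: nat
proof -
  have "(\<Sum>c\<in>{i * t..<i * t + t}. f c) = (\<Sum>j<t. f (j + t * i))" for i
    using sum.shift_bounds_nat_ivl[of f 0 "i * t" t] by (simp add: atLeast0LessThan mult.commute add.commute)
  then show ?thesis using sum.nat_group[of f t n] by simp
qed

context nfold_solver
begin

lemma nfold_product_top:
  assumes "A \<in> carrier_mat (r + s) t" "x \<in> carrier_vec (n * t)" "k < r"
  shows "(nfold_product r s t A n *\<^sub>v x) $ k = (\<Sum>i<n. \<Sum>j<t. A $$ (k, j) * x $ (j + t * i))"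
proof -
  have "(nfold_product r s t A n *\<^sub>v x) $ k = (\<Sum>c<n * t. nfold_product r s t A n $$ (k, c) * x $ c)"
    using assms by (simp add: nfold_product_def scalar_prod_def atLeast0LessThan)
  also have "\<dots> = (\<Sum>i<n. \<Sum>j<t. A $$ (k, j) * x $ (j + t * i))"
    unfolding sum_blocks
  proof (intro sum.cong refl)
    fix i j assume ij: "i \<in> {..<n}" "j \<in> {..<t}"
    have "j + t * i < n * t"
    proof -
      have "j + t * i < t * Suc i" using ij by simp
      also have "\<dots> \<le> t * n" using ij by (intro mult_le_mono2) simp
      finally show ?thesis by (simp add: mult.commute)
    qed
    then show "nfold_product r s t A n $$ (k, j + t * i) * x $ (j + t * i) = A $$ (k, j) * x $ (j + t * i)"
      using assms ij by (simp add: nfold_product_def upper_block_def)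
  qed
  finally show ?thesis .
qed

lemma nfold_product_bottom:
  assumes "A \<in> carrier_mat (r + s) t" "x \<in> carrier_vec (n * t)" "k < s" "i < n"
  shows "(nfold_product r s t A n *\<^sub>v x) $ (r + (k + s * i)) = (\<Sum>j<t. A $$ (r + k, j) * x $ (j + t * i))"
proof -
  have row: "k + s * i < n * s"
  proof -
    have "k + s * i < s * Suc i" using assms by simp
    also have "\<dots> \<le> s * n" using assms by (intro mult_le_mono2) simp
    finally show ?thesis by (simp add: mult.commute)
  qed
  have "(nfold_product r s t A n *\<^sub>v x) $ (r + (k + s * i)) =
      (\<Sum>c<n * t. nfold_product r s t A n $$ (r + (k + s * i), c) * x $ c)"
    using assms row by (simp add: nfold_product_def scalar_prod_def atLeast0LessThan)
  also have "\<dots> = (\<Sum>i'<n. if i' = i then \<Sum>j<t. A $$ (r + k, j) * x $ (j + t * i) else 0)"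
    unfolding sum_blocks
  proof (intro sum.cong refl)
    fix i' assume i': "i' \<in> {..<n}"
    have "nfold_product r s t A n $$ (r + (k + s * i), j + t * i') = (if i' = i then A $$ (r + k, j) else 0)"
      if j: "j < t" for j
    proof -
      have "j + t * i' < t * Suc i'" using j by simp
      also have "\<dots> \<le> t * n" using i' by (intro mult_le_mono2) simp
      finally have "j + t * i' < n * t" by (simp add: mult.commute)
      then show ?thesis using row assms j by (auto simp: nfold_product_def lower_block_def)
    qed
    then show "(\<Sum>j<t. nfold_product r s t A n $$ (r + (k + s * i), j + t * i') * x $ (j + t * i')) =
        (if i' = i then \<Sum>j<t. A $$ (r + k, j) * x $ (j + t * i) else 0)" by simp
  qed
  also have "\<dots> = (\<Sum>j<t. A $$ (r + k, j) * x $ (j + t * i))" using assms(4) by simp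
  finally show ?thesis .
qed

abbreviation blocks :: "int vec \<Rightarrow> nat \<times> nat \<Rightarrow> int" where
  "blocks v \<equiv> \<lambda>(i, j). v $ (j + t * i)"

abbreviation bottom_blocks :: "int vec \<Rightarrow> nat \<times> nat \<Rightarrow> int" where
  "bottom_blocks b \<equiv> \<lambda>(i, k). b $ (r + (k + s * i))"

lemma block_index: "i < n \<Longrightarrow> j < q \<Longrightarrow> j + q * i < n * q" for q :: nat
proof -
  assume "i < n" "j < q"
  then have "j + q * i < q * Suc i" by simp
  also have "\<dots> \<le> q * n" using \<open>i < n\<close> by (intro mult_le_mono2) simp
  finally show ?thesis by (simp add: mult.commute)
qed

lemma block_cases: "c < n * q \<Longrightarrow> \<exists>i<n. \<exists>j<q. c = j + q * i" for q :: nat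
proof -
  assume c: "c < n * q"
  then have "0 < q" by (cases q) auto
  then have "c div q < n" "c mod q < q" "c = c mod q + q * (c div q)"
    using c by (simp_all add: less_mult_imp_div_less)
  then show ?thesis by blast
qed

lemma nfold_feasible_iff:
  assumes A: "A \<in> carrier_mat (r + s) t" and l: "l \<in> carrier_vec (n * t)" and u: "u \<in> carrier_vec (n * t)"
    and b: "b \<in> carrier_vec (r + n * s)" and x: "x \<in> carrier_vec (n * t)"
  shows "x \<in> nfold_feasible r s t A n b l u \<longleftrightarrow>
    feas n (\<lambda>k. b $ k) (bottom_blocks b) (blocks l) (blocks u) (blocks x)"
proof -
  have eq: "nfold_product r s t A n *\<^sub>v x = b \<longleftrightarrow>
      (\<forall>k<r. (\<Sum>i<n. \<Sum>j<t. A $$ (k, j) * x $ (j + t * i)) = b $ k) \<and>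
      (\<forall>i<n. \<forall>k<s. (\<Sum>j<t. A $$ (r + k, j) * x $ (j + t * i)) = b $ (r + (k + s * i)))" (is "_ \<longleftrightarrow> ?R")
  proof
    assume "nfold_product r s t A n *\<^sub>v x = b"
    then show ?R using nfold_product_top[OF A x] nfold_product_bottom[OF A x] by simp
  next
    assume R: ?R
    show "nfold_product r s t A n *\<^sub>v x = b"
    proof (rule eq_vecI)
      show "dim_vec (nfold_product r s t A n *\<^sub>v x) = dim_vec b" using b by (simp add: nfold_product_def)
      fix c assume "c < dim_vec b"
      then have c: "c < r + n * s" using b by simp
      show "(nfold_product r s t A n *\<^sub>v x) $ c = b $ c"
      proof (cases "c < r")
        case True
        then show ?thesis using R nfold_product_top[OF A x] by simp
      next
        case False
        then have "c - r < n * s" using c by simp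
        from block_cases[OF this] obtain i k where "i < n" "k < s" "c - r = k + s * i" by blast
        then have "i < n" "k < s" "c = r + (k + s * i)" using False by auto
        then show ?thesis using R nfold_product_bottom[OF A x] by simp
      qed
    qed
  qed
  have le: "v \<le> v' \<longleftrightarrow> (\<forall>i<n. \<forall>j<t. v $ (j + t * i) \<le> v' $ (j + t * i))"
    if "v \<in> carrier_vec (n * t)" "v' \<in> carrier_vec (n * t)" for v v' :: "int vec"
  proof
    assume "v \<le> v'"
    then show "\<forall>i<n. \<forall>j<t. v $ (j + t * i) \<le> v' $ (j + t * i)"
      using that block_index[where q = t and n = n] by (simp add: less_eq_vec_def)
  next
    assume R: "\<forall>i<n. \<forall>j<t. v $ (j + t * i) \<le> v' $ (j + t * i)"
    show "v \<le> v'" unfolding less_eq_vec_def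
    proof (intro conjI allI impI)
      show "dim_vec v = dim_vec v'" using that by simp
      fix c assume "c < dim_vec v'"
      then have "c < n * t" using that by simp
      from block_cases[OF this] obtain i j where "i < n" "j < t" "c = j + t * i" by blast
      then show "v $ c \<le> v' $ c" using R by simp
    qed
  qed
  have "x \<in> nfold_feasible r s t A n b l u \<longleftrightarrow> nfold_product r s t A n *\<^sub>v x = b \<and> l \<le> x \<and> x \<le> u"
    using x by (simp add: nfold_feasible_def)
  also have "\<dots> \<longleftrightarrow> feas n (\<lambda>k. b $ k) (bottom_blocks b) (blocks l) (blocks u) (blocks x)"
    unfolding eq le[OF l x] le[OF x u] feas_def prod.case by blast
  finally show ?thesis .
qed

lemma cost_blocks:
  assumes "w \<in> carrier_vec (n * t)" "x \<in> carrier_vec (n * t)"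
  shows "w \<bullet> x = (\<Sum>i<n. \<Sum>j<t. blocks w (i, j) * blocks x (i, j))"
  using assms by (simp add: scalar_prod_def atLeast0LessThan sum_blocks)

section \<open>The input memory as a store\<close>

lemma nfold_input_at:
  assumes "w \<in> carrier_vec (n * t)" "l \<in> carrier_vec (n * t)" "u \<in> carrier_vec (n * t)" "b \<in> carrier_vec (r + n * s)"
  shows "nfold_input n w b l u 0 = real n"
    and "k < n * t \<Longrightarrow> nfold_input n w b l u (1 + k) = of_int (w $ k)"
    and "k < r + n * s \<Longrightarrow> nfold_input n w b l u (1 + n * t + k) = of_int (b $ k)"
    and "k < n * t \<Longrightarrow> nfold_input n w b l u (1 + n * t + (r + n * s) + k) = of_int (l $ k)"
    and "k < n * t \<Longrightarrow> nfold_input n w b l u (1 + n * t + (r + n * s) + n * t + k) = of_int (u $ k)"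
    and "1 + n * t + (r + n * s) + n * t + n * t \<le> a \<Longrightarrow> nfold_input n w b l u a = 0"
proof -
  define xs where "xs = list_of_vec w @ list_of_vec b @ list_of_vec l @ list_of_vec u"
  have dims: "dim_vec w = n * t" "dim_vec b = r + n * s" "dim_vec l = n * t" "dim_vec u = n * t"
    using assms by simp_all
  have len: "length xs = n * t + (r + n * s) + n * t + n * t" by (simp add: xs_def dims)
  have inp: "nfold_input n w b l u a = (if a < Suc (length xs) then of_int ((int n # xs) ! a) else 0)" for a
    by (simp add: nfold_input_def Let_def xs_def)
  have skip: "(ys @ zs) ! (p + k) = zs ! k" if "length ys = p" for ys zs :: "int list" and p k
    using that by (simp add: nth_append)
  show "nfold_input n w b l u 0 = real n" by (simp add: inp)
  show "nfold_input n w b l u (1 + k) = of_int (w $ k)" if "k < n * t" for k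
    using that unfolding inp len by (simp add: xs_def nth_append dims)
  show "nfold_input n w b l u (1 + n * t + k) = of_int (b $ k)" if "k < r + n * s" for k
  proof -
    have "xs ! (n * t + k) = (list_of_vec b @ list_of_vec l @ list_of_vec u) ! k"
      unfolding xs_def by (rule skip) (simp add: dims)
    also have "\<dots> = b $ k" using that by (simp add: nth_append dims)
    finally show ?thesis using that unfolding inp len by simp
  qed
  show "nfold_input n w b l u (1 + n * t + (r + n * s) + k) = of_int (l $ k)" if "k < n * t" for k
  proof -
    have "xs ! (n * t + (r + n * s) + k) = (list_of_vec l @ list_of_vec u) ! k"
      unfolding xs_def append_assoc[symmetric, of _ _ "_ @ _"] by (rule skip) (simp add: dims)
    also have "\<dots> = l $ k" using that by (simp add: nth_append dims)
    finally show ?thesis using that unfolding inp len by simp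
  qed
  show "nfold_input n w b l u (1 + n * t + (r + n * s) + n * t + k) = of_int (u $ k)" if "k < n * t" for k
  proof -
    have "xs ! (n * t + (r + n * s) + n * t + k) = list_of_vec u ! k"
      unfolding xs_def append_assoc[symmetric] by (rule skip) (simp add: dims)
    also have "\<dots> = u $ k" using that by (simp add: dims)
    finally show ?thesis using that unfolding inp len by simp
  qed
  show "nfold_input n w b l u a = 0" if "1 + n * t + (r + n * s) + n * t + n * t \<le> a"
    using that unfolding inp len by simp
qed

definition input_store :: "memory \<Rightarrow> store" where
  "input_store M = (\<lambda>x. case x of Low a \<Rightarrow> M a | _ \<Rightarrow> 0)"

text \<open>The input ends below \<open>W * n\<close>; all cells from there on are 0, which agrees
  with a store whose globals and bricks are 0. No counters are tracked yet.\<close>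

lemma input_coupled:
  assumes "1 \<le> n" "w \<in> carrier_vec (n * t)" "l \<in> carrier_vec (n * t)" "u \<in> carrier_vec (n * t)" "b \<in> carrier_vec (r + n * s)"
  shows "coupled W n 0 \<iota> (input_store (nfold_input n w b l u)) (nfold_input n w b l u)"
proof -
  have len: "1 + n * t + (r + n * s) + n * t + n * t \<le> W * n"
  proof -
    have "1 + n * t + (r + n * s) + n * t + n * t \<le> 1 * n + t * n + (r * n + s * n) + t * n + t * n"
      using assms(1) by (intro add_mono) simp_all
    also have "\<dots> = (1 + t + (r + s) + t + t) * n" by (simp add: distrib_right)
    also have "\<dots> \<le> W * n" by (intro mult_le_mono1) (simp add: W_def)
    finally show ?thesis .
  qed
  have high: "nfold_input n w b l u a = 0" if "W * n \<le> a" for a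
    using nfold_input_at(6)[OF assms(2-5)] len that by simp
  show ?thesis unfolding coupled_def
  proof (intro conjI allI impI)
    show "nfold_input n w b l u 0 = real n" by (rule nfold_input_at(1)[OF assms(2-5)])
    fix x
    have "W * n \<le> W * (n + k) + q" for k q by (rule trans_le_add1, rule mult_le_mono2) simp
    then have "nfold_input n w b l u (W * (n + k) + q) = 0" for k q by (rule high)
    then show "nfold_input n w b l u (addr W n x) = input_store (nfold_input n w b l u) x"
      by (cases x) (simp_all only: addr.simps input_store_def loc.case add.assoc)
  qed simp_all
qed

lemma input_inputs:
  assumes "w \<in> carrier_vec (n * t)" "l \<in> carrier_vec (n * t)" "u \<in> carrier_vec (n * t)" "b \<in> carrier_vec (r + n * s)"
    and n: "1 \<le> n"
  shows "inputs n (input_store (nfold_input n w b l u)) (blocks w) (\<lambda>k. b $ k) (bottom_blocks b) (blocks l) (blocks u)"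
  unfolding inputs_def
proof (intro conjI allI impI)
  note at = nfold_input_at[OF assms(1-4)]
  fix \<iota> :: env
  show "input_store (nfold_input n w b l u) (lval n \<iota> (w_in j)) = of_int (blocks w (\<iota> 0, j))" if "\<iota> 0 < n" "j < t" for j
    using at(2)[OF block_index[OF that]] by (simp add: input_store_def w_in_def)
  show "input_store (nfold_input n w b l u) (lval n \<iota> (l_in j)) = of_int (blocks l (\<iota> 0, j))" if "\<iota> 0 < n" "j < t" for j
    using at(4)[OF block_index[OF that]] by (simp add: input_store_def l_in_def algebra_simps)
  show "input_store (nfold_input n w b l u) (lval n \<iota> (u_in j)) = of_int (blocks u (\<iota> 0, j))" if "\<iota> 0 < n" "j < t" for j
    using at(5)[OF block_index[OF that]] by (simp add: input_store_def u_in_def algebra_simps)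
  show "input_store (nfold_input n w b l u) (lval n \<iota> (b_bottom k)) = of_int (bottom_blocks b (\<iota> 0, k))" if "\<iota> 0 < n" "k < s" for k
    using at(3)[of "r + (k + s * \<iota> 0)"] block_index[OF that] by (simp add: input_store_def b_bottom_def algebra_simps)
  show "input_store (nfold_input n w b l u) (lval n \<iota> (b_top k)) = of_int (b $ k)" if "k < r" for k
    using at(3)[of k] that by (simp add: input_store_def b_top_def algebra_simps)
  show "input_store (nfold_input n w b l u) (lval n \<iota> (l_in0 j)) = of_int (blocks l (0, j))" if "j < t" for j
    using at(4)[OF block_index[of 0 n j t]] n that by (simp add: input_store_def l_in0_def algebra_simps)
qed

lemma solves:
  assumes A: "A \<in> carrier_mat (r + s) t" and pos: "1 \<le> r + s + t"
  shows "\<exists>C. \<forall>n\<ge>1. \<forall>w\<in>carrier_vec (n * t). \<forall>l\<in>carrier_vec (n * t). \<forall>u\<in>carrier_vec (n * t).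
    \<forall>b\<in>carrier_vec (r + n * s). \<exists>Tm m. exec solver (nfold_input n w b l u) Tm m \<and> nfold_solved r s t A n w b l u m \<and>
      Tm \<le> C * (n ^ 3 * (binary_length_vec w + binary_length_vec b + binary_length_vec l + binary_length_vec u))"
proof -
  obtain C1 where C1: "\<forall>n \<iota> m M w bt bb l u N. 1 \<le> n \<longrightarrow> coupled W n 0 \<iota> m M \<longrightarrow> inputs n m w bt bb l u \<longrightarrow>
     (\<forall>i \<sigma> j. m (Brick i (Box \<sigma> j)) = 0) \<longrightarrow>
     (\<forall>i<n. \<forall>j<T. U0 bt bb l u True (i, j) + U0 bt bb l u False (i, j) \<le> 2 ^ N) \<longrightarrow>
     (\<exists>Tm M'. exec solver M Tm M' \<and> Tm \<le> C1 * ((N + 1) * n ^ 3) \<and>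
       (M' 0 = 1 \<and> (\<exists>z. feas n bt bb l u z \<and> (\<forall>x. feas n bt bb l u x \<longrightarrow>
            (\<Sum>i<n. \<Sum>j<t. w (i, j) * z (i, j)) \<le> (\<Sum>i<n. \<Sum>j<t. w (i, j) * x (i, j))) \<and>
          (\<forall>i<n. \<forall>j<t. M' (1 + (j + t * i)) = of_int (z (i, j)))) \<or>
        M' 0 = 0 \<and> (\<forall>x. \<not> feas n bt bb l u x)))"
    using solver_exec by (elim exE)
  \<comment> \<open>The factor from \<open>range_bound\<close>. It depends on \<open>A\<close> only,
    so its contribution to the exponent is a constant.\<close>
  define \<kappa> where "\<kappa> = 2 + (\<Sum>k<r + s. \<Sum>j<t. \<bar>A $$ (k, j)\<bar>)"
  have \<kappa>: "0 \<le> \<kappa>" "\<kappa> \<le> 2 ^ nat \<kappa>"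
  proof -
    show "0 \<le> \<kappa>" unfolding \<kappa>_def by (intro add_nonneg_nonneg sum_nonneg) auto
    have "nat \<kappa> < 2 ^ nat \<kappa>" by (rule less_exp)
    then have "int (nat \<kappa>) < int (2 ^ nat \<kappa>)" by (simp only: of_nat_less_iff)
    then show "\<kappa> \<le> 2 ^ nat \<kappa>" using \<open>0 \<le> \<kappa>\<close> by simp
  qed
  have "\<exists>Tm m. exec solver (nfold_input n w b l u) Tm m \<and> nfold_solved r s t A n w b l u m \<and>
      Tm \<le> (C1 * (nat \<kappa> + 2)) * (n ^ 3 * (binary_length_vec w + binary_length_vec b + binary_length_vec l + binary_length_vec u))"
    if n: "1 \<le> n" and w: "w \<in> carrier_vec (n * t)" and l: "l \<in> carrier_vec (n * t)" and u: "u \<in> carrier_vec (n * t)"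
      and b: "b \<in> carrier_vec (r + n * s)" for n w l u b
  proof -
    define L where "L = binary_length_vec w + binary_length_vec b + binary_length_vec l + binary_length_vec u"
    let ?bt = "\<lambda>k. b $ k" and ?bb = "bottom_blocks b" and ?l = "blocks l" and ?u = "blocks u" and ?w = "blocks w"
    have L1: "1 \<le> L"
    proof -
      have "s \<le> n * s" "t \<le> n * t" using n by simp_all
      then have "1 \<le> r + n * s + n * t" using pos by linarith
      also have "\<dots> \<le> L" using dim_le_binary_length[of b] dim_le_binary_length[of w] b w by (simp add: L_def)
      finally show ?thesis .
    qed
    define N where "N = nat \<kappa> + L"
    have range: "\<forall>i<n. \<forall>j<T. U0 ?bt ?bb ?l ?u True (i, j) + U0 ?bt ?bb ?l ?u False (i, j) \<le> 2 ^ N"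
    proof (intro allI impI)
      fix i j assume ij: "i < n" "j < T"
      have "U0 ?bt ?bb ?l ?u True (i, j) + U0 ?bt ?bb ?l ?u False (i, j) \<le> \<kappa> * 2 ^ L" unfolding \<kappa>_def
      proof (rule range_bound[OF _ _ _ _ ij])
        show "\<bar>?l (i, j)\<bar> \<le> 2 ^ L \<and> \<bar>?u (i, j)\<bar> \<le> 2 ^ L" if "i < n" "j < t" for i j
          using block_index[OF that] l u by (auto simp: L_def intro!: abs_entry_le)
        show "\<bar>b $ k\<bar> \<le> 2 ^ L" if "k < r" for k using that b by (intro abs_entry_le) (auto simp: L_def)
        show "\<bar>?bb (i, k)\<bar> \<le> 2 ^ L" if "i < n" "k < s" for i k
          using block_index[OF that] b by (auto simp: L_def intro!: abs_entry_le)
      qed simp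
      also have "\<dots> \<le> 2 ^ nat \<kappa> * 2 ^ L" using \<kappa> by (intro mult_right_mono) auto
      finally show "U0 ?bt ?bb ?l ?u True (i, j) + U0 ?bt ?bb ?l ?u False (i, j) \<le> 2 ^ N"
        by (simp add: N_def power_add)
    qed
    have box: "\<forall>i \<sigma> j. input_store (nfold_input n w b l u) (Brick i (Box \<sigma> j)) = 0" by (simp add: input_store_def)
    obtain Tm M' where ex: "exec solver (nfold_input n w b l u) Tm M'" and time: "Tm \<le> C1 * ((N + 1) * n ^ 3)"
      and res: "M' 0 = 1 \<and> (\<exists>z. feas n ?bt ?bb ?l ?u z \<and> (\<forall>x. feas n ?bt ?bb ?l ?u x \<longrightarrow>
            (\<Sum>i<n. \<Sum>j<t. ?w (i, j) * z (i, j)) \<le> (\<Sum>i<n. \<Sum>j<t. ?w (i, j) * x (i, j))) \<and>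
          (\<forall>i<n. \<forall>j<t. M' (1 + (j + t * i)) = of_int (z (i, j)))) \<or>
        M' 0 = 0 \<and> (\<forall>x. \<not> feas n ?bt ?bb ?l ?u x)"
      using C1[THEN spec[of _ n], THEN spec[of _ "\<lambda>_. 0"], THEN spec, THEN spec, THEN spec, THEN spec,
          THEN spec, THEN spec, THEN spec, THEN spec, THEN mp, OF n, THEN mp, OF input_coupled[OF n w l u b],
          THEN mp, OF input_inputs[OF w l u b n], THEN mp, OF box, THEN mp, OF range]
      by (elim exE conjE)
    have fi: "x \<in> nfold_feasible r s t A n b l u \<longleftrightarrow> feas n ?bt ?bb ?l ?u (blocks x)" if "x \<in> carrier_vec (n * t)" for x
      using nfold_feasible_iff[OF A l u b that] .
    have carrier: "x \<in> carrier_vec (n * t)" if "x \<in> nfold_feasible r s t A n b l u" for x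
      using that by (simp add: nfold_feasible_def)
    have "nfold_solved r s t A n w b l u M'"
      using res
    proof
      assume "M' 0 = 0 \<and> (\<forall>x. \<not> feas n ?bt ?bb ?l ?u x)"
      then show ?thesis using fi carrier unfolding nfold_solved_def by blast
    next
      assume *: "M' 0 = 1 \<and> (\<exists>z. feas n ?bt ?bb ?l ?u z \<and> (\<forall>x. feas n ?bt ?bb ?l ?u x \<longrightarrow>
            (\<Sum>i<n. \<Sum>j<t. ?w (i, j) * z (i, j)) \<le> (\<Sum>i<n. \<Sum>j<t. ?w (i, j) * x (i, j))) \<and>
          (\<forall>i<n. \<forall>j<t. M' (1 + (j + t * i)) = of_int (z (i, j))))"
      then obtain z where z: "feas n ?bt ?bb ?l ?u z"
        and best: "\<forall>x. feas n ?bt ?bb ?l ?u x \<longrightarrow>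
            (\<Sum>i<n. \<Sum>j<t. ?w (i, j) * z (i, j)) \<le> (\<Sum>i<n. \<Sum>j<t. ?w (i, j) * x (i, j))"
        and out: "\<forall>i<n. \<forall>j<t. M' (1 + (j + t * i)) = of_int (z (i, j))" by blast
      define x where "x = vec (n * t) (\<lambda>c. z (c div t, c mod t))"
      have x: "x \<in> carrier_vec (n * t)" by (simp add: x_def)
      have xz: "blocks x (i, j) = z (i, j)" if "i < n" "j < t" for i j
        using block_index[OF that] that by (simp add: x_def)
      have "feas n ?bt ?bb ?l ?u (blocks x) \<longleftrightarrow> feas n ?bt ?bb ?l ?u z"
        unfolding feas_def using xz by (simp del: prod.case)
      then have fx: "x \<in> nfold_feasible r s t A n b l u" using z fi[OF x] by blast
      have wx: "w \<bullet> x = (\<Sum>i<n. \<Sum>j<t. ?w (i, j) * z (i, j))"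
        unfolding cost_blocks[OF w x] using xz by (simp del: prod.case)
      have "w \<bullet> x \<le> w \<bullet> y" if "y \<in> nfold_feasible r s t A n b l u" for y
        unfolding wx cost_blocks[OF w carrier[OF that]] using best fi[OF carrier[OF that]] that by blast
      then have "nfold_optimal r s t A n w b l u x"
        unfolding nfold_optimal_def is_arg_min_def using fx by (auto simp: not_less)
      moreover have "M' (1 + c) = of_int (x $ c)" if c: "c < n * t" for c
      proof -
        obtain i j where "i < n" "j < t" "c = j + t * i" using block_cases[OF c] by blast
        then show ?thesis using out xz[of i j] by simp
      qed
      ultimately show ?thesis using * unfolding nfold_solved_def by blast
    qed
    moreover have "Tm \<le> (C1 * (nat \<kappa> + 2)) * (n ^ 3 * L)"
    proof -
      \<comment> \<open>By \<open>L \<ge> 1\<close> both constants, \<open>nat \<kappa>\<close> and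
        1, are at most the same multiples of \<open>L\<close>.\<close>
      have "N + 1 \<le> (nat \<kappa> + 2) * L"
      proof -
        have "nat \<kappa> \<le> nat \<kappa> * L" using L1 by simp
        then show ?thesis unfolding N_def distrib_right using L1 by linarith
      qed
      then have "C1 * ((N + 1) * n ^ 3) \<le> C1 * (((nat \<kappa> + 2) * L) * n ^ 3)" by (intro mult_le_mono2 mult_le_mono1)
      also have "\<dots> = (C1 * (nat \<kappa> + 2)) * (n ^ 3 * L)" by (simp only: mult_ac)
      finally show ?thesis using time by linarith
    qed
    ultimately show ?thesis using ex unfolding L_def by blast
  qed
  then show ?thesis by blast
qed

end

text \<open>With \<open>r = s = t = 0\<close> all vectors are empty, so \<open>L = 0\<close> and the
  time bound leaves no operation at all. Storing a constant at a constant address costs none, and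
  the empty vector is optimal.\<close>

lemma trivial_bimatrix:
  assumes "w \<in> carrier_vec 0" "l \<in> carrier_vec 0" "u \<in> carrier_vec 0" "b \<in> carrier_vec 0"
  shows "exec (Store (Const 0) (Const 1)) (nfold_input n w b l u) 0 ((nfold_input n w b l u)(0 := 1))"
    and "nfold_solved 0 0 0 A n w b l u ((nfold_input n w b l u)(0 := 1))"
proof -
  show "exec (Store (Const 0) (Const 1)) (nfold_input n w b l u) 0 ((nfold_input n w b l u)(0 := 1))"
    using exec.Store[of "Const 0" "nfold_input n w b l u" "Const 1"] address_of_nat[of 0] by simp
  have "u \<in> nfold_feasible 0 0 0 A n b l u"
    using assms by (auto simp: nfold_feasible_def nfold_product_def less_eq_vec_def)
  moreover have "\<not> w \<bullet> y < w \<bullet> u" if "y \<in> nfold_feasible 0 0 0 A n b l u" for y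
  proof -
    have "dim_vec y = 0" "dim_vec u = 0" using that assms by (auto simp: nfold_feasible_def)
    then show ?thesis by (simp add: scalar_prod_def)
  qed
  ultimately have "nfold_optimal 0 0 0 A n w b l u u"
    by (auto simp: nfold_optimal_def is_arg_min_def)
  then show "nfold_solved 0 0 0 A n w b l u ((nfold_input n w b l u)(0 := 1))"
    by (auto simp: nfold_solved_def)
qed

theorem theorem3p9:
  fixes A :: "int mat" and r s t :: nat
  assumes "A \<in> carrier_mat (r + s) t"
  shows "\<exists>(p :: program) (C :: nat). \<forall>n\<ge>1.
    \<forall>w \<in> carrier_vec (n * t). \<forall>l \<in> carrier_vec (n * t). \<forall>u \<in> carrier_vec (n * t).
    \<forall>b \<in> carrier_vec (r + n * s).
    \<exists>T m. exec p (nfold_input n w b l u) T m \<and> nfold_solved r s t A n w b l u m \<and>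
      T \<le> C * (n ^ 3 * (binary_length_vec w + binary_length_vec b +
                         binary_length_vec l + binary_length_vec u))"
proof (cases "1 \<le> r + s + t")
  case True
  from nfold_solver_exists[of r s t A] show ?thesis
  proof (elim exE)
    fix T E S C a1 a2 sts b1
    assume solver: "nfold_solver T E S C r s a1 a2 sts b1 t A"
    show ?thesis by (rule exI, rule nfold_solver.solves[OF solver assms True])
  qed
next
  case False
  then have z: "r = 0" "s = 0" "t = 0" by auto
  show ?thesis
  proof (rule exI[of _ "Store (Const 0) (Const 1)"], rule exI[of _ 0], intro allI ballI impI)
    fix n :: nat and w l u b :: "int vec"
    assume "w \<in> carrier_vec (n * t)" "l \<in> carrier_vec (n * t)" "u \<in> carrier_vec (n * t)" "b \<in> carrier_vec (r + n * s)"
    then show "\<exists>T m. exec (Store (Const 0) (Const 1)) (nfold_input n w b l u) T m \<and>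
        nfold_solved r s t A n w b l u m \<and>
        T \<le> 0 * (n ^ 3 * (binary_length_vec w + binary_length_vec b + binary_length_vec l + binary_length_vec u))"
      using trivial_bimatrix(1)[of w l u b n] trivial_bimatrix(2)[of w l u b A n] z by auto
  qed
qed

end
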